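(* Let $1\le p\le\infty$, let $\Lambda$ be a relatively-separated subset of $\mathbb{R}^d$, and let $\Phi=\{\phi_\lambda,\ \lambda\in\Lambda\}$ be a family of functions on $\mathbb{R}^d$ satisfying $$\text{(i)}\ \Big\|\sup_{\lambda\in\Lambda}|\phi_\lambda(\cdot+\lambda)|\,\Big\|_{\mathcal{W}_1}<\infty\qquad\text{and}\qquad\text{(ii)}\ \lim_{\delta\to0}\Big\|\sup_{\lambda\in\Lambda}|\omega_\delta(\phi_\lambda)(\cdot+\lambda)|\,\Big\|_{\mathcal{W}_1}=0.$$ If the synthesis operator $S_\Phi$ has $\ell^p$-stability, then there exists another family $\tilde\Phi=\{\tilde\phi_\lambda,\ \lambda\in\Lambda\}$ of functions on $\mathbb{R}^d$ satisfying $$\Big\|\sup_{\lambda\in\Lambda}|\tilde\phi_\lambda(\cdot+\lambda)|\,\Big\|_{\mathcal{W}_1}<\infty\qquad\text{and}\qquad\lim_{\delta\to0}\Big\|\sup_{\lambda\in\Lambda}|\omega_\delta(\tilde\phi_\lambda)(\cdot+\lambda)|\,\Big\|_{\mathcal{W}_1}=0$$ such that the inverse of the synthesis operator $S_\Phi:\ell^p(\Lambda)\to V_p(\Phi,\Lambda)$ is given by $$(S_\Phi)^{-1}f=\Big(\int_{\mathbb{R}^d}f(x)\tilde\phi_\lambda(x)\,dx\Big)_{\lambda\in\Lambda}\quad\text{for all }f\in V_p(\Phi,\Lambda).$$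
   Context: A discrete subset $\Lambda$ of $\mathbb{R}^d$ is relatively-separated if $R(\Lambda)=\sup_{x\in\mathbb{R}^d}\sum_{\lambda\in\Lambda}\chi_{\lambda+[0,1)^d}(x)<\infty$, where $\chi_E$ is the characteristic function of $E$. The modulus of continuity of a function $f$ on $\mathbb{R}^d$ is $\omega_\delta(f)(x)=\sup_{|y|\le\delta}|f(x+y)-f(x)|$, $|\cdot|$ the Euclidean norm. The Wiener amalgam norm on $\mathbb{R}^d$ is $\|\phi\|_{\mathcal{W}_1}=\sum_{k\in\mathbb{Z}^d}\sup_{x\in[0,1)^d}|\phi(k+x)|$. The synthesis operator is $S_\Phi:\ \ell^p(\Lambda)\ni(c(\lambda))_{\lambda\in\Lambda}\mapsto\sum_{\lambda\in\Lambda}c(\lambda)\phi_\lambda\in V_p(\Phi,\Lambda)$, where $V_p(\Phi,\Lambda):=\{\sum_{\lambda\in\Lambda}c(\lambda)\phi_\lambda:\ (c(\lambda))_{\lambda\in\Lambda}\in\ell^p(\Lambda)\}$. It has $\ell^p$-stability if there exists a positive constant $C$ such that $C^{-1}\|c\|_{\ell^p(\Lambda)}\le\|S_\Phi c\|_p\le C\|c\|_{\ell^p(\Lambda)}$ for all $c\in\ell^p(\Lambda)$, where $\|\cdot\|_p$ is the norm of $L^p(\mathbb{R}^d)$. *)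

theory Defs
  imports "HOL-Analysis.Analysis" "HOL-Probability.Essential_Supremum"
begin

definition unit_cube :: "(real^'n) set" where
  "unit_cube = {x. \<forall>i. 0 \<le> x $ i \<and> x $ i < 1}"

definition integer_lattice :: "(real^'n) set" where
  "integer_lattice = {k. \<forall>i. k $ i \<in> \<int>}"

definition relatively_separated :: "(real^'n) set \<Rightarrow> bool" where
  "relatively_separated \<Lambda> \<longleftrightarrow> discrete \<Lambda> \<and>
     (SUP x. \<Sum>\<^sub>\<infinity>l\<in>\<Lambda>. indicator ((+) l ` unit_cube) x :: ennreal) < \<infinity>"

text \<open>Suprema and the sum over the lattice are taken in the extended nonnegative reals, so
  the modulus of continuity and the Wiener amalgam norm exist for every function. The latter
  is applied to nonnegative functions only, namely to suprema of absolute values.\<close>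

definition modulus_of_continuity :: "real \<Rightarrow> (real^'n \<Rightarrow> complex) \<Rightarrow> real^'n \<Rightarrow> ennreal" where
  "modulus_of_continuity \<delta> f x = (SUP y\<in>{y. norm y \<le> \<delta>}. ennreal (cmod (f (x + y) - f x)))"

definition wiener_norm :: "(real^'n \<Rightarrow> ennreal) \<Rightarrow> ennreal" where
  "wiener_norm h = (\<Sum>\<^sub>\<infinity>k\<in>integer_lattice. SUP x\<in>unit_cube. h (k + x))"

text \<open>The \<open>L\<^sup>p\<close> norm over a measure space, for an exponent in \<open>[1, \<infinity>]\<close>. For a counting
  measure on a set this is the \<open>\<ell>\<^sup>p\<close> norm on that set. It is meant for measurable \<open>f\<close>.\<close>

definition Lp_norm :: "'a measure \<Rightarrow> ennreal \<Rightarrow> ('a \<Rightarrow> complex) \<Rightarrow> ennreal" where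
  "Lp_norm M p f =
     (if p = \<infinity> then esssup M (\<lambda>x. ennreal (cmod (f x)))
      else let I = (\<integral>\<^sup>+x. ennreal (cmod (f x) powr enn2real p) \<partial>M)
           in if I = \<infinity> then \<infinity> else ennreal (enn2real I powr (1 / enn2real p)))"

text \<open>A sequence indexed by \<open>\<Lambda>\<close> is represented by its extension by zero, so that equality of
  functions is equality of sequences.\<close>

definition lp_space :: "ennreal \<Rightarrow> 'a set \<Rightarrow> ('a \<Rightarrow> complex) set" where
  "lp_space p \<Lambda> = {c. (\<forall>l. l \<notin> \<Lambda> \<longrightarrow> c l = 0) \<and> Lp_norm (count_space \<Lambda>) p c < \<infinity>}"

text \<open>The series is summed pointwise. For relatively separated \<open>\<Lambda>\<close>, a family whose translated
  envelope has finite Wiener amalgam norm, and bounded \<open>c\<close>, it converges absolutely at every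
  point.\<close>

definition synthesis ::
    "'a set \<Rightarrow> ('a \<Rightarrow> real^'n \<Rightarrow> complex) \<Rightarrow> ('a \<Rightarrow> complex) \<Rightarrow> real^'n \<Rightarrow> complex" where
  "synthesis \<Lambda> \<phi> c = (\<lambda>x. \<Sum>\<^sub>\<infinity>l\<in>\<Lambda>. c l * \<phi> l x)"

definition synthesis_space ::
    "ennreal \<Rightarrow> 'a set \<Rightarrow> ('a \<Rightarrow> real^'n \<Rightarrow> complex) \<Rightarrow> (real^'n \<Rightarrow> complex) set" where
  "synthesis_space p \<Lambda> \<phi> = synthesis \<Lambda> \<phi> ` lp_space p \<Lambda>"

definition lp_stable :: "ennreal \<Rightarrow> 'a set \<Rightarrow> ('a \<Rightarrow> real^'n \<Rightarrow> complex) \<Rightarrow> bool" where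
  "lp_stable p \<Lambda> \<phi> \<longleftrightarrow> (\<exists>C::real. C > 0 \<and> (\<forall>c\<in>lp_space p \<Lambda>.
     ennreal (inverse C) * Lp_norm (count_space \<Lambda>) p c \<le> Lp_norm lborel p (synthesis \<Lambda> \<phi> c) \<and>
     Lp_norm lborel p (synthesis \<Lambda> \<phi> c) \<le> ennreal C * Lp_norm (count_space \<Lambda>) p c))"

end

theory Submission
  imports Defs "HOL-Real_Asymp.Real_Asymp"
begin

text \<open>The family is sampled on a fine grid: averages of the \<open>\<phi> l\<close> against grid bumps form a matrix
  \<open>A\<close> with summable off-diagonal envelope, and by uniform continuity stability of the synthesis
  operator gives \<open>\<parallel>c\<parallel>\<^sub>p \<le> K \<parallel>A c\<parallel>\<^sub>p\<close>. Cutting off with slowly varying windows and absorbing the commutator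
  by a Neumann series localizes this to \<open>\<bar>c l\<bar> \<le> \<Sum>\<^sub>i W (i - l) \<bar>(A c) i\<bar>\<close> with \<open>W\<close> summable, whatever \<open>p\<close> is.
  By Hahn--Banach in this weighted \<open>\<ell>\<^sup>1\<close> norm the functional \<open>A c \<mapsto> c l\<close> is a sum \<open>\<Sum>\<^sub>i b\<^sub>i (A c) i\<close> with
  \<open>\<bar>b\<^sub>i\<bar> \<le> 2 W (i - l)\<close>, and superposing the bumps with coefficients \<open>b\<close> gives the dual function. No
  passage to \<open>\<ell>\<^sup>2\<close> or to the Gram matrix is needed.\<close>

section \<open>Linear functionals below a sublinear functional\<close>

text \<open>Stability controls a coefficient only through a global norm, while a dual function needs
  an envelope around \<open>l\<close> that is summable and uniform in \<open>l\<close>; hence the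
  detour through a pointwise estimate. The envelope of the matrix is merely summable, with no rate
  of decay, so the smallness of the commutator with wide windows comes from dominated convergence.
  The pointwise estimate involves absolute values and gives no formula for \<open>c l\<close>;
  Hahn--Banach makes it linear and hands the weight on to the coefficients. The bumps are Lipschitz
  and live on disjoint grid cells, so both conditions on the dual family follow from the summability
  of \<open>W\<close>.

  Up to the construction of the dual coefficients, \<open>c\<close> has finite support. This
  provides the finiteness on which the absorption of error terms and the Neumann iteration rest.
  Such sequences are not dense when \<open>p\<close> is infinite, so the inverse formula is not
  reached by a limit: the integrals of \<open>\<phi> l' * \<psi> l\<close> are 0 or 1, and the
  relations are multiplied by \<open>c l'\<close> and summed, which absolute convergence permits for
  every bounded \<open>c\<close>.\<close>

definition sublinear :: "('v::real_vector \<Rightarrow> real) \<Rightarrow> bool" where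
  "sublinear q \<longleftrightarrow> (\<forall>x y. q (x + y) \<le> q x + q y) \<and> (\<forall>t x. 0 \<le> t \<longrightarrow> q (t *\<^sub>R x) = t * q x)"

lemma sublinearI:
  assumes "\<And>x y. q (x + y) \<le> q x + q y" and "\<And>t x. 0 < t \<Longrightarrow> q (t *\<^sub>R x) \<le> t * q x" and "q 0 = 0"
  shows "sublinear q"
  unfolding sublinear_def
proof (intro conjI allI impI)
  fix t :: real and x assume "0 \<le> t"
  show "q (t *\<^sub>R x) = t * q x"
  proof (cases "t = 0")
    case False
    then have t: "0 < t" using \<open>0 \<le> t\<close> by simp
    have "q (inverse t *\<^sub>R (t *\<^sub>R x)) \<le> inverse t * q (t *\<^sub>R x)"
      by (rule assms(2)) (use t in simp)
    then have "t * q x \<le> q (t *\<^sub>R x)" using t by (simp add: field_simps)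
    then show ?thesis using assms(2)[OF t, of x] by simp
  qed (simp add: assms(3))
qed (rule assms(1))

lemma sublinear_add: "sublinear q \<Longrightarrow> q (x + y) \<le> q x + q y"
  and sublinear_scale: "sublinear q \<Longrightarrow> 0 \<le> t \<Longrightarrow> q (t *\<^sub>R x) = t * q x"
  by (simp_all add: sublinear_def)

lemma sublinear_zero: "sublinear q \<Longrightarrow> q 0 = 0"
  using sublinear_scale[of q 0 0] by simp

lemma sublinear_minus: "sublinear q \<Longrightarrow> - q (- x) \<le> q x"
  using sublinear_add[of q x "- x"] by (simp add: sublinear_zero)

text \<open>The \<open>q\<close>-infimal convolution with a convex cone of pairs \<open>(v, r)\<close>: the largest sublinear
  functional below \<open>q\<close> whose value at \<open>- v\<close> is at most \<open>- r\<close>.\<close>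

definition cone_reduct :: "('v::real_vector \<Rightarrow> real) \<Rightarrow> ('v \<times> real) set \<Rightarrow> 'v \<Rightarrow> real" where
  "cone_reduct q S x = (INF (v, r)\<in>S. q (x + v) - r)"

lemma
  assumes q: "sublinear q" and S: "convex_cone S" and S_le: "\<forall>(v, r)\<in>S. r \<le> q v"
  shows sublinear_cone_reduct: "sublinear (cone_reduct q S)"
    and cone_reduct_le: "\<And>x v r. (v, r) \<in> S \<Longrightarrow> cone_reduct q S x \<le> q (x + v) - r"
proof -
  have S0: "(0, 0) \<in> S" using convex_cone_contains_0[OF S] by (simp add: zero_prod_def)
  have Sadd: "(v + w, r + s) \<in> S" if "(v, r) \<in> S" "(w, s) \<in> S" for v r w s
    using convex_cone_add[OF S that] by simp
  have Sscale: "(t *\<^sub>R v, t * r) \<in> S" if "0 < t" "(v, r) \<in> S" for t v r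
    using convex_cone_scaleR[OF S _ that(2), of t] that(1) by simp
  have Sle: "r \<le> q v" if "(v, r) \<in> S" for v r using S_le that by auto
  have below: "- q (- x) \<le> q (x + v) - r" if "(v, r) \<in> S" for x v r
    using Sle[OF that] sublinear_add[OF q, of "- x" "x + v"] by simp
  then have bdd: "bdd_below ((\<lambda>(v, r). q (x + v) - r) ` S)" for x
    by (intro bdd_belowI[of _ "- q (- x)"]) auto
  show le: "cone_reduct q S x \<le> q (x + v) - r" if "(v, r) \<in> S" for x v r
    unfolding cone_reduct_def using cINF_lower[OF bdd[of x] that] by simp
  have ge: "c \<le> cone_reduct q S x" if "\<And>v r. (v, r) \<in> S \<Longrightarrow> c \<le> q (x + v) - r" for c x
    unfolding cone_reduct_def using that S0 by (intro cINF_greatest) auto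
  show "sublinear (cone_reduct q S)"
  proof (rule sublinearI)
    fix x y
    have "cone_reduct q S (x + y) - (q (x + v) - r) \<le> cone_reduct q S y" if v: "(v, r) \<in> S" for v r
    proof (rule ge)
      fix w s assume w: "(w, s) \<in> S"
      show "cone_reduct q S (x + y) - (q (x + v) - r) \<le> q (y + w) - s"
        using le[OF Sadd[OF v w], of "x + y"] sublinear_add[OF q, of "x + v" "y + w"]
        by (simp add: algebra_simps)
    qed
    then have "cone_reduct q S (x + y) - cone_reduct q S y \<le> cone_reduct q S x"
      by (intro ge) (simp add: algebra_simps)
    then show "cone_reduct q S (x + y) \<le> cone_reduct q S x + cone_reduct q S y" by simp
  next
    fix t :: real and x assume t: "0 < t"
    have "cone_reduct q S (t *\<^sub>R x) / t \<le> q (x + v) - r" if v: "(v, r) \<in> S" for v r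
    proof -
      have "cone_reduct q S (t *\<^sub>R x) \<le> q (t *\<^sub>R x + t *\<^sub>R v) - t * r"
        by (rule le[OF Sscale[OF t v]])
      also have "\<dots> = t * (q (x + v) - r)"
        using t by (simp add: sublinear_scale[OF q] scaleR_add_right[symmetric] right_diff_distrib)
      finally show ?thesis using t by (simp add: field_simps)
    qed
    then have "cone_reduct q S (t *\<^sub>R x) / t \<le> cone_reduct q S x" by (rule ge)
    then show "cone_reduct q S (t *\<^sub>R x) \<le> t * cone_reduct q S x" using t by (simp add: field_simps)
  next
    have "cone_reduct q S 0 \<le> 0" using le[OF S0, of 0] by (simp add: sublinear_zero[OF q])
    moreover have "0 \<le> cone_reduct q S 0" by (rule ge) (use Sle in simp)
    ultimately show "cone_reduct q S 0 = 0" by simp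
  qed
qed

text \<open>Minimality is tested against the reduct by the ray through \<open>(y, q y)\<close>.\<close>

lemma minimal_sublinear_linear:
  fixes q :: "'v::real_vector \<Rightarrow> real"
  assumes q: "sublinear q" and min: "\<And>q'. sublinear q' \<Longrightarrow> (\<And>x. q' x \<le> q x) \<Longrightarrow> q' = q"
  shows "linear q"
proof -
  have add: "q (x + y) = q x + q y" for x y
  proof -
    define S where "S = {(t *\<^sub>R y, t * q y) | t. 0 \<le> t}"
    have S: "convex_cone S" unfolding convex_cone_iff
    proof (intro conjI ballI allI impI)
      show "0 \<in> S" by (auto simp: S_def zero_prod_def intro!: exI[of _ 0])
    next
      fix v w assume "v \<in> S" "w \<in> S"
      then obtain a b where "v = (a *\<^sub>R y, a * q y)" "w = (b *\<^sub>R y, b * q y)" "0 \<le> a" "0 \<le> b"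
        by (auto simp: S_def)
      then show "v + w \<in> S" unfolding S_def by (auto intro!: exI[of _ "a + b"] simp: algebra_simps)
    next
      fix v and t :: real assume "v \<in> S" "0 \<le> t"
      then obtain a where "v = (a *\<^sub>R y, a * q y)" "0 \<le> a" by (auto simp: S_def)
      then show "t *\<^sub>R v \<in> S" using \<open>0 \<le> t\<close> unfolding S_def by (auto intro!: exI[of _ "t * a"])
    qed
    have S_le: "\<forall>(v, r)\<in>S. r \<le> q v"
      by (auto simp: S_def sublinear_scale[OF q])
    have Sy: "(y, q y) \<in> S" by (auto simp: S_def intro!: exI[of _ 1])
    have S0: "(0, 0) \<in> S" by (auto simp: S_def intro!: exI[of _ 0])
    have "sublinear (cone_reduct q S)" by (rule sublinear_cone_reduct[OF q S S_le])
    moreover have "cone_reduct q S x \<le> q x" for x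
      using cone_reduct_le[OF q S S_le S0, of x] by simp
    ultimately have "cone_reduct q S = q" by (rule min)
    then have "q x \<le> q (x + y) - q y" using cone_reduct_le[OF q S S_le Sy, of x] by simp
    then show ?thesis using sublinear_add[OF q, of x y] by simp
  qed
  have "q (- x) = - q x" for x using add[of x "- x"] by (simp add: sublinear_zero[OF q])
  then have scale: "q (t *\<^sub>R x) = t * q x" for t x
    using sublinear_scale[OF q, of t x] sublinear_scale[OF q, of "- t" "- x"]
    by (cases "0 \<le> t") simp_all
  show ?thesis by (rule linearI) (simp_all add: add scale)
qed

text \<open>The infimum is finite because \<open>- p (- x)\<close> lies below every member.
  Comparability enters in subadditivity: for two members \<open>q\<close> and \<open>q'\<close>, the
  smaller one is used at both \<open>x\<close> and \<open>y\<close>.\<close>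

lemma sublinear_chain_Inf:
  assumes C: "C \<noteq> {}" "\<And>q. q \<in> C \<Longrightarrow> sublinear q \<and> (\<forall>x. q x \<le> p x)"
    and tot: "\<And>q q'. q \<in> C \<Longrightarrow> q' \<in> C \<Longrightarrow> (\<forall>x. q x \<le> q' x) \<or> (\<forall>x. q' x \<le> q x)"
  shows "sublinear (\<lambda>x. INF q\<in>C. q x)" "\<And>q x. q \<in> C \<Longrightarrow> (INF q\<in>C. q x) \<le> q x"
proof -
  have "- p (- x) \<le> q x" if "q \<in> C" for q x
    using C(2)[OF that] sublinear_minus[of q x] by (smt (verit))
  then have bdd: "bdd_below ((\<lambda>q. q x) ` C)" for x
    by (intro bdd_belowI[of _ "- p (- x)"]) auto
  show le: "(INF q\<in>C. q x) \<le> q x" if "q \<in> C" for q x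
    by (rule cINF_lower[OF bdd that])
  have ge: "c \<le> (INF q\<in>C. q x)" if "\<And>q. q \<in> C \<Longrightarrow> c \<le> q x" for c x
    using that C(1) by (intro cINF_greatest)
  show "sublinear (\<lambda>x. INF q\<in>C. q x)"
  proof (rule sublinearI)
    fix x y
    have *: "(INF q\<in>C. q (x + y)) \<le> q x + q' y" if "q \<in> C" "q' \<in> C" for q q'
    proof -
      from tot[OF that] show ?thesis
      proof
        assume "\<forall>x. q x \<le> q' x"
        then show ?thesis using le[OF that(1), of "x + y"] C(2)[OF that(1)] sublinear_add[of q x y]
          by (smt (verit))
      next
        assume "\<forall>x. q' x \<le> q x"
        then show ?thesis using le[OF that(2), of "x + y"] C(2)[OF that(2)] sublinear_add[of q' x y]
          by (smt (verit))
      qed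
    qed
    have "(INF q\<in>C. q (x + y)) - q x \<le> (INF q\<in>C. q y)" if "q \<in> C" for q
      by (rule ge) (use *[OF that] in \<open>simp add: algebra_simps\<close>)
    then have "(INF q\<in>C. q (x + y)) - (INF q\<in>C. q y) \<le> (INF q\<in>C. q x)"
      by (intro ge) (simp add: algebra_simps)
    then show "(INF q\<in>C. q (x + y)) \<le> (INF q\<in>C. q x) + (INF q\<in>C. q y)" by simp
  next
    fix t :: real and x assume t: "0 < t"
    have "(INF q\<in>C. q (t *\<^sub>R x)) / t \<le> (INF q\<in>C. q x)"
    proof (rule ge)
      fix q assume "q \<in> C"
      then have "(INF q\<in>C. q (t *\<^sub>R x)) \<le> t * q x"
        using le[of q "t *\<^sub>R x"] C(2)[of q] sublinear_scale[of q t x] t by simp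
      then show "(INF q\<in>C. q (t *\<^sub>R x)) / t \<le> q x" using t by (simp add: field_simps)
    qed
    then show "(INF q\<in>C. q (t *\<^sub>R x)) \<le> t * (INF q\<in>C. q x)" using t by (simp add: field_simps)
  next
    have "(\<lambda>q. q 0) ` C = {0}" using C sublinear_zero by (auto simp: image_iff)
    then show "(INF q\<in>C. q 0) = 0" by simp
  qed
qed

lemma ex_linear_le_sublinear:
  fixes p :: "'v::real_vector \<Rightarrow> real"
  assumes p: "sublinear p"
  obtains f where "linear f" "\<And>x. f x \<le> p x"
proof -
  define A where "A = {q. sublinear q \<and> (\<forall>x. q x \<le> p x)}"
  \<comment> \<open>The order is reversed: Zorn's lemma yields maximal elements, while a minimal
    functional is wanted.\<close>
  define P where "P q q' \<longleftrightarrow> (\<forall>x. q' x \<le> q x)" for q q' :: "'v \<Rightarrow> real"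
  have po: "partial_order_on A (relation_of P A)"
    by (rule partial_order_on_relation_ofI) (auto simp: P_def fun_eq_iff intro: order_trans antisym)
  have "\<exists>u\<in>A. \<forall>a\<in>C. P a u" if C: "C \<in> Chains (relation_of P A)" for C
  proof (cases "C = {}")
    case True
    then show ?thesis using p by (auto simp: A_def)
  next
    case False
    have CA: "C \<subseteq> A" using C by (auto simp: Chains_def relation_of_def)
    have tot: "(\<forall>x. q x \<le> q' x) \<or> (\<forall>x. q' x \<le> q x)" if "q \<in> C" "q' \<in> C" for q q'
      using C that by (auto simp: Chains_def relation_of_def P_def)
    have sub: "sublinear q \<and> (\<forall>x. q x \<le> p x)" if "q \<in> C" for q using CA that by (auto simp: A_def)
    have inf_le: "(INF q\<in>C. q x) \<le> q x" if "q \<in> C" for q x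
      using False sub tot that by (rule sublinear_chain_Inf(2))
    obtain q0 where q0: "q0 \<in> C" using False by auto
    have "(INF q\<in>C. q x) \<le> p x" for x
      using order_trans[OF inf_le[OF q0, of x]] sub[OF q0] by blast
    moreover have "sublinear (\<lambda>x. INF q\<in>C. q x)"
      using False sub tot by (rule sublinear_chain_Inf(1))
    ultimately have "(\<lambda>x. INF q\<in>C. q x) \<in> A" unfolding A_def by blast
    moreover have "\<forall>a\<in>C. P a (\<lambda>x. INF q\<in>C. q x)" unfolding P_def using inf_le by blast
    ultimately show ?thesis by blast
  qed
  then obtain q where q: "q \<in> A" and max: "\<And>a. a \<in> A \<Longrightarrow> P q a \<Longrightarrow> a = q"
    using predicate_Zorn[OF po] by blast
  have "linear q"
  proof (rule minimal_sublinear_linear)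
    show "sublinear q" using q by (simp add: A_def)
    fix q' assume "sublinear q'" "\<And>x. q' x \<le> q x"
    then show "q' = q" using q by (intro max) (auto simp: A_def P_def intro: order_trans)
  qed
  then show ?thesis using q by (intro that) (auto simp: A_def)
qed

text \<open>Any linear functional below the reduct works: it is below \<open>p\<close> since
  \<open>(0, 0)\<close> is in the cone, and its value at \<open>- v\<close> is at most
  \<open>- r\<close>, which is the lower bound at \<open>v\<close>. On a cone closed under negation
  the lower bounds become prescribed values; the dual coefficients arise in this way.\<close>

theorem Mazur_Orlicz:
  fixes p :: "'v::real_vector \<Rightarrow> real"
  assumes p: "sublinear p" and S: "convex_cone S" and S_le: "\<forall>(v, r)\<in>S. r \<le> p v"
  obtains f where "linear f" "\<And>x. f x \<le> p x" "\<And>v r. (v, r) \<in> S \<Longrightarrow> r \<le> f v"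
proof -
  note le = cone_reduct_le[OF assms]
  obtain f where f: "linear f" "\<And>x. f x \<le> cone_reduct p S x"
    using ex_linear_le_sublinear[OF sublinear_cone_reduct[OF assms]] by blast
  have "(0, 0) \<in> S" using convex_cone_contains_0[OF S] by (simp add: zero_prod_def)
  then have "f x \<le> p x" for x using f(2)[of x] le[of 0 0 x] by simp
  moreover have "r \<le> f v" if "(v, r) \<in> S" for v r
    using f(2)[of "- v"] le[OF that, of "- v"] linear_neg[OF f(1), of v] sublinear_zero[OF p] by simp
  ultimately show ?thesis using f(1) that by blast
qed

section \<open>Sums and norms of sequences\<close>

abbreviation nsum :: "('i \<Rightarrow> ennreal) \<Rightarrow> ennreal" where
  "nsum f \<equiv> integral\<^sup>N (count_space UNIV) f"

lemma nsum_swap: "nsum (\<lambda>i. nsum (\<lambda>j. f i j)) = nsum (\<lambda>j. nsum (\<lambda>i. f i j))"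
  using nn_integral_fst_count_space[of "\<lambda>(i, j). f i j"]
    nn_integral_snd_count_space[of "\<lambda>(i, j). f i j"] by simp

lemma nsum_reindex: "bij g \<Longrightarrow> nsum (\<lambda>i. f (g i)) = nsum f"
  by (rule nn_integral_bij_count_space)

lemma bij_shift: "bij (\<lambda>k. k + i)" "bij (\<lambda>k. i + k)" "bij (\<lambda>k. k - i)" "bij (\<lambda>k. i - k)"
  for i :: "'a::ab_group_add"
proof -
  show "bij (\<lambda>k. k + i)" by (rule bij_betw_byWitness[where f' = "\<lambda>k. k - i"]) auto
  show "bij (\<lambda>k. i + k)" by (rule bij_betw_byWitness[where f' = "\<lambda>k. k - i"]) auto
  show "bij (\<lambda>k. k - i)" by (rule bij_betw_byWitness[where f' = "\<lambda>k. k + i"]) auto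
  show "bij (\<lambda>k. i - k)" by (rule bij_betw_byWitness[where f' = "\<lambda>k. i - k"]) auto
qed

lemma nsum_shift:
  fixes i :: "'a::ab_group_add"
  shows "nsum (\<lambda>k. f (k + i)) = nsum f" "nsum (\<lambda>k. f (i + k)) = nsum f"
    "nsum (\<lambda>k. f (k - i)) = nsum f" "nsum (\<lambda>k. f (i - k)) = nsum f"
  by (rule nsum_reindex[OF bij_shift(1)], rule nsum_reindex[OF bij_shift(2)],
      rule nsum_reindex[OF bij_shift(3)], rule nsum_reindex[OF bij_shift(4)])

lemma nsum_ge: "f i \<le> nsum f"
  using nn_integral_ge_point[of i UNIV f] by simp

lemma nsum_mono: "(\<And>i. f i \<le> g i) \<Longrightarrow> nsum f \<le> nsum g"
  by (simp add: nn_integral_mono)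

lemma nsum_cmult: "nsum (\<lambda>i. c * f i) = c * nsum f" "nsum (\<lambda>i. f i * c) = nsum f * c"
  by (simp_all add: nn_integral_cmult nn_integral_multc)

lemma nsum_add: "nsum (\<lambda>i. f i + g i) = nsum f + nsum g"
  by (simp add: nn_integral_add)

lemma nsum_sum: "nsum (\<lambda>i. \<Sum>e\<in>E. f e i) = (\<Sum>e\<in>E. nsum (f e))"
  by (simp add: nn_integral_sum)

lemma nsum_finite_support:
  "finite A \<Longrightarrow> (\<And>i. i \<notin> A \<Longrightarrow> f i = 0) \<Longrightarrow> nsum f = sum f A"
  by (rule nn_integral_count_space') auto

lemma nsum_single: "nsum (\<lambda>i. if i = a then f i else 0) = f a"
  using nsum_finite_support[of "{a}" "\<lambda>i. if i = a then f i else 0"] by simp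

section \<open>Powers of extended nonnegative reals and Minkowski's inequality\<close>

text \<open>Infinity is fixed, as in the case split inside \<open>Lp_norm\<close>. For finite
  exponents a p-norm thus becomes one expression without cases, and powers are multiplicative on all
  of \<open>ennreal\<close>.\<close>

definition npow :: "real \<Rightarrow> ennreal \<Rightarrow> ennreal" where
  "npow r x = (if x = \<infinity> then \<infinity> else ennreal (enn2real x powr r))"

lemma npow_ennreal: "0 \<le> x \<Longrightarrow> npow r (ennreal x) = ennreal (x powr r)"
  by (simp add: npow_def)

lemma npow_top [simp]: "npow r top = top"
  by (simp add: npow_def)

lemma npow_zero [simp]: "npow r 0 = 0"
  by (simp add: npow_def)

lemma npow_eq_zero_iff [simp]: "npow r x = 0 \<longleftrightarrow> x = 0"
  by (cases x) (auto simp: npow_ennreal)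

lemma npow_eq_top_iff [simp]: "npow r x = top \<longleftrightarrow> x = top"
  by (simp add: npow_def)

lemma npow_mono: "0 \<le> r \<Longrightarrow> x \<le> y \<Longrightarrow> npow r x \<le> npow r y"
  by (cases x; cases y) (auto simp: npow_ennreal powr_mono2 top_unique)

lemma npow_mult: "npow r (x * y) = npow r x * npow r y"
  by (cases x; cases y)
    (auto simp: npow_ennreal powr_mult ennreal_mult'[symmetric] ennreal_mult_top ennreal_top_mult)

lemma npow_npow: "npow r (npow s x) = npow (r * s) x"
  by (cases x) (auto simp: npow_ennreal powr_powr mult.commute)

lemma npow_1 [simp]: "npow 1 x = x"
  by (cases x) (auto simp: npow_ennreal)

lemma Young_power_real:
  fixes x y r :: real
  assumes "0 < x" "0 \<le> y" "1 \<le> r"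
  shows "r * x powr (r - 1) * y \<le> y powr r + (r - 1) * x powr r"
proof (cases "r = 1")
  case True
  then show ?thesis using assms by simp
next
  case False
  define q where "q = r / (r - 1)"
  have r: "r > 1" using False assms by simp
  have "y * x powr (r - 1) \<le> y powr r / r + (x powr (r - 1)) powr q / q"
    using r assms by (intro Youngs_inequality) (auto simp: q_def field_simps)
  moreover have "(x powr (r - 1)) powr q = x powr r"
    using r by (simp add: powr_powr q_def)
  ultimately have le: "r * (y * x powr (r - 1)) \<le> r * (y powr r / r + x powr r / q)"
    using r by (intro mult_left_mono) auto
  have "r * (y powr r / r) = y powr r" "r * (x powr r / q) = (r - 1) * x powr r"
    using r by (simp_all add: q_def)
  then have "r * (y powr r / r + x powr r / q) = y powr r + (r - 1) * x powr r"
    by (simp only: distrib_left)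
  with le show ?thesis by (simp add: mult_ac)
qed

text \<open>Young's inequality with the mean as the second argument is the tangent line bound, so
  integrating it gives Jensen's inequality, with all terms nonnegative.\<close>

lemma npow_Jensen:
  assumes r: "1 \<le> r" and \<theta>: "nsum \<theta> \<le> 1"
  shows "npow r (nsum (\<lambda>i. \<theta> i * y i)) \<le> nsum (\<lambda>i. \<theta> i * npow r (y i))"
proof -
  define x where "x = nsum (\<lambda>i. \<theta> i * y i)"
  define B where "B = nsum (\<lambda>i. \<theta> i * npow r (y i))"
  consider "x = top" | "x = 0" | t where "x = ennreal t" "t > 0"
    by (cases x) (auto simp: less_le ennreal_0[symmetric] simp del: ennreal_0)
  then show ?thesis
  proof cases
    case 1
    \<comment> \<open>As the total weight is finite, this makes the mean of the powers infinite as
      soon as the mean itself is.\<close>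
    have "y i \<le> 1 + npow r (y i)" for i
    proof (cases "y i")
      case (real t)
      have "t \<le> 1 + t powr r"
        using real r ge_one_powr_ge_zero powr_mono[of 1 r t]
        by (cases "t \<le> 1") (auto intro: order_trans)
      then show ?thesis using real
        by (simp add: npow_ennreal ennreal_1[symmetric] ennreal_plus[symmetric] del: ennreal_1 ennreal_plus)
    qed simp
    then have "x \<le> nsum (\<lambda>i. \<theta> i * (1 + npow r (y i)))"
      unfolding x_def by (intro nsum_mono mult_left_mono) auto
    also have "\<dots> = nsum \<theta> + B" by (simp add: distrib_left nsum_add B_def)
    finally have "B = top" using 1 \<theta> by (auto simp: top_unique)
    then show ?thesis by (simp add: B_def)
  next
    case 2
    then show ?thesis by (simp add: x_def)
  next
    case 3
    have Y: "ennreal (r * t powr (r - 1)) * y i \<le> npow r (y i) + ennreal ((r - 1) * t powr r)" for i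
    proof (cases "y i")
      case (real s)
      then show ?thesis using Young_power_real[of t s r] 3 r
        by (simp add: npow_ennreal ennreal_mult'[symmetric] ennreal_plus[symmetric] del: ennreal_plus)
    qed simp
    have "ennreal (r * t powr r) = ennreal (r * t powr (r - 1)) * x"
      using 3 r by (simp add: ennreal_mult'[symmetric] powr_diff)
    also have "\<dots> = nsum (\<lambda>i. \<theta> i * (ennreal (r * t powr (r - 1)) * y i))"
      unfolding x_def nsum_cmult(1)[symmetric] by (simp add: mult_ac)
    also have "\<dots> \<le> nsum (\<lambda>i. \<theta> i * (npow r (y i) + ennreal ((r - 1) * t powr r)))"
      by (intro nsum_mono mult_left_mono Y) auto
    also have "\<dots> = B + nsum \<theta> * ennreal ((r - 1) * t powr r)"
      by (simp add: distrib_left nsum_add B_def nsum_cmult)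
    also have "\<dots> \<le> B + 1 * ennreal ((r - 1) * t powr r)"
      by (intro add_left_mono mult_right_mono \<theta>) auto
    finally have *: "ennreal (r * t powr r) \<le> B + ennreal ((r - 1) * t powr r)" by simp
    have "ennreal (t powr r) \<le> B"
    proof (cases B)
      case (real b)
      have "r * t powr r \<le> b + (r - 1) * t powr r"
        using * real r 3 by (simp add: ennreal_plus[symmetric] del: ennreal_plus)
      then show ?thesis using real by (simp add: algebra_simps)
    qed simp
    then show ?thesis using 3 by (simp add: x_def[symmetric] B_def[symmetric] npow_ennreal)
  qed
qed

definition seq_norm :: "ennreal \<Rightarrow> ('k \<Rightarrow> ennreal) \<Rightarrow> ennreal" where
  "seq_norm p X = (if p = \<infinity> then (SUP k. X k)
     else npow (1 / enn2real p) (nsum (\<lambda>k. npow (enn2real p) (X k))))"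

lemma enn2real_ge_1: "1 \<le> p \<Longrightarrow> p \<noteq> \<infinity> \<Longrightarrow> 1 \<le> enn2real p"
  by (cases p) auto

lemma seq_norm_mono: "(\<And>k. X k \<le> Y k) \<Longrightarrow> seq_norm p X \<le> seq_norm p Y"
  unfolding seq_norm_def
  by (auto intro!: npow_mono nsum_mono SUP_mono')

lemma seq_norm_ge:
  assumes "1 \<le> p"
  shows "X k \<le> seq_norm p X"
proof (cases "p = \<infinity>")
  case False
  then have r: "1 \<le> enn2real p" using assms by (rule enn2real_ge_1[rotated])
  have "X k = npow (1 / enn2real p) (npow (enn2real p) (X k))"
    using r by (simp add: npow_npow)
  also have "\<dots> \<le> npow (1 / enn2real p) (nsum (\<lambda>k. npow (enn2real p) (X k)))"
    using r by (intro npow_mono nsum_ge[of "\<lambda>k. npow (enn2real p) (X k)"]) auto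
  finally show ?thesis using False by (simp add: seq_norm_def)
qed (auto simp: seq_norm_def intro: SUP_upper)

lemma seq_norm_shift:
  fixes i :: "'a::ab_group_add"
  shows "seq_norm p (\<lambda>k. X (k - i)) = seq_norm p X"
proof -
  have "range (\<lambda>k. X (k - i)) = range X"
    using bij_shift(3)[of i] by (metis bij_def image_image)
  then show ?thesis
    by (simp add: seq_norm_def nsum_shift(3)[of "\<lambda>k. npow (enn2real p) (X k)"])
qed

lemma seq_norm_cmult: 
  assumes "1 \<le> p"
  shows "seq_norm p (\<lambda>k. c * X k) = c * seq_norm p X"
proof (cases "p = \<infinity>")
  case False
  then have r: "1 \<le> enn2real p" using assms by (rule enn2real_ge_1[rotated])
  then show ?thesis using False
    by (simp add: seq_norm_def npow_mult nsum_cmult npow_npow)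
qed (simp add: seq_norm_def SUP_mult_left_ennreal)

text \<open>Minkowski's inequality. With \<open>t i\<close> the norm of \<open>X i\<close> and
  \<open>T\<close> the sum of these norms, the sum over \<open>i\<close> is \<open>T\<close> times
  an average, with weights \<open>t i / T\<close>, of the normalized sequences
  \<open>X i k / t i\<close>. Jensen's inequality at each \<open>k\<close> and an exchange of sums
  give the bound.\<close>

lemma seq_norm_nsum:
  assumes "1 \<le> p"
  shows "seq_norm p (\<lambda>k. nsum (\<lambda>i. X i k)) \<le> nsum (\<lambda>i. seq_norm p (X i))"
proof (cases "p = \<infinity>")
  case True
  have "nsum (\<lambda>i. X i k) \<le> nsum (\<lambda>i. seq_norm p (X i))" for k
    by (intro nsum_mono seq_norm_ge assms)
  moreover have "seq_norm p (\<lambda>k. nsum (\<lambda>i. X i k)) = (SUP k. nsum (\<lambda>i. X i k))"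
    using True by (simp add: seq_norm_def)
  ultimately show ?thesis by (simp only: SUP_least)
next
  case False
  define r where "r = enn2real p"
  have r: "1 \<le> r" using assms False unfolding r_def by (rule enn2real_ge_1)
  define t where "t i = seq_norm p (X i)" for i
  define T where "T = nsum t"
  consider "T = top" | "T = 0" | "T \<noteq> 0" "T \<noteq> top" by blast
  then show ?thesis
  proof cases
    case 2
    then have "t i = 0" for i using nsum_ge[of t i] by (simp add: T_def)
    then have "X i k = 0" for i k using seq_norm_ge[OF assms, of "X i" k] by (simp add: t_def)
    then show ?thesis using False by (simp add: seq_norm_def)
  next
    case 3
    have tfin: "t i \<noteq> top" for i using nsum_ge[of t i] 3 by (auto simp: T_def[symmetric] top_unique)
    \<comment> \<open>Vanishing norms are no exception: the whole sequence \<open>X i\<close> is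
      then zero.\<close>
    have Xt: "X i k = t i * (X i k / t i)" for i k
    proof (cases "t i = 0")
      case True
      then show ?thesis using seq_norm_ge[OF assms, of "X i" k] by (simp add: t_def)
    next
      case False
      then show ?thesis using tfin[of i]
        by (simp add: ennreal_times_divide mult.commute[of "t i"] mult_divide_eq_ennreal)
    qed
    have Y: "t i * nsum (\<lambda>k. npow r (X i k / t i)) \<le> t i" for i
    proof (cases "t i = 0")
      case False
      have "npow r (t i) = nsum (\<lambda>k. npow r (X i k))"
        using \<open>p \<noteq> \<infinity>\<close> r by (simp add: t_def seq_norm_def r_def npow_npow)
      also have "\<dots> = npow r (t i) * nsum (\<lambda>k. npow r (X i k / t i))"
        unfolding nsum_cmult[symmetric] npow_mult[symmetric] Xt[symmetric] ..
      finally have "nsum (\<lambda>k. npow r (X i k / t i)) = 1"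
        using False tfin[of i]
        by (metis ennreal_mult_cancel_left mult.right_neutral npow_eq_top_iff npow_eq_zero_iff)
      then show ?thesis by simp
    qed simp
    define \<theta> where "\<theta> i = t i / T" for i
    have \<theta>T: "T * \<theta> i = t i" for i
      using 3 by (simp add: \<theta>_def ennreal_times_divide mult.commute[of T] mult_divide_eq_ennreal)
    have "T * nsum \<theta> = nsum (\<lambda>i. T * \<theta> i)" by (simp add: nsum_cmult)
    then have "T * nsum \<theta> = T" by (simp add: \<theta>T T_def[symmetric])
    then have \<theta>: "nsum \<theta> = 1" using 3 by (metis ennreal_mult_cancel_left mult.right_neutral)
    have "nsum (\<lambda>k. npow r (nsum (\<lambda>i. X i k)))
        = nsum (\<lambda>k. npow r T * npow r (nsum (\<lambda>i. \<theta> i * (X i k / t i))))"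
      unfolding npow_mult[symmetric] nsum_cmult(1)[symmetric] mult.assoc[symmetric] \<theta>T Xt[symmetric] ..
    also have "\<dots> \<le> nsum (\<lambda>k. npow r T * nsum (\<lambda>i. \<theta> i * npow r (X i k / t i)))"
      by (intro nsum_mono mult_left_mono npow_Jensen r) (auto simp: \<theta>)
    also have "\<dots> = npow r T * nsum (\<lambda>k. nsum (\<lambda>i. \<theta> i * npow r (X i k / t i)))"
      by (rule nsum_cmult)
    also have "\<dots> = npow r T * nsum (\<lambda>i. \<theta> i * nsum (\<lambda>k. npow r (X i k / t i)))"
      by (subst nsum_swap) (simp only: nsum_cmult(1))
    also have "\<dots> \<le> npow r T * nsum \<theta>"
    proof (intro mult_left_mono nsum_mono)
      fix i show "\<theta> i * nsum (\<lambda>k. npow r (X i k / t i)) \<le> \<theta> i"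
        using divide_right_mono_ennreal[OF Y[of i], of T]
        by (simp add: \<theta>_def divide_ennreal_def mult_ac)
    qed auto
    finally have "nsum (\<lambda>k. npow r (nsum (\<lambda>i. X i k))) \<le> npow r T" by (simp add: \<theta>)
    then have "npow (1/r) (nsum (\<lambda>k. npow r (nsum (\<lambda>i. X i k)))) \<le> npow (1/r) (npow r T)"
      using r by (intro npow_mono) auto
    then show ?thesis using False r by (simp add: seq_norm_def r_def npow_npow T_def t_def[abs_def])
  qed (simp add: T_def t_def[abs_def])
qed

lemma seq_norm_add:
  assumes "1 \<le> p"
  shows "seq_norm p (\<lambda>k. X k + Y k) \<le> seq_norm p X + seq_norm p Y"
  using seq_norm_nsum[OF assms, of "\<lambda>b k. if b then X k else Y k"]
  by (simp add: nn_integral_count_space_finite UNIV_bool add.commute)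

text \<open>Minkowski's inequality for the decomposition of \<open>X\<close> into its single
  entries.\<close>

lemma seq_norm_le_nsum:
  assumes "1 \<le> p"
  shows "seq_norm p X \<le> nsum X"
proof -
  have "seq_norm p (\<lambda>k. if k = i then X k else 0) \<le> X i" for i
  proof (cases "p = \<infinity>")
    case False
    have "npow r (if k = i then X k else 0) = (if k = i then npow r (X k) else 0)" for r k by simp
    then show ?thesis using enn2real_ge_1[OF assms False] False
      by (simp add: seq_norm_def nsum_single npow_npow)
  qed (auto simp: seq_norm_def intro: SUP_least)
  then have "nsum (\<lambda>i. seq_norm p (\<lambda>k. if k = i then X k else 0)) \<le> nsum X"
    by (intro nsum_mono)
  moreover have "nsum (\<lambda>i. if k = i then X k else 0) = X k" for k
    using nsum_single[of k "\<lambda>_. X k"] by (simp add: eq_commute)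
  ultimately show ?thesis
    using seq_norm_nsum[OF assms, of "\<lambda>i k. if k = i then X k else 0"] by simp
qed

section \<open>Windows and kernels on the integer lattice\<close>

definition lattice_box :: "int \<Rightarrow> (int^'n) set" where
  "lattice_box r = {k. \<forall>i. \<bar>k $ i\<bar> \<le> r}"

definition sup_abs :: "int^'n \<Rightarrow> int" where
  "sup_abs k = Max (range (\<lambda>i. \<bar>k $ i\<bar>))"

lemma sup_abs_le_iff: "sup_abs k \<le> r \<longleftrightarrow> k \<in> lattice_box r"
  by (auto simp: sup_abs_def lattice_box_def)

lemma sup_abs_component: "\<bar>k $ i\<bar> \<le> sup_abs k"
  by (simp add: sup_abs_def)

lemma sup_abs_nonneg [simp]: "0 \<le> sup_abs k"
  using sup_abs_component[of k undefined] by linarith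

lemma sup_abs_zero [simp]: "sup_abs 0 = 0"
  by (simp add: sup_abs_def)

lemma sup_abs_add: "sup_abs (k + l) \<le> sup_abs k + sup_abs l"
  unfolding sup_abs_le_iff lattice_box_def
  by (auto intro!: order_trans[OF abs_triangle_ineq] add_mono sup_abs_component)

lemma sup_abs_minus [simp]: "sup_abs (- k) = sup_abs k"
  by (simp add: sup_abs_def)

lemma finite_lattice_box [simp]: "finite (lattice_box r :: (int^'n) set)"
proof -
  have "lattice_box r \<subseteq> vec_lambda ` (PiE (UNIV::'n set) (\<lambda>_. {-r..r}))"
  proof
    fix k :: "int^'n" assume "k \<in> lattice_box r"
    then have "vec_nth k \<in> PiE UNIV (\<lambda>_. {-r..r})"
      by (auto simp: lattice_box_def abs_le_iff) (metis minus_le_iff)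
    then show "k \<in> vec_lambda ` (PiE UNIV (\<lambda>_. {-r..r}))"
      by (metis image_eqI vec_nth_inverse)
  qed
  then show ?thesis by (rule finite_subset) (intro finite_imageI finite_PiE; simp)
qed

text \<open>Division with remainder by \<open>M\<close> in each coordinate. The factor
  \<open>card (lattice_box 4)\<close> does not depend on \<open>M\<close>; otherwise the gain from
  wide windows could be lost.\<close>

lemma card_lattice_box_mult:
  assumes "0 < M"
  shows "card (lattice_box (4 * M) :: (int^'n) set)
    \<le> card (lattice_box 4 :: (int^'n) set) * card (lattice_box M :: (int^'n) set)"
proof -
  let ?f = "\<lambda>(e :: int^'n, r :: int^'n). (\<chi> i. e $ i * M + r $ i)"
  have "lattice_box (4 * M) \<subseteq> ?f ` (lattice_box 4 \<times> lattice_box M)"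
  proof
    fix k :: "int^'n" assume k: "k \<in> lattice_box (4 * M)"
    let ?e = "\<chi> i. k $ i div M" and ?r = "\<chi> i. k $ i mod M"
    have "\<bar>k $ i div M\<bar> \<le> 4" for i
    proof -
      have "- (4 * M) \<le> k $ i" "k $ i \<le> 4 * M"
        using k by (auto simp: lattice_box_def abs_le_iff minus_le_iff)
      then have "- 4 * M div M \<le> k $ i div M" "k $ i div M \<le> 4 * M div M"
        using zdiv_mono1[of "- 4 * M" "k $ i" M] zdiv_mono1[of "k $ i" "4 * M" M] assms by simp_all
      moreover have "- 4 * M div M = - 4" "4 * M div M = 4"
        using assms by (intro nonzero_mult_div_cancel_right; simp)+
      ultimately show ?thesis by linarith
    qed
    moreover have "\<bar>k $ i mod M\<bar> \<le> M" for i
      using assms pos_mod_bound[of M "k $ i"] by (simp add: less_imp_le)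
    ultimately have "(?e, ?r) \<in> lattice_box 4 \<times> lattice_box M"
      by (simp add: lattice_box_def)
    moreover have "k = ?f (?e, ?r)"
      by (simp add: vec_eq_iff)
    ultimately show "k \<in> ?f ` (lattice_box 4 \<times> lattice_box M)" by (rule rev_image_eqI)
  qed
  then have "card (lattice_box (4 * M) :: (int^'n) set) \<le> card ((lattice_box 4 :: (int^'n) set) \<times> (lattice_box M :: (int^'n) set))"
    by (intro order_trans[OF card_mono card_image_le]) auto
  then show ?thesis by (simp add: card_cartesian_product)
qed

section \<open>Tent windows: oscillation and mass\<close>

definition tent :: "int \<Rightarrow> int^'n \<Rightarrow> real" where
  "tent M k = max 0 (1 - of_int (sup_abs k) / of_int (2 * M))"

lemma tent_nonneg: "0 \<le> tent M k"
  by (simp add: tent_def)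

lemma tent_le_1: "0 < M \<Longrightarrow> tent M k \<le> 1"
  by (simp add: tent_def)

lemma tent_zero [simp]: "tent M 0 = 1"
  by (simp add: tent_def)

lemma tent_eq_0: "0 < M \<Longrightarrow> 2 * M \<le> sup_abs k \<Longrightarrow> tent M k = 0"
  by (simp add: tent_def field_simps flip: of_int_mult)

lemma tent_ge_half: "0 < M \<Longrightarrow> k \<in> lattice_box M \<Longrightarrow> 1 / 2 \<le> tent M k"
proof -
  assume "0 < M" "k \<in> lattice_box M"
  then have "of_int (sup_abs k) \<le> (of_int M :: real)" by (simp add: sup_abs_le_iff)
  then show ?thesis using \<open>0 < M\<close> by (simp add: tent_def field_simps max_def)
qed

lemma tent_Lipschitz:
  assumes "0 < M"
  shows "\<bar>tent M k - tent M (k + i)\<bar> \<le> min 1 (of_int (sup_abs i) / of_int (2 * M))"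
proof -
  have "sup_abs (k + i) \<le> sup_abs k + sup_abs i" "sup_abs k \<le> sup_abs (k + i) + sup_abs i"
    using sup_abs_add[of k i] sup_abs_add[of "k + i" "- i"] by auto
  then have "\<bar>of_int (sup_abs k) - of_int (sup_abs (k + i))\<bar> \<le> (of_int (sup_abs i) :: real)"
    by linarith
  then have "\<bar>of_int (sup_abs k) / of_int (2 * M) - of_int (sup_abs (k + i)) / of_int (2 * M)\<bar>
      \<le> (of_int (sup_abs i) / of_int (2 * M) :: real)"
    using assms by (simp add: diff_divide_distrib[symmetric] divide_right_mono)
  then have "\<bar>tent M k - tent M (k + i)\<bar> \<le> of_int (sup_abs i) / of_int (2 * M)"
    unfolding tent_def by linarith
  moreover have "\<bar>tent M k - tent M (k + i)\<bar> \<le> 1"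
    using tent_nonneg[of M k] tent_nonneg[of M "k + i"] tent_le_1[OF assms, of k]
      tent_le_1[OF assms, of "k + i"] by linarith
  ultimately show ?thesis by simp
qed

text \<open>A nonzero value at \<open>j\<close> forces \<open>sup_abs j < 2 * M\<close>. A shift of
  \<open>j\<close> by a vector outside the box of radius \<open>4 * M\<close> therefore leaves the
  support of the tent, so the difference vanishes unless one of the two shifts lies in that
  box.\<close>

lemma tent_local_oscillation:
  fixes j m i :: "int^'n"
  assumes "0 < M" "tent M j \<noteq> 0"
  shows "ennreal \<bar>tent M (j + m) - tent M (j + m + i)\<bar>
    \<le> ennreal (min 1 (of_int (sup_abs i) / of_int (2 * M))) *
       (indicator (lattice_box (4 * M)) m + indicator (lattice_box (4 * M)) (m + i))"
proof (cases "m \<in> lattice_box (4 * M) \<or> m + i \<in> lattice_box (4 * M)")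
  case True
  have "ennreal \<bar>tent M (j + m) - tent M (j + m + i)\<bar>
      \<le> ennreal (min 1 (of_int (sup_abs i) / of_int (2 * M))) * 1"
    using tent_Lipschitz[OF assms(1), of "j + m" i] by (simp add: ennreal_leI)
  also have "\<dots> \<le> ennreal (min 1 (of_int (sup_abs i) / of_int (2 * M))) *
       (indicator (lattice_box (4 * M)) m + indicator (lattice_box (4 * M)) (m + i))"
    using True by (intro mult_left_mono) (auto simp: indicator_def)
  finally show ?thesis .
next
  case False
  have j: "sup_abs j < 2 * M" using tent_eq_0[OF assms(1), of j] assms(2) by linarith
  have "2 * M \<le> sup_abs (j + l)" if "l \<notin> lattice_box (4 * M)" for l
    using that sup_abs_add[of "j + l" "- j"] j by (simp add: sup_abs_le_iff[symmetric])
  then have "tent M (j + m) = 0" "tent M (j + (m + i)) = 0"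
    using False by (auto intro: tent_eq_0[OF assms(1)])
  then show ?thesis by (simp add: add.assoc)
qed

lemma nsum_indicator: "finite A \<Longrightarrow> nsum (indicator A) = of_nat (card A)"
  by (subst nsum_finite_support[of A]) auto

text \<open>The tent is at least 1/2 on the box of radius \<open>M\<close>, whose cardinality is
  comparable to that of the box of radius \<open>4 * M\<close>. This comparison with a constant free
  of \<open>M\<close> is what normalizing by the mass relies on.\<close>

lemma tent_mass:
  assumes "0 < M"
  defines "S \<equiv> nsum (\<lambda>k::int^'n. ennreal (tent M k))"
  shows "S < top" "of_nat (card (lattice_box (4 * M) :: (int^'n) set))
    \<le> 2 * of_nat (card (lattice_box 4 :: (int^'n) set)) * S" "S > 0"
proof -
  have "S = (\<Sum>k::int^'n\<in>lattice_box (2 * M). ennreal (tent M k))"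
    unfolding S_def by (rule nsum_finite_support) (auto simp: sup_abs_le_iff[symmetric] tent_eq_0 assms)
  then show "S < top" by (simp add: sum_ennreal tent_nonneg)
  have "of_nat (card (lattice_box M :: (int^'n) set)) = nsum (indicator (lattice_box M :: (int^'n) set))"
    by (simp add: nsum_indicator)
  also have "\<dots> \<le> nsum (\<lambda>k::int^'n. 2 * ennreal (tent M k))"
  proof (intro nsum_mono)
    fix k :: "int^'n"
    show "indicator (lattice_box M) k \<le> 2 * ennreal (tent M k)"
    proof (cases "k \<in> lattice_box M")
      case True
      then have "ennreal 1 \<le> ennreal (2 * tent M k)"
        using tent_ge_half[OF assms(1) True] by (intro ennreal_leI) auto
      then show ?thesis using True by (simp add: ennreal_mult' tent_nonneg)
    qed simp
  qed
  finally have *: "of_nat (card (lattice_box M :: (int^'n) set)) \<le> 2 * S" by (simp add: S_def nsum_cmult)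
  have "of_nat (card (lattice_box (4 * M) :: (int^'n) set))
      \<le> (of_nat (card (lattice_box 4 :: (int^'n) set) * card (lattice_box M :: (int^'n) set)) :: ennreal)"
    using card_lattice_box_mult[OF assms(1)] of_nat_mono by blast
  also have "\<dots> \<le> of_nat (card (lattice_box 4 :: (int^'n) set)) * (2 * S)"
    by (simp add: mult_left_mono *)
  finally show "of_nat (card (lattice_box (4 * M) :: (int^'n) set))
    \<le> 2 * of_nat (card (lattice_box 4 :: (int^'n) set)) * S" by (simp add: mult_ac)
  have "(1::ennreal) \<le> S"
    unfolding S_def using nsum_ge[of "\<lambda>k::int^'n. ennreal (tent M k)" 0] by simp
  then show "S > 0" by (auto simp: order.strict_iff_order)
qed

section \<open>Convolution kernels and the Neumann series\<close>

text \<open>The kernel is evaluated at input minus output index, so that the final bounds carry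
  weights \<open>W (i - l)\<close> centred at the index \<open>l\<close> being estimated.\<close>

definition kernel_conv :: "('k \<Rightarrow> ennreal) \<Rightarrow> ('k \<Rightarrow> ennreal) \<Rightarrow> ('k::ab_group_add) \<Rightarrow> ennreal" where
  "kernel_conv V X n = nsum (\<lambda>m. V (m - n) * X m)"

lemma nsum_kernel_conv_bound:
  "nsum (\<lambda>l. nsum (\<lambda>m. V m * U (l - m))) = nsum V * nsum U"
  for V U :: "'k::ab_group_add \<Rightarrow> ennreal"
  by (subst nsum_swap) (simp add: nsum_cmult nsum_shift(3))

lemma kernel_conv_assoc:
  "kernel_conv V (kernel_conv U X) n = kernel_conv (\<lambda>l. nsum (\<lambda>m. V m * U (l - m))) X n"
proof -
  have "kernel_conv V (kernel_conv U X) n = nsum (\<lambda>m. nsum (\<lambda>l. V (m - n) * (U (l - m) * X l)))"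
    by (simp add: kernel_conv_def nsum_cmult)
  also have "\<dots> = nsum (\<lambda>l. nsum (\<lambda>m. V (m - n) * U (l - m)) * X l)"
    by (subst nsum_swap) (simp add: nsum_cmult mult.assoc[symmetric])
  also have "(\<lambda>l. nsum (\<lambda>m. V (m - n) * U (l - m))) = (\<lambda>l. nsum (\<lambda>m. V m * U (l - n - m)))"
  proof
    fix l show "nsum (\<lambda>m. V (m - n) * U (l - m)) = nsum (\<lambda>m. V m * U (l - n - m))"
      using nsum_shift(1)[of "\<lambda>m. V (m - n) * U (l - m)" n] by (simp add: algebra_simps)
  qed
  finally show ?thesis by (simp add: kernel_conv_def)
qed

lemma kernel_conv_mono: "(\<And>m. X m \<le> Y m) \<Longrightarrow> kernel_conv V X n \<le> kernel_conv V Y n"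
  by (auto simp: kernel_conv_def intro!: nsum_mono mult_left_mono)

lemma kernel_conv_add: "kernel_conv V (\<lambda>m. X m + Y m) n = kernel_conv V X n + kernel_conv V Y n"
  by (simp add: kernel_conv_def distrib_left nsum_add)

lemma kernel_conv_bounded:
  assumes "\<And>m. X m \<le> B"
  shows "kernel_conv V X n \<le> nsum V * B"
proof -
  have "kernel_conv V X n \<le> nsum (\<lambda>m. V (m - n) * B)"
    unfolding kernel_conv_def by (intro nsum_mono mult_left_mono assms) auto
  then show ?thesis by (simp add: nsum_cmult nsum_shift(3))
qed

text \<open>Iterating the inequality \<open>R\<close> times leaves a partial sum of the Neumann
  series applied to \<open>\<beta>\<close> and a remainder of at most
  \<open>(1 / 2) ^ R * B\<close>. The bound \<open>B\<close> enters only through this remainder, so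
  \<open>W\<close> depends on \<open>V\<close> alone.\<close>

lemma Neumann_domination:
  fixes V :: "'k::ab_group_add \<Rightarrow> ennreal"
  assumes V: "nsum V \<le> ennreal (1 / 2)"
  obtains W where "nsum W < top"
    "\<And>\<alpha> \<beta> B n. (\<And>n. \<alpha> n \<le> \<beta> n + kernel_conv V \<alpha> n) \<Longrightarrow> (\<And>n. \<alpha> n \<le> B) \<Longrightarrow> B < top
      \<Longrightarrow> \<alpha> n \<le> kernel_conv W \<beta> n"
proof -
  \<comment> \<open>\<open>P r\<close> is the \<open>r\<close>-fold convolution power of
    \<open>V\<close>, beginning with the unit mass at 0.\<close>
  define P :: "nat \<Rightarrow> 'k \<Rightarrow> ennreal" where
    "P = rec_nat (\<lambda>k. if k = 0 then 1 else 0) (\<lambda>_ Q l. nsum (\<lambda>m. Q m * V (l - m)))"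
  have P0: "P 0 = (\<lambda>k. if k = 0 then 1 else 0)"
    and PS: "P (Suc r) = (\<lambda>l. nsum (\<lambda>m. P r m * V (l - m)))" for r
    by (simp_all add: P_def)
  have sumP: "nsum (P r) \<le> ennreal ((1 / 2) ^ r)" for r
  proof (induction r)
    case 0
    show ?case using nsum_single[of "0::'k" "\<lambda>_. 1"] by (simp add: P0)
  next
    case (Suc r)
    have "nsum (P (Suc r)) = nsum (P r) * nsum V"
      unfolding PS by (rule nsum_kernel_conv_bound)
    also have "\<dots> \<le> ennreal ((1 / 2) ^ r) * ennreal (1 / 2)" by (intro mult_mono Suc V) auto
    also have "\<dots> = ennreal ((1 / 2) ^ r * (1 / 2))" by (rule ennreal_mult[symmetric]) auto
    finally show ?case by (simp only: power_Suc2)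
  qed
  define W where "W k = nsum (\<lambda>r. P r k)" for k
  have "nsum W = (\<Sum>r. nsum (P r))"
    unfolding W_def by (subst nsum_swap) (rule nn_integral_count_space_nat)
  also have "\<dots> \<le> (\<Sum>r. ennreal ((1 / 2) ^ r))" by (intro suminf_le sumP) auto
  also have "\<dots> = ennreal (\<Sum>r. (1 / 2) ^ r)"
    by (intro suminf_ennreal2) (auto intro: summable_geometric)
  finally have "nsum W < top" by (simp add: le_less_trans)
  moreover have "\<alpha> n \<le> kernel_conv W \<beta> n"
    if rec: "\<And>n. \<alpha> n \<le> \<beta> n + kernel_conv V \<alpha> n" and B: "\<And>n. \<alpha> n \<le> B" "B < top" for \<alpha> \<beta> B n
  proof -
    have it: "\<alpha> n \<le> (\<Sum>r<R. kernel_conv (P r) \<beta> n) + kernel_conv (P R) \<alpha> n" for R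
    proof (induction R)
      case 0
      have "kernel_conv (P 0) \<alpha> n = nsum (\<lambda>m. if m = n then \<alpha> m else 0)"
        unfolding kernel_conv_def P0 by (intro nn_integral_cong) auto
      then show ?case by (simp add: nsum_single)
    next
      case (Suc R)
      have "kernel_conv (P R) \<alpha> n \<le> kernel_conv (P R) (\<lambda>m. \<beta> m + kernel_conv V \<alpha> m) n"
        by (intro kernel_conv_mono rec)
      also have "\<dots> = kernel_conv (P R) \<beta> n + kernel_conv (P (Suc R)) \<alpha> n"
        unfolding kernel_conv_add kernel_conv_assoc PS ..
      finally have "kernel_conv (P R) \<alpha> n \<le> kernel_conv (P R) \<beta> n + kernel_conv (P (Suc R)) \<alpha> n" .
      from order_trans[OF Suc add_left_mono[OF this]] show ?case
        unfolding sum.lessThan_Suc add.assoc .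
    qed
    have W: "(\<Sum>r<R. kernel_conv (P r) \<beta> n) \<le> kernel_conv W \<beta> n" for R
    proof -
      have "(\<Sum>r<R. kernel_conv (P r) \<beta> n) = kernel_conv (\<lambda>k. \<Sum>r<R. P r k) \<beta> n"
        unfolding kernel_conv_def nsum_sum[symmetric] by (simp add: sum_distrib_right)
      also have "\<dots> \<le> kernel_conv W \<beta> n"
        unfolding kernel_conv_def W_def nn_integral_count_space_nat
        by (intro nsum_mono mult_right_mono sum_le_suminf) auto
      finally show ?thesis .
    qed
    have "\<alpha> n \<le> kernel_conv W \<beta> n + ennreal ((1 / 2) ^ R) * B" for R
    proof -
      have "kernel_conv (P R) \<alpha> n \<le> ennreal ((1 / 2) ^ R) * B"
        by (rule order_trans[OF kernel_conv_bounded[OF B(1)]]) (intro mult_right_mono sumP; simp)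
      then show ?thesis using it[of R] W[of R] by (meson add_mono order_trans)
    qed
    moreover have "(\<lambda>R. kernel_conv W \<beta> n + ennreal ((1 / 2) ^ R) * B) \<longlonglongrightarrow> kernel_conv W \<beta> n + ennreal 0"
    proof (intro tendsto_add tendsto_const)
      obtain b where b: "B = ennreal b" "0 \<le> b" using B(2) by (cases B) auto
      have "(\<lambda>R. (1 / 2) ^ R * b) \<longlonglongrightarrow> 0"
        by (intro tendsto_mult_left_zero LIMSEQ_realpow_zero) auto
      then have "(\<lambda>R. ennreal ((1 / 2) ^ R * b)) \<longlonglongrightarrow> ennreal 0" by (rule tendsto_ennrealI)
      then show "(\<lambda>R. ennreal ((1 / 2) ^ R) * B) \<longlonglongrightarrow> ennreal 0"
        using b by (simp add: ennreal_mult)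
    qed
    ultimately have "\<alpha> n \<le> kernel_conv W \<beta> n + ennreal 0"
      by (intro LIMSEQ_le_const) auto
    then show ?thesis by simp
  qed
  ultimately show ?thesis by (rule that)
qed

section \<open>Localization of stability estimates\<close>

text \<open>Dominated convergence with majorant \<open>H\<close>; the bound 1 is kept in the minimum
  for the sake of this majorant.\<close>

lemma tendsto_nsum_tent_modulus:
  fixes H :: "int^'n \<Rightarrow> ennreal"
  assumes "nsum H < top"
  shows "(\<lambda>N. nsum (\<lambda>i. H i * ennreal (min 1 (of_int (sup_abs i) / of_int (2 * int (Suc N))))))
    \<longlonglongrightarrow> 0"
proof -
  have "(\<lambda>N. nsum (\<lambda>i. H i * ennreal (min 1 (of_int (sup_abs i) / of_int (2 * int (Suc N))))))
      \<longlonglongrightarrow> nsum (\<lambda>i::int^'n. 0)"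
  proof (rule nn_integral_dominated_convergence[where w = H])
    have "(\<lambda>N. H i * ennreal (min 1 (of_int (sup_abs i) / of_int (2 * int (Suc N))))) \<longlonglongrightarrow> 0" for i
    proof -
      obtain h where h: "H i = ennreal h" "0 \<le> h"
        using nsum_ge[of H i] assms by (cases "H i") (auto simp: top_unique)
      have "(\<lambda>N. of_int (sup_abs i) / of_int (2 * int (Suc N)) :: real) \<longlonglongrightarrow> 0"
        by real_asymp
      then have "(\<lambda>N. min 1 (of_int (sup_abs i) / of_int (2 * int (Suc N))) :: real) \<longlonglongrightarrow> min 1 0"
        by (intro tendsto_min tendsto_const)
      then have "(\<lambda>N. h * min 1 (of_int (sup_abs i) / of_int (2 * int (Suc N))) :: real) \<longlonglongrightarrow> h * 0"
        by (intro tendsto_mult tendsto_const) simp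
      then have "(\<lambda>N. ennreal (h * min 1 (of_int (sup_abs i) / of_int (2 * int (Suc N))))) \<longlonglongrightarrow> ennreal (h * 0)"
        by (rule tendsto_ennrealI)
      then show ?thesis using h by (simp add: ennreal_mult)
    qed
    then show "AE i in count_space UNIV. (\<lambda>N. H i * ennreal (min 1 (of_int (sup_abs i) / of_int (2 * int (Suc N))))) \<longlonglongrightarrow> 0"
      by simp
    have "H i * ennreal (min 1 (of_int (sup_abs i) / of_int (2 * int (Suc N)))) \<le> H i * 1" for i N
      by (intro mult_left_mono) (auto simp: ennreal_le_1)
    then show "AE i in count_space UNIV. H i * ennreal (min 1 (of_int (sup_abs i) / of_int (2 * int (Suc N)))) \<le> H i" for N
      by simp
  qed (use assms in auto)
  then show ?thesis by simp
qed

text \<open>For a matrix with entries bounded by \<open>H (k - j)\<close>, this dominates row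
  \<open>k\<close> of its commutator with multiplication by \<open>u\<close>, applied to a sequence
  bounded by \<open>X\<close>.\<close>

definition commutator_bound ::
    "(int^'n \<Rightarrow> ennreal) \<Rightarrow> (int^'n \<Rightarrow> real) \<Rightarrow> (int^'n \<Rightarrow> ennreal) \<Rightarrow> int^'n \<Rightarrow> ennreal" where
  "commutator_bound H u X k = nsum (\<lambda>j. ennreal \<bar>u j - u k\<bar> * H (k - j) * X j)"

text \<open>The value at \<open>m - n\<close> measures how much the piece of a sequence cut out by
  the window at \<open>m\<close> contributes to the commutator with the window at \<open>n\<close>.
  The denominator is the mass of the window, by which the pieces are normalized.\<close>

definition commutator_kernel :: "(int^'n \<Rightarrow> ennreal) \<Rightarrow> int \<Rightarrow> int^'n \<Rightarrow> ennreal" where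
  "commutator_kernel H M m = nsum (\<lambda>i. H i *
     (ennreal (min 1 (of_int (sup_abs i) / of_int (2 * M))) *
      (indicator (lattice_box (4 * M)) m + indicator (lattice_box (4 * M)) (m + i)))) /
     nsum (\<lambda>k::int^'n. ennreal (tent M k))"

text \<open>Averaging over all translates \<open>m\<close> of the window, instead of a partition into blocks, makes
  the gain \<open>\<bar>i\<bar> / M\<close> of the Lipschitz cutoff visible without separating near and far blocks.\<close>

lemma seq_norm_commutator_bound:
  fixes H X :: "int^'n \<Rightarrow> ennreal"
  assumes p: "1 \<le> p" and M: "0 < M"
  shows "seq_norm p (commutator_bound H (\<lambda>k. tent M (k - n)) X)
    \<le> kernel_conv (commutator_kernel H M) (\<lambda>m. seq_norm p (\<lambda>k. ennreal (tent M (k - m)) * X k)) n"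
proof -
  define S where "S = nsum (\<lambda>k::int^'n. ennreal (tent M k))"
  have S: "S \<noteq> 0" "S \<noteq> top" using tent_mass(1,3)[OF M, where 'n='n] by (auto simp: S_def)
  define s where "s i m = ennreal (min 1 (of_int (sup_abs i) / of_int (2 * M))) *
      (indicator (lattice_box (4 * M)) m + indicator (lattice_box (4 * M)) (m + i))" for i m :: "int^'n"
  define Z where "Z m k = ennreal (tent M (k - m)) * X k" for m k :: "int^'n"
  \<comment> \<open>The translates of the tent sum to \<open>S\<close> at every point, so after
    division by \<open>S\<close> they form a partition of unity.\<close>
  have Zsum: "X k = nsum (\<lambda>m. Z m k / S)" for k
  proof -
    have "nsum (\<lambda>m. Z m k / S) = X k / S * nsum (\<lambda>m. ennreal (tent M (k - m)))"
      unfolding nsum_cmult(1)[symmetric] by (simp add: Z_def divide_ennreal_def mult_ac)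
    also have "nsum (\<lambda>m. ennreal (tent M (k - m))) = S"
      unfolding S_def by (rule nsum_shift(4))
    finally show ?thesis using S mult_divide_eq_ennreal[of S 1]
      by (simp add: ennreal_divide_times)
  qed
  \<comment> \<open>Only points in the window around \<open>m\<close> matter, since
    \<open>Z m\<close> vanishes elsewhere; this provides the nonzero tent value that
    \<open>tent_local_oscillation\<close> asks for.\<close>
  have pw: "ennreal \<bar>tent M (k - i - n) - tent M (k - n)\<bar> * Z m (k - i) \<le> s i (m - n) * Z m (k - i)"
    for k i m :: "int^'n"
  proof (cases "tent M (k - i - m) = 0")
    case False
    then have "ennreal \<bar>tent M ((k - i - m) + (m - n)) - tent M ((k - i - m) + (m - n) + i)\<bar> \<le> s i (m - n)"
      unfolding s_def by (rule tent_local_oscillation[OF M])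
    then show ?thesis by (intro mult_right_mono) (simp_all add: algebra_simps)
  qed (simp add: Z_def)
  have "commutator_bound H (\<lambda>k. tent M (k - n)) X k
      \<le> nsum (\<lambda>i. nsum (\<lambda>m. H i * s i (m - n) / S * Z m (k - i)))" for k
  proof -
    have "commutator_bound H (\<lambda>k. tent M (k - n)) X k
        = nsum (\<lambda>i. ennreal \<bar>tent M (k - i - n) - tent M (k - n)\<bar> * H i * X (k - i))"
      using nsum_shift(4)[of "\<lambda>j. ennreal \<bar>tent M (j - n) - tent M (k - n)\<bar> * H (k - j) * X j" k]
      by (simp add: commutator_bound_def)
    also have "\<dots> = nsum (\<lambda>i. nsum (\<lambda>m. ennreal \<bar>tent M (k - i - n) - tent M (k - n)\<bar> * H i * (Z m (k - i) / S)))"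
      by (simp add: nsum_cmult(1) Zsum[symmetric])
    also have "\<dots> \<le> nsum (\<lambda>i. nsum (\<lambda>m. H i * s i (m - n) / S * Z m (k - i)))"
    proof (intro nsum_mono)
      fix i m
      have "ennreal \<bar>tent M (k - i - n) - tent M (k - n)\<bar> * H i * (Z m (k - i) / S)
          = (H i / S) * (ennreal \<bar>tent M (k - i - n) - tent M (k - n)\<bar> * Z m (k - i))"
        by (simp add: divide_ennreal_def mult_ac)
      also have "\<dots> \<le> (H i / S) * (s i (m - n) * Z m (k - i))"
        by (intro mult_left_mono pw) auto
      finally show "ennreal \<bar>tent M (k - i - n) - tent M (k - n)\<bar> * H i * (Z m (k - i) / S)
          \<le> H i * s i (m - n) / S * Z m (k - i)"
        by (simp add: divide_ennreal_def mult_ac)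
    qed
    finally show ?thesis .
  qed
  then have "seq_norm p (commutator_bound H (\<lambda>k. tent M (k - n)) X)
      \<le> seq_norm p (\<lambda>k. nsum (\<lambda>i. nsum (\<lambda>m. H i * s i (m - n) / S * Z m (k - i))))"
    by (rule seq_norm_mono)
  also have "\<dots> \<le> nsum (\<lambda>i. seq_norm p (\<lambda>k. nsum (\<lambda>m. H i * s i (m - n) / S * Z m (k - i))))"
    by (rule seq_norm_nsum[OF p])
  also have "\<dots> \<le> nsum (\<lambda>i. nsum (\<lambda>m. seq_norm p (\<lambda>k. H i * s i (m - n) / S * Z m (k - i))))"
    by (intro nsum_mono seq_norm_nsum[OF p])
  also have "\<dots> = nsum (\<lambda>i. nsum (\<lambda>m. H i * s i (m - n) / S * seq_norm p (Z m)))"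
    by (simp add: seq_norm_cmult[OF p] seq_norm_shift)
  also have "\<dots> = nsum (\<lambda>m. nsum (\<lambda>i. H i * s i (m - n)) / S * seq_norm p (Z m))"
    by (subst nsum_swap) (simp add: divide_ennreal_def nsum_cmult(2))
  finally show ?thesis
    by (simp add: kernel_conv_def commutator_kernel_def s_def S_def Z_def[abs_def])
qed

text \<open>Each of the two indicators has mass \<open>card (lattice_box (4 * M))\<close>, which is
  at most \<open>2 * card (lattice_box 4)\<close> times the window mass in the denominator. Together
  they give the factor 4, free of \<open>M\<close>.\<close>

lemma nsum_commutator_kernel:
  fixes H :: "int^'n \<Rightarrow> ennreal"
  assumes M: "0 < M"
  shows "nsum (commutator_kernel H M) \<le> of_nat (4 * card (lattice_box 4 :: (int^'n) set)) *
    nsum (\<lambda>i. H i * ennreal (min 1 (of_int (sup_abs i) / of_int (2 * M))))"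
proof -
  define S where "S = nsum (\<lambda>k::int^'n. ennreal (tent M k))"
  have S: "S \<noteq> 0" "S \<noteq> top" using tent_mass(1,3)[OF M, where 'n='n] by (auto simp: S_def)
  define L :: ennreal where "L = of_nat (card (lattice_box 4 :: (int^'n) set))"
  define c :: ennreal where "c = of_nat (card (lattice_box (4 * M) :: (int^'n) set))"
  define \<theta> where "\<theta> i = ennreal (min 1 (of_int (sup_abs i) / of_int (2 * M)))" for i :: "int^'n"
  have cS: "c \<le> 2 * L * S" using tent_mass(2)[OF M, where 'n='n] by (simp add: c_def L_def S_def)
  have ind: "nsum (\<lambda>m::int^'n. indicator (lattice_box (4 * M)) m + indicator (lattice_box (4 * M)) (m + i)) = c + c" for i
    by (simp add: nsum_add nsum_shift(1)[of "indicator (lattice_box (4 * M))"] nsum_indicator c_def)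
  have "nsum (commutator_kernel H M)
      = nsum (\<lambda>m. nsum (\<lambda>i. H i * (\<theta> i * (indicator (lattice_box (4 * M)) m + indicator (lattice_box (4 * M)) (m + i))))) / S"
    by (simp add: commutator_kernel_def[abs_def] S_def[symmetric] \<theta>_def divide_ennreal_def nsum_cmult(2))
  also have "\<dots> = nsum (\<lambda>i. H i * (\<theta> i * (c + c))) / S"
    by (subst nsum_swap) (simp add: nsum_cmult(1) ind)
  also have "\<dots> = nsum (\<lambda>i. H i * \<theta> i) * ((c + c) / S)"
    by (simp add: mult.assoc[symmetric] nsum_cmult(2) divide_ennreal_def)
  also have "\<dots> \<le> nsum (\<lambda>i. H i * \<theta> i) * (4 * L * S / S)"
  proof (intro mult_left_mono divide_right_mono_ennreal)
    have "c + c \<le> 2 * L * S + 2 * L * S" by (intro add_mono cS)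
    also have "\<dots> = 4 * L * S" by (simp add: mult_2[symmetric] mult.assoc[symmetric] del: mult_2)
    finally show "c + c \<le> 4 * L * S" .
  qed auto
  also have "4 * L * S / S = 4 * L" using S by (rule mult_divide_eq_ennreal)
  also have "nsum (\<lambda>i. H i * \<theta> i) * (4 * L) = (4 * L) * nsum (\<lambda>i. H i * \<theta> i)"
    by (rule mult.commute)
  finally show ?thesis by (simp add: L_def \<theta>_def)
qed

text \<open>Testing the hypothesis with the translates of one tent gives a scalar inequality between
  the local norms \<open>\<alpha> n\<close> of \<open>X\<close> and \<open>\<beta> n\<close> of
  \<open>Y\<close>, where the commutator acts as convolution with \<open>V\<close>. A wide window
  brings the mass of \<open>V\<close> down to 1/2, and the Neumann series removes
  \<open>\<alpha>\<close> from the right side. The exponent drops out at the ends: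
  \<open>X j\<close> is at most \<open>\<alpha> j\<close>, and \<open>\<beta> n\<close> is at most
  the windowed sum of \<open>Y\<close>.\<close>

theorem localized_stability:
  fixes H :: "int^'n \<Rightarrow> ennreal" and K :: real
  assumes p: "1 \<le> p" and H: "nsum H < top"
  shows "\<exists>W :: int^'n \<Rightarrow> ennreal. nsum W < top \<and> (\<forall>X Y j. nsum X < top \<longrightarrow>
      (\<forall>u. (\<forall>k. 0 \<le> u k \<and> u k \<le> 1) \<longrightarrow>
        seq_norm p (\<lambda>k. ennreal (u k) * X k) \<le> ennreal K *
          (seq_norm p (\<lambda>k. ennreal (u k) * Y k) + seq_norm p (commutator_bound H u X))) \<longrightarrow>
      X j \<le> kernel_conv W Y j)"
proof -
  define L :: ennreal where "L = of_nat (4 * card (lattice_box 4 :: (int^'n) set))"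
  define g where "g N = nsum (\<lambda>i. H i * ennreal (min 1 (of_int (sup_abs i) / of_int (2 * int (Suc N)))))" for N
  have "(\<lambda>N. (ennreal K * L) * g N) \<longlonglongrightarrow> (ennreal K * L) * 0"
    unfolding g_def L_def
    by (intro ennreal_tendsto_cmult tendsto_nsum_tent_modulus H)
      (simp add: ennreal_mult_less_top of_nat_less_top)
  moreover have half: "0 < ennreal (1 / 2)" by (subst ennreal_less_zero_iff) simp
  ultimately have "eventually (\<lambda>N. (ennreal K * L) * g N < ennreal (1 / 2)) sequentially"
    by (intro order_tendstoD(2)) (simp_all only: mult_zero_right)
  then obtain N where N: "(ennreal K * L) * g N < ennreal (1 / 2)"
    by (auto simp: eventually_sequentially)
  define M where "M = int (Suc N)"
  have M: "0 < M" by (simp add: M_def)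
  define V where "V m = ennreal K * commutator_kernel H M m" for m
  have "nsum V \<le> ennreal K * (L * g N)"
    unfolding V_def nsum_cmult(1) L_def g_def M_def[symmetric]
    by (intro mult_left_mono nsum_commutator_kernel M) auto
  also have "\<dots> \<le> ennreal (1 / 2)" using N by (simp add: mult.assoc)
  finally have V: "nsum V \<le> ennreal (1 / 2)" .
  obtain W0 where W0: "nsum W0 < top" and
    dom: "\<And>\<alpha> \<beta> B n. (\<And>n. \<alpha> n \<le> \<beta> n + kernel_conv V \<alpha> n) \<Longrightarrow> (\<And>n. \<alpha> n \<le> B) \<Longrightarrow> B < top
      \<Longrightarrow> \<alpha> n \<le> kernel_conv W0 \<beta> n"
    using Neumann_domination[OF V] by metis
  define T where "T k = ennreal (tent M k)" for k :: "int^'n"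
  define W where "W l = ennreal K * nsum (\<lambda>m. W0 m * T (l - m))" for l
  have "nsum W = ennreal K * (nsum W0 * nsum T)"
    unfolding W_def nsum_cmult(1) nsum_kernel_conv_bound ..
  then have Wfin: "nsum W < top"
    using W0 tent_mass(1)[OF M, where 'n='n] by (simp add: T_def[abs_def] ennreal_mult_less_top)
  have Wdom: "X j \<le> kernel_conv W Y j"
    if X: "nsum X < top" and st: "\<forall>u. (\<forall>k. 0 \<le> u k \<and> u k \<le> 1) \<longrightarrow>
        seq_norm p (\<lambda>k. ennreal (u k) * X k) \<le> ennreal K *
          (seq_norm p (\<lambda>k. ennreal (u k) * Y k) + seq_norm p (commutator_bound H u X))" for X Y j
  proof -
    define \<alpha> where "\<alpha> n = seq_norm p (\<lambda>k. T (k - n) * X k)" for n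
    define \<beta> where "\<beta> n = seq_norm p (\<lambda>k. T (k - n) * Y k)" for n
    have T1: "T k \<le> 1" for k using tent_le_1[OF M, of k] by (simp add: T_def)
    have "\<alpha> n \<le> ennreal K * \<beta> n + kernel_conv V \<alpha> n" for n
    proof -
      have "\<alpha> n \<le> ennreal K * (\<beta> n + seq_norm p (commutator_bound H (\<lambda>k. tent M (k - n)) X))"
        unfolding \<alpha>_def \<beta>_def T_def
        by (rule st[rule_format]) (simp add: tent_nonneg tent_le_1[OF M])
      also have "\<dots> \<le> ennreal K * (\<beta> n + kernel_conv (commutator_kernel H M) \<alpha> n)"
        unfolding \<alpha>_def T_def
        by (intro mult_left_mono add_left_mono seq_norm_commutator_bound p M) simp
      also have "\<dots> = ennreal K * \<beta> n + kernel_conv V \<alpha> n"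
        by (simp add: distrib_left kernel_conv_def V_def mult.assoc nsum_cmult(1))
      finally show ?thesis .
    qed
    \<comment> \<open>The a priori bound for the Neumann iteration.\<close>
    moreover have "\<alpha> n \<le> nsum X" for n
    proof -
      have "\<alpha> n \<le> nsum (\<lambda>k. T (k - n) * X k)"
        unfolding \<alpha>_def by (rule seq_norm_le_nsum[OF p])
      also have "\<dots> \<le> nsum X"
        by (intro nsum_mono) (use mult_right_mono[OF T1] in simp)
      finally show ?thesis .
    qed
    ultimately have "\<alpha> j \<le> kernel_conv W0 (\<lambda>n. ennreal K * \<beta> n) j"
      using X by (rule dom)
    also have "\<dots> \<le> kernel_conv W0 (\<lambda>n. ennreal K * kernel_conv (\<lambda>k. T k) Y n) j"
      unfolding \<beta>_def kernel_conv_def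
      by (intro nsum_mono mult_left_mono seq_norm_le_nsum[OF p]) auto
    also have "\<dots> = ennreal K * kernel_conv W0 (kernel_conv T Y) j"
      unfolding kernel_conv_def[of W0] nsum_cmult(1)[symmetric] by (simp add: mult_ac)
    also have "\<dots> = kernel_conv W Y j"
      unfolding kernel_conv_assoc
      by (simp add: kernel_conv_def W_def mult.assoc nsum_cmult(1))
    finally have "\<alpha> j \<le> kernel_conv W Y j" .
    moreover have "X j \<le> \<alpha> j"
      using seq_norm_ge[OF p, of "\<lambda>k. T (k - j) * X k" j] by (simp add: \<alpha>_def T_def)
    ultimately show ?thesis by (rule order_trans[rotated])
  qed
  show ?thesis
  proof (intro exI conjI allI impI)
    show "nsum W < top" by (rule Wfin)
    show "X j \<le> kernel_conv W Y j" if "nsum X < top" "\<forall>u. (\<forall>k. 0 \<le> u k \<and> u k \<le> 1) \<longrightarrow>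
        seq_norm p (\<lambda>k. ennreal (u k) * X k) \<le> ennreal K *
          (seq_norm p (\<lambda>k. ennreal (u k) * Y k) + seq_norm p (commutator_bound H u X))" for X Y j
      using that by (rule Wdom)
  qed
qed

section \<open>Unit cells and grids\<close>

lemma sum_le_infsum_ennreal:
  fixes f :: "'i \<Rightarrow> ennreal"
  assumes "finite F" "F \<subseteq> A"
  shows "sum f F \<le> infsum f A"
proof -
  have "infsum f A = (SUP F\<in>{F. finite F \<and> F \<subseteq> A}. sum f F)"
    by (rule nonneg_infsum_complete) simp
  then show ?thesis using assms by (simp add: SUP_upper)
qed

lemma infsum_ennreal_countable:
  fixes f :: "'i \<Rightarrow> ennreal"
  assumes "countable A"
  shows "infsum f A = (\<integral>\<^sup>+i. f i \<partial>count_space A)"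
proof (rule antisym)
  have "infsum f A = (SUP F\<in>{F. finite F \<and> F \<subseteq> A}. sum f F)"
    by (rule nonneg_infsum_complete) simp
  also have "\<dots> \<le> (\<integral>\<^sup>+i. f i \<partial>count_space A)"
  proof (rule SUP_least, clarify)
    fix F assume F: "finite F" "F \<subseteq> A"
    have "sum f F = (\<integral>\<^sup>+i. f i * indicator F i \<partial>count_space A)"
      using F by (subst nn_integral_count_space'[of F]) auto
    also have "\<dots> \<le> (\<integral>\<^sup>+i. f i \<partial>count_space A)"
      by (intro nn_integral_mono) (auto simp: indicator_def)
    finally show "sum f F \<le> (\<integral>\<^sup>+i. f i \<partial>count_space A)" .
  qed
  finally show "infsum f A \<le> (\<integral>\<^sup>+i. f i \<partial>count_space A)" .
  \<comment> \<open>Finite sets exhausting \<open>A\<close> along an enumeration, for monotone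
    convergence.\<close>
  define F where "F n = {i\<in>A. to_nat_on A i < n}" for n
  have F: "finite (F n)" "F n \<subseteq> A" for n
    by (auto simp: F_def intro!: inj_on_finite[OF inj_on_subset[OF inj_on_to_nat_on[OF assms]], of _ "{..<n}"])
  have "(\<integral>\<^sup>+i. f i \<partial>count_space A) = (\<integral>\<^sup>+i. (SUP n. f i * indicator (F n) i) \<partial>count_space A)"
  proof (rule nn_integral_cong)
    fix i assume "i \<in> space (count_space A)"
    then have "f i = f i * indicator (F (Suc (to_nat_on A i))) i" by (simp add: F_def)
    then show "f i = (SUP n. f i * indicator (F n) i)"
      by (intro antisym SUP_upper2[of "Suc (to_nat_on A i)"] SUP_least)
        (auto simp: indicator_def)
  qed
  also have "\<dots> = (SUP n. \<integral>\<^sup>+i. f i * indicator (F n) i \<partial>count_space A)"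
    by (rule nn_integral_monotone_convergence_SUP)
      (auto simp: incseq_def le_fun_def F_def indicator_def)
  also have "\<dots> \<le> infsum f A"
  proof (rule SUP_least)
    fix n
    have "(\<integral>\<^sup>+i. f i * indicator (F n) i \<partial>count_space A) = sum f (F n)"
      using F[of n] by (subst nn_integral_count_space'[of "F n"]) auto
    also have "\<dots> \<le> infsum f A" by (rule sum_le_infsum_ennreal[OF F])
    finally show "(\<integral>\<^sup>+i. f i * indicator (F n) i \<partial>count_space A) \<le> infsum f A" .
  qed
  finally show "(\<integral>\<^sup>+i. f i \<partial>count_space A) \<le> infsum f A" .
qed

section \<open>Unit cells and the amalgam norm as a sum over integer vectors\<close>

definition floor_vec :: "real^'n \<Rightarrow> int^'n" where
  "floor_vec x = (\<chi> i. \<lfloor>x $ i\<rfloor>)"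

definition cell_sup :: "(real^'n \<Rightarrow> ennreal) \<Rightarrow> int^'n \<Rightarrow> ennreal" where
  "cell_sup h k = (SUP x\<in>{x. floor_vec x = k}. h x)"

lemma floor_vec_component [simp]: "floor_vec x $ i = \<lfloor>x $ i\<rfloor>"
  by (simp add: floor_vec_def)

lemma cell_sup_ge: "floor_vec x = k \<Longrightarrow> h x \<le> cell_sup h k"
  by (auto simp: cell_sup_def intro: SUP_upper)

lemma countable_int_vec: "countable (A :: (int^'n) set)"
  by (rule countable_subset[OF subset_UNIV]) simp

text \<open>The translates of the unit cube by lattice points are the fibres of
  \<open>floor_vec\<close>. Indexing them by the type \<open>int^'n\<close> turns lattice sums into
  sums over \<open>UNIV\<close>, on which translations are bijections.\<close>

lemma wiener_norm_eq_nsum: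
  fixes h :: "real^'n \<Rightarrow> ennreal"
  shows "wiener_norm h = nsum (cell_sup h)"
proof -
  define \<iota> :: "int^'n \<Rightarrow> real^'n" where "\<iota> k = (\<chi> i. of_int (k $ i))" for k
  have inj: "inj \<iota>" by (auto simp: inj_def \<iota>_def vec_eq_iff)
  have range: "integer_lattice = range \<iota>"
  proof (intro set_eqI iffI)
    fix x :: "real^'n" assume "x \<in> integer_lattice"
    then have "x = \<iota> (floor_vec x)"
      by (auto simp: integer_lattice_def \<iota>_def vec_eq_iff Ints_def)
    then show "x \<in> range \<iota>" by blast
  qed (auto simp: integer_lattice_def \<iota>_def)
  have "(\<lambda>x. \<iota> k + x) ` unit_cube = {x. floor_vec x = k}" for k
  proof (intro set_eqI iffI)
    fix x :: "real^'n" assume "x \<in> {x. floor_vec x = k}"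
    then have k: "k = floor_vec x" by simp
    have "0 \<le> x $ i - of_int \<lfloor>x $ i\<rfloor> \<and> x $ i - of_int \<lfloor>x $ i\<rfloor> < 1" for i
      by linarith
    then have "x - \<iota> k \<in> unit_cube" by (simp add: unit_cube_def \<iota>_def k)
    then show "x \<in> (\<lambda>x. \<iota> k + x) ` unit_cube" by (intro image_eqI[of _ _ "x - \<iota> k"]) auto
  qed (auto simp: unit_cube_def \<iota>_def vec_eq_iff floor_eq_iff)
  then have cell: "(SUP x\<in>unit_cube. h (\<iota> k + x)) = cell_sup h k" for k
    unfolding cell_sup_def by (metis (no_types) image_image)
  have "wiener_norm h = (\<integral>\<^sup>+x. (SUP y\<in>unit_cube. h (x + y)) \<partial>count_space (range \<iota>))"
    unfolding wiener_norm_def range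
    by (rule infsum_ennreal_countable) (simp add: countable_int_vec)
  also have "\<dots> = nsum (\<lambda>k. SUP y\<in>unit_cube. h (\<iota> k + y))"
    using inj by (intro nn_integral_bij_count_space[symmetric]) (simp add: bij_betw_def)
  finally show ?thesis by (simp add: cell)
qed

text \<open>\<open>floor_vec\<close> is not additive, and the sum over neighbouring cells absorbs
  the error. Radius 2 covers the worst case \<open>floor_vec_add\<close>: carrying between two
  fractional parts together with a displacement of norm at most 1.\<close>

definition enlarge :: "(int^'n \<Rightarrow> ennreal) \<Rightarrow> int^'n \<Rightarrow> ennreal" where
  "enlarge U m = (\<Sum>e\<in>lattice_box 2. U (m + e))"

lemma nsum_enlarge: "nsum (enlarge U) = of_nat (card (lattice_box 2 :: (int^'n) set)) * nsum U"
  for U :: "int^'n \<Rightarrow> ennreal"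
  by (simp add: enlarge_def[abs_def] nsum_sum nsum_shift(1))

lemma le_enlarge: "k - m \<in> lattice_box 2 \<Longrightarrow> U k \<le> enlarge U m"
  unfolding enlarge_def
  using member_le_sum[of "k - m" "lattice_box 2" "\<lambda>e. U (m + e)"] by simp

lemma floor_vec_diff: "floor_vec (x - l) - (floor_vec x - floor_vec l) \<in> lattice_box 2"
proof -
  have "\<bar>\<lfloor>x $ i - l $ i\<rfloor> - (\<lfloor>x $ i\<rfloor> - \<lfloor>l $ i\<rfloor>)\<bar> \<le> 2" for i by linarith
  then show ?thesis by (simp add: lattice_box_def)
qed

lemma floor_vec_add:
  assumes "norm y \<le> 1"
  shows "floor_vec (x + l + y) - floor_vec l - floor_vec x \<in> lattice_box 2"
proof -
  have "\<bar>\<lfloor>x $ i + l $ i + y $ i\<rfloor> - \<lfloor>l $ i\<rfloor> - \<lfloor>x $ i\<rfloor>\<bar> \<le> 2" for i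
    using component_le_norm_cart[of y i] assms by linarith
  then show ?thesis by (simp add: lattice_box_def)
qed

lemma relatively_separated_count:
  fixes \<Lambda> :: "(real^'n) set"
  assumes "relatively_separated \<Lambda>"
  obtains R :: nat where "\<And>j. finite {l\<in>\<Lambda>. floor_vec l = j}"
    "\<And>j. card {l\<in>\<Lambda>. floor_vec l = j} \<le> R"
proof -
  define s where "s x = (\<Sum>\<^sub>\<infinity>l\<in>\<Lambda>. indicator ((+) l ` unit_cube) x :: ennreal)" for x
  have "(SUP x. s x) < top" using assms by (simp add: relatively_separated_def s_def)
  then obtain R :: nat where R: "(SUP x. s x) < of_nat R" by (rule ennreal_Ex_less_of_nat[THEN exE])
  have "card F \<le> R" if F: "F \<subseteq> {l\<in>\<Lambda>. floor_vec l = j}" "finite F" for F j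
  proof (cases "F = {}")
    case False
    \<comment> \<open>The coordinatewise maximum of \<open>F\<close>. Since the points of
      \<open>F\<close> share one integer cell, it lies in the half-open cube attached to each of
      them, so the counting sum at this single point sees all of \<open>F\<close>.\<close>
    define x :: "real^'n" where "x = (\<chi> i. Max ((\<lambda>l. l $ i) ` F))"
    have "x \<in> (+) l ` unit_cube" if l: "l \<in> F" for l
    proof -
      have "0 \<le> x $ i - l $ i \<and> x $ i - l $ i < 1" for i
      proof -
        have "Max ((\<lambda>l. l $ i) ` F) \<in> (\<lambda>l. l $ i) ` F" using F False by (intro Max_in) auto
        then obtain l' where l': "l' \<in> F" "x $ i = l' $ i" by (auto simp: x_def)
        have "floor_vec l' = j" "floor_vec l = j" using F l l' by auto
        then have "floor_vec l' $ i = floor_vec l $ i" by simp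
        moreover have "l $ i \<le> x $ i" using F l by (auto simp: x_def)
        ultimately show ?thesis unfolding l'(2) floor_vec_component by linarith
      qed
      then have "x - l \<in> unit_cube" by (simp add: unit_cube_def)
      then show ?thesis by (intro image_eqI[of _ _ "x - l"]) auto
    qed
    then have "of_nat (card F) = (\<Sum>l\<in>F. indicator ((+) l ` unit_cube) x :: ennreal)"
      by simp
    also have "\<dots> \<le> s x"
      unfolding s_def using F by (intro sum_le_infsum_ennreal) auto
    also have "\<dots> \<le> (SUP x. s x)" by (rule SUP_upper) simp
    also have "\<dots> < of_nat R" by (rule R)
    finally show ?thesis by simp
  qed simp
  then have "finite {l\<in>\<Lambda>. floor_vec l = j}" "card {l\<in>\<Lambda>. floor_vec l = j} \<le> R" for j
    using finite_if_finite_subsets_card_bdd[of "{l\<in>\<Lambda>. floor_vec l = j}" R] by auto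
  then show ?thesis by (rule that)
qed

lemma countable_of_finite_fibres:
  assumes "\<And>j :: int^'n. finite {l\<in>A. f l = j}"
  shows "countable A"
proof -
  have "A = (\<Union>j. {l\<in>A. f l = j})" by auto
  moreover have "countable (\<Union>j\<in>UNIV. {l\<in>A. f l = j})"
    by (intro countable_UN countable_int_vec countable_finite assms)
  ultimately show ?thesis by simp
qed

lemma nn_integral_fibres_le:
  assumes "\<And>j. finite {a\<in>A. f a = j}" "\<And>j. card {a\<in>A. f a = j} \<le> R"
  shows "(\<integral>\<^sup>+a. X (f a) \<partial>count_space A) \<le> of_nat R * nsum X"
proof -
  have "(\<integral>\<^sup>+a. X (f a) \<partial>count_space A) = nsum (\<lambda>a. X (f a) * indicator A a)"
    using nn_integral_restrict_space[of A "count_space UNIV" "\<lambda>a. X (f a)"]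
    by (simp add: restrict_count_space)
  also have "\<dots> = nsum (\<lambda>a. nsum (\<lambda>j. if j = f a then X (f a) * indicator A a else 0))"
    by (simp add: nsum_single)
  also have "\<dots> = nsum (\<lambda>j. nsum (\<lambda>a. X j * indicator {a\<in>A. f a = j} a))"
    by (subst nsum_swap) (intro nn_integral_cong; auto simp: indicator_def)
  also have "\<dots> = nsum (\<lambda>j. X j * of_nat (card {a\<in>A. f a = j}))"
    unfolding nsum_cmult(1) using assms(1) by (simp add: one_ennreal_def[symmetric] emeasure_count_space)
  also have "\<dots> \<le> nsum (\<lambda>j. X j * of_nat R)"
    by (intro nsum_mono mult_left_mono of_nat_mono assms) auto
  finally show ?thesis by (simp add: nsum_cmult mult.commute)
qed

section \<open>Grids of mesh \<open>1 / q\<close> and bumps on their cells\<close>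

text \<open>The unit cell that contains the grid cell \<open>i\<close> of side
  \<open>1 / q\<close>.\<close>

definition block_index :: "nat \<Rightarrow> int^'n \<Rightarrow> int^'n" where
  "block_index q i = (\<chi> l. i $ l div int q)"

lemma block_index_floor_vec:
  assumes "0 < q"
  shows "block_index q (floor_vec (real q *\<^sub>R x)) = floor_vec x"
proof -
  have "\<lfloor>real q * x $ l\<rfloor> div int q = \<lfloor>real q * x $ l / real_of_int (int q)\<rfloor>" for l
    by (rule floor_divide_real_eq_div[symmetric]) simp
  then show ?thesis using assms by (simp add: block_index_def vec_eq_iff)
qed

lemma block_index_fibre:
  assumes "0 < q"
  shows "finite {i :: int^'n. block_index q i = k}"
    "card {i :: int^'n. block_index q i = k} \<le> card (lattice_box (int q) :: (int^'n) set)"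
proof -
  have sub: "{i :: int^'n. block_index q i = k} \<subseteq> (\<lambda>r. (\<chi> l. int q * k $ l + r $ l)) ` lattice_box (int q)"
  proof
    fix i :: "int^'n" assume "i \<in> {i. block_index q i = k}"
    then have "k $ l = i $ l div int q" for l by (auto simp: block_index_def)
    then have "i = (\<chi> l. int q * k $ l + (\<chi> l. i $ l mod int q) $ l)" by (simp add: vec_eq_iff)
    moreover have "(\<chi> l. i $ l mod int q) \<in> lattice_box (int q)"
      using assms by (auto simp: lattice_box_def intro: less_imp_le)
    ultimately show "i \<in> (\<lambda>r. (\<chi> l. int q * k $ l + r $ l)) ` lattice_box (int q)" by (rule image_eqI)
  qed
  then show "finite {i :: int^'n. block_index q i = k}" by (rule finite_subset) simp
  show "card {i :: int^'n. block_index q i = k} \<le> card (lattice_box (int q) :: (int^'n) set)"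
    by (rule order_trans[OF card_mono[OF _ sub] card_image_le]) simp_all
qed

text \<open>Confinement to one grid cell leaves at most one nonzero bump at each point. The global
  Lipschitz bound, also across cell boundaries, is what gives superpositions of bumps a small
  modulus of continuity.\<close>

definition grid_kernels :: "nat \<Rightarrow> (int^'n \<Rightarrow> real^'n \<Rightarrow> real) \<Rightarrow> real \<Rightarrow> bool" where
  "grid_kernels q h B \<longleftrightarrow> (\<forall>i x. 0 \<le> h i x \<and> h i x \<le> B) \<and>
    (\<forall>i x. h i x \<noteq> 0 \<longrightarrow> floor_vec (real q *\<^sub>R x) = i) \<and>
    (\<forall>i x y. \<bar>h i x - h i y\<bar> \<le> B * norm (x - y)) \<and>
    (\<forall>i. integrable lborel (h i) \<and> (\<integral>x. h i x \<partial>lborel) = 1)"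

lemma grid_kernelsD:
  assumes "grid_kernels q h B"
  shows "0 \<le> h i x" "h i x \<le> B" "h i x \<noteq> 0 \<Longrightarrow> floor_vec (real q *\<^sub>R x) = i"
    "\<bar>h i x - h i y\<bar> \<le> B * norm (x - y)" "integrable lborel (h i)" "(\<integral>x. h i x \<partial>lborel) = 1"
  using assms unfolding grid_kernels_def by blast+

text \<open>Cone functions over the balls inscribed in the grid cells, divided by their integrals.
  By translation invariance of volume the integrals have a common lower bound, so one
  \<open>B\<close> serves all cells.\<close>

lemma ex_grid_kernels:
  assumes q: "0 < q"
  shows "\<exists>(h :: int^'n \<Rightarrow> real^'n \<Rightarrow> real) B. grid_kernels q h B"
proof -
  define r where "r = 1 / (2 * real q)"
  have r: "0 < r" using q by (simp add: r_def)
  define z :: "int^'n \<Rightarrow> real^'n" where "z i = (\<chi> l. (of_int (i $ l) + 1 / 2) / real q)" for i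
  define g where "g i x = max 0 (r - norm (x - z i))" for i x
  have g0: "0 \<le> g i x" and gr: "g i x \<le> r" for i x using r by (auto simp: g_def)
  have supp: "floor_vec (real q *\<^sub>R x) = i" if "g i x \<noteq> 0" for i x
  proof -
    have "norm (x - z i) < r" using that by (auto simp: g_def max_def split: if_splits)
    then have *: "\<bar>x $ l - (of_int (i $ l) + 1 / 2) / real q\<bar> < 1 / (2 * real q)" for l
      using component_le_norm_cart[of "x - z i" l] by (simp add: z_def r_def)
    have "\<lfloor>real q * x $ l\<rfloor> = i $ l" for l
    proof -
      have "(of_int (i $ l) + 1 / 2) / real q + 1 / (2 * real q) = (of_int (i $ l) + 1) / real q"
        "(of_int (i $ l) + 1 / 2) / real q - 1 / (2 * real q) = of_int (i $ l) / real q"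
        using q by (simp_all add: field_simps)
      moreover have "a < c + d" "c - d < a" if "\<bar>a - c\<bar> < d" for a c d :: real
        using that by linarith+
      ultimately have "x $ l < (of_int (i $ l) + 1) / real q" "of_int (i $ l) / real q < x $ l"
        using *[of l] by metis+
      then have "real q * x $ l < of_int (i $ l) + 1" "of_int (i $ l) < real q * x $ l"
        using q by (simp_all add: pos_less_divide_eq pos_divide_less_eq mult.commute)
      then show ?thesis by (simp add: floor_eq_iff)
    qed
    then show ?thesis by (simp add: vec_eq_iff)
  qed
  have lip: "\<bar>g i x - g i y\<bar> \<le> norm (x - y)" for i x y
    using norm_triangle_ineq3[of "x - z i" "y - z i"] by (auto simp: g_def)
  have gm [measurable]: "g i \<in> borel_measurable lborel" for i
    unfolding g_def by measurable
  have int: "integrable lborel (g i)" for i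
  proof (rule integrableI_bounded_set[where A = "cball (z i) r" and B = r])
    show "AE x in lborel. x \<in> cball (z i) r \<longrightarrow> norm (g i x) \<le> r" using g0 gr by auto
    show "AE x in lborel. x \<notin> cball (z i) r \<longrightarrow> g i x = 0"
      by (auto simp: g_def dist_norm norm_minus_commute)
  qed (use emeasure_lborel_cball_finite in auto)
  \<comment> \<open>The cone of height and radius \<open>r\<close> is at least \<open>r / 2\<close>
    on the concentric ball of radius \<open>r / 2\<close>.\<close>
  define m where "m = r / 2 * measure lborel (ball (0 :: real^'n) (r / 2))"
  have m: "0 < m" using r by (simp add: m_def content_ball_pos)
  have mass: "m \<le> (\<integral>x. g i x \<partial>lborel)" for i
  proof -
    have "measure lborel (ball (z i) (r / 2)) = measure lborel (ball (0 :: real^'n) (r / 2))"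
      using r by (simp add: content_ball)
    then have "m = (\<integral>x. (r / 2) * indicator (ball (z i) (r / 2)) x \<partial>lborel)" by (simp add: m_def)
    also have "\<dots> \<le> (\<integral>x. g i x \<partial>lborel)"
    proof (rule integral_mono[OF _ int])
      show "integrable lborel (\<lambda>x. (r / 2) * indicator (ball (z i) (r / 2)) x :: real)"
        by (intro integrable_mult_right integrable_real_indicator) (use emeasure_lborel_ball_finite in auto)
      show "r / 2 * indicator (ball (z i) (r / 2)) x \<le> g i x" for x
        using r by (auto simp: g_def indicator_def dist_norm norm_minus_commute)
    qed
    finally show ?thesis .
  qed
  define h where "h i x = g i x / (\<integral>x. g i x \<partial>lborel)" for i x
  define B where "B = max (r / m) (1 / m)"
  have pos: "0 < (\<integral>x. g i x \<partial>lborel)" for i using mass[of i] m by linarith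
  show ?thesis
  proof (intro exI[of _ h] exI[of _ B], unfold grid_kernels_def, intro conjI allI impI)
    show "0 \<le> h i x" for i x using g0[of i x] pos[of i] by (simp add: h_def)
    show "h i x \<le> B" for i x
    proof -
      have "h i x \<le> r / m" unfolding h_def using gr[of i x] g0[of i x] mass[of i] m r by (intro frac_le) auto
      then show ?thesis by (simp add: B_def)
    qed
    show "floor_vec (real q *\<^sub>R x) = i" if "h i x \<noteq> 0" for i x
      using that by (intro supp) (auto simp: h_def)
    show "\<bar>h i x - h i y\<bar> \<le> B * norm (x - y)" for i x y
    proof -
      have "\<bar>h i x - h i y\<bar> = \<bar>g i x - g i y\<bar> / (\<integral>x. g i x \<partial>lborel)"
        using pos[of i] by (simp add: h_def diff_divide_distrib[symmetric])
      also have "\<dots> \<le> norm (x - y) / m" using lip[of i x y] mass[of i] m by (intro frac_le) auto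
      also have "\<dots> = (1 / m) * norm (x - y)" by simp
      also have "\<dots> \<le> B * norm (x - y)" by (intro mult_right_mono) (auto simp: B_def)
      finally show ?thesis .
    qed
    show "integrable lborel (h i)" for i unfolding h_def using int by simp
    show "(\<integral>x. h i x \<partial>lborel) = 1" for i unfolding h_def using pos[of i] by simp
  qed
qed

text \<open>An average with respect to a probability density stays in any closed disc containing the
  averaged values. It is applied with \<open>v\<close> a value of the function to control
  oscillation, and with \<open>v = 0\<close> to control size.\<close>

lemma kernel_average_bound:
  fixes f :: "'a::euclidean_space \<Rightarrow> complex" and h :: "'a \<Rightarrow> real"
  assumes [measurable]: "f \<in> borel_measurable M" and h: "integrable M h" "\<And>x. 0 \<le> h x"
    and one: "(\<integral>x. h x \<partial>M) = 1"
    and D: "\<And>x. h x \<noteq> 0 \<Longrightarrow> ennreal (cmod (v - f x)) \<le> D"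
  shows "ennreal (cmod (v - (\<integral>x. h x *\<^sub>R f x \<partial>M))) \<le> D"
    and "D < top \<Longrightarrow> integrable M (\<lambda>x. h x *\<^sub>R f x)"
proof -
  have [measurable]: "h \<in> borel_measurable M" using h by auto
  have int: "integrable M (\<lambda>x. h x *\<^sub>R (v - f x))" and "cmod (\<integral>x. h x *\<^sub>R (v - f x) \<partial>M) \<le> d"
    if d: "D = ennreal d" "0 \<le> d" for d
  proof -
    have le: "norm (h x *\<^sub>R (v - f x)) \<le> norm (d * h x)" for x
      using D[of x] h(2)[of x] d by (cases "h x = 0") (auto simp: mult.commute[of d] intro: mult_left_mono)
    show int: "integrable M (\<lambda>x. h x *\<^sub>R (v - f x))"
      by (rule Bochner_Integration.integrable_bound[of _ "\<lambda>x. d * h x"]) (use h le in auto)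
    have "cmod (\<integral>x. h x *\<^sub>R (v - f x) \<partial>M) \<le> (\<integral>x. d * h x \<partial>M)"
      by (rule Bochner_Integration.integral_norm_bound_integral[OF int]) (use h le d in auto)
    then show "cmod (\<integral>x. h x *\<^sub>R (v - f x) \<partial>M) \<le> d" using one by simp
  qed
  note b = this
  have split: "h x *\<^sub>R f x = h x *\<^sub>R v - h x *\<^sub>R (v - f x)" for x by (simp add: scaleR_diff_right)
  have hv: "integrable M (\<lambda>x. h x *\<^sub>R v)" using h by simp
  show "integrable M (\<lambda>x. h x *\<^sub>R f x)" if "D < top"
  proof -
    obtain d where d: "D = ennreal d" "0 \<le> d" using \<open>D < top\<close> by (cases D) auto
    show ?thesis unfolding split by (intro Bochner_Integration.integrable_diff hv b(1)[OF d])
  qed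
  show "ennreal (cmod (v - (\<integral>x. h x *\<^sub>R f x \<partial>M))) \<le> D"
  proof (cases D)
    case (real d)
    have "(\<integral>x. h x *\<^sub>R f x \<partial>M) = (\<integral>x. h x *\<^sub>R v \<partial>M) - (\<integral>x. h x *\<^sub>R (v - f x) \<partial>M)"
      unfolding split by (intro Bochner_Integration.integral_diff hv b(1)) (use real in auto)
    also have "(\<integral>x. h x *\<^sub>R v \<partial>M) = v" using one h by simp
    finally show ?thesis using b(2)[of d] real by simp
  qed simp
qed

section \<open>Duality for a weighted sequence norm\<close>

text \<open>As \<open>int^'n\<close> is discrete, the type of bounded continuous functions on it
  consists of all bounded sequences; it is the vector space in which the duality argument takes
  place.\<close>

lemma continuous_on_int_vec: "continuous_on A (f :: int^'n \<Rightarrow> 'b::topological_space)"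
proof -
  have "open {x}" for x :: "int^'n"
    unfolding open_vec_def
    by (auto simp: vec_eq_iff open_discrete intro!: exI[of _ "\<lambda>i. {x $ i}"])
  then have "open (S :: (int^'n) set)" for S
    using open_UN[of S "\<lambda>x. {x}"] by simp
  then have "continuous_on UNIV f"
    by (simp add: continuous_on_open_vimage)
  then show ?thesis by (rule continuous_on_subset) simp
qed

lemma apply_Bcontfun_int_vec:
  fixes g :: "int^'n \<Rightarrow> 'b::metric_space"
  assumes "bounded (range g)"
  shows "apply_bcontfun (Bcontfun g) = g"
  by (rule Bcontfun_inverse) (simp add: bcontfun_def continuous_on_int_vec assms)

lemma has_sum_complex_parts:
  assumes "((\<lambda>i. Re (f i)) has_sum x) A" "((\<lambda>i. Im (f i)) has_sum y) A"
  shows "(f has_sum Complex x y) A"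
proof -
  have "((\<lambda>i. of_real (Re (f i)) + \<i> * of_real (Im (f i))) has_sum of_real x + \<i> * of_real y) A"
    by (intro has_sum_add has_sum_cmult_right has_sum_of_real assms)
  then show ?thesis by (simp add: complex_eq[symmetric] Complex_eq)
qed

text \<open>A functional on bounded sequences need not be given by a series. Domination by the
  weighted seminorm \<open>N\<close> rules out a part at infinity: truncations converge in
  \<open>N\<close> because \<open>w\<close> is summable, although they need not converge in the
  supremum norm.\<close>

theorem weighted_l1_duality:
  fixes a :: "int^'n \<Rightarrow> 'l \<Rightarrow> complex" and w :: "int^'n \<Rightarrow> real"
  assumes w0: "\<And>i. 0 \<le> w i" and w: "w summable_on UNIV"
    and bdd: "\<And>l. l \<in> \<Lambda> \<Longrightarrow> bounded (range (\<lambda>i. a i l))" and l0: "l0 \<in> \<Lambda>"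
    and est: "\<And>c. finite {l. c l \<noteq> 0} \<Longrightarrow> {l. c l \<noteq> 0} \<subseteq> \<Lambda> \<Longrightarrow>
      cmod (c l0) \<le> (\<Sum>\<^sub>\<infinity>i. w i * cmod (\<Sum>l | c l \<noteq> 0. c l * a i l))"
  obtains b where "\<And>i. cmod (b i) \<le> 2 * w i"
    "\<And>l. l \<in> \<Lambda> \<Longrightarrow> ((\<lambda>i. b i * a i l) has_sum (if l = l0 then 1 else 0)) UNIV"
proof -
  define N :: "((int^'n) \<Rightarrow>\<^sub>C complex) \<Rightarrow> real" where "N g = (\<Sum>\<^sub>\<infinity>i. w i * cmod (g i))" for g
  have sumN: "(\<lambda>i. w i * cmod (g i)) summable_on UNIV" for g :: "(int^'n) \<Rightarrow>\<^sub>C complex"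
    by (rule summable_on_comparison_test[OF summable_on_cmult_left[OF w, of "norm g"]])
      (auto intro!: mult_left_mono mult_nonneg_nonneg w0 norm_bounded)
  have N: "sublinear N"
  proof (rule sublinearI)
    fix g h
    have "N (g + h) \<le> (\<Sum>\<^sub>\<infinity>i. w i * cmod (g i) + w i * cmod (h i))"
      unfolding N_def
      by (intro infsum_mono sumN summable_on_add)
        (auto simp: distrib_left[symmetric] intro!: mult_left_mono w0 norm_triangle_ineq)
    also have "\<dots> = N g + N h" unfolding N_def by (intro infsum_add sumN)
    finally show "N (g + h) \<le> N g + N h" .
  next
    fix t :: real and g assume "0 < t"
    then show "N (t *\<^sub>R g) \<le> t * N g"
      unfolding N_def by (simp add: infsum_cmult_right'[symmetric] mult_ac)
  qed (simp add: N_def)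
  define C where "C = {c :: 'l \<Rightarrow> complex. finite {l. c l \<noteq> 0} \<and> {l. c l \<noteq> 0} \<subseteq> \<Lambda>}"
  define A where "A c i = (\<Sum>l | c l \<noteq> 0. c l * a i l)" for c :: "'l \<Rightarrow> complex" and i
  have A_eq: "A c i = (\<Sum>l\<in>F. c l * a i l)" if "finite F" "{l. c l \<noteq> 0} \<subseteq> F" for c i F
    unfolding A_def using that by (intro sum.mono_neutral_left) auto
  \<comment> \<open>Real parts suffice, because \<open>C\<close> is closed under multiplication by
    complex scalars.\<close>
  define S where "S = {(g :: (int^'n) \<Rightarrow>\<^sub>C complex, Re (c l0)) | g c. c \<in> C \<and> apply_bcontfun g = A c}"
  have "convex_cone S" unfolding convex_cone_iff
  proof (intro conjI ballI allI impI)
    show "0 \<in> S"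
      by (auto simp: S_def zero_prod_def C_def A_def fun_eq_iff intro!: exI[of _ "\<lambda>_. 0"])
  next
    fix x y assume "x \<in> S" "y \<in> S"
    then obtain g c h d where x: "x = (g, Re (c l0))" "c \<in> C" "apply_bcontfun g = A c"
      and y: "y = (h, Re (d l0))" "d \<in> C" "apply_bcontfun h = A d"
      unfolding S_def by blast
    have F: "finite ({l. c l \<noteq> 0} \<union> {l. d l \<noteq> 0})" using x y by (simp add: C_def)
    have sub: "{l. c l + d l \<noteq> 0} \<subseteq> {l. c l \<noteq> 0} \<union> {l. d l \<noteq> 0}" by auto
    then have "(\<lambda>l. c l + d l) \<in> C" using x y F finite_subset[OF sub F] by (auto simp: C_def)
    moreover have "A (\<lambda>l. c l + d l) i = A c i + A d i" for i
      unfolding A_eq[OF F sub] A_eq[OF F Un_upper1] A_eq[OF F Un_upper2]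
      by (simp add: sum.distrib algebra_simps)
    ultimately show "x + y \<in> S"
      unfolding S_def using x y
      by (auto simp: fun_eq_iff intro!: exI[of _ "\<lambda>l. c l + d l"])
  next
    fix x and t :: real assume "x \<in> S" "0 \<le> t"
    then obtain g c where x: "x = (g, Re (c l0))" "c \<in> C" "apply_bcontfun g = A c"
      unfolding S_def by blast
    have F: "finite {l. c l \<noteq> 0}" using x by (simp add: C_def)
    have sub: "{l. t * c l \<noteq> 0} \<subseteq> {l. c l \<noteq> 0}" by auto
    then have "(\<lambda>l. t * c l) \<in> C" using x finite_subset[OF sub F] by (auto simp: C_def)
    moreover have "A (\<lambda>l. t * c l) i = t * A c i" for i
      unfolding A_eq[OF F sub] A_eq[OF F order_refl] by (simp add: sum_distrib_left mult_ac)
    ultimately show "t *\<^sub>R x \<in> S"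
      unfolding S_def using x
      by (auto simp: fun_eq_iff scaleR_conv_of_real intro!: exI[of _ "\<lambda>l. t * c l"])
  qed
  moreover have "\<forall>(g, r)\<in>S. r \<le> N g"
  proof clarify
    fix g r assume "(g, r) \<in> S"
    then obtain c where "c \<in> C" "r = Re (c l0)" "apply_bcontfun g = A c"
      by (auto simp: S_def)
    then show "r \<le> N g"
      using est[of c] complex_Re_le_cmod[of "c l0"] by (simp add: C_def N_def A_def)
  qed
  ultimately obtain f where f: "linear f" "\<And>g. f g \<le> N g" and fS: "\<And>g r. (g, r) \<in> S \<Longrightarrow> r \<le> f g"
    using Mazur_Orlicz[OF N] by blast
  have f_abs: "\<bar>f g\<bar> \<le> N g" for g
    using f(2)[of g] f(2)[of "- g"] linear_neg[OF f(1), of g] by (simp add: N_def)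
  define E where "E i z = Bcontfun (\<lambda>j. if j = i then z else 0)" for i :: "int^'n" and z :: complex
  have E: "apply_bcontfun (E i z) = (\<lambda>j. if j = i then z else 0)" for i z
  proof -
    have "finite (range (\<lambda>j. if j = i then z else 0))"
      by (rule finite_subset[of _ "{z, 0}"]) auto
    then show ?thesis unfolding E_def by (rule apply_Bcontfun_int_vec[OF finite_imp_bounded])
  qed
  have NE: "N (E i z) = w i * cmod z" for i z
  proof -
    have "N (E i z) = (\<Sum>\<^sub>\<infinity>j\<in>{i}. w j * cmod (E i z j))"
      unfolding N_def by (rule infsum_cong_neutral) (auto simp: E)
    then show ?thesis by (simp add: E)
  qed
  \<comment> \<open>Complexification of the real functional, arranged so that
    \<open>f (E i z) = Re (b i * z)\<close>. Bounding the real and imaginary parts separately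
    produces the factor 2.\<close>
  define b where "b i = Complex (f (E i 1)) (- f (E i \<i>))" for i
  have b: "cmod (b i) \<le> 2 * w i" for i
    using cmod_le[of "b i"] f_abs[of "E i 1"] f_abs[of "E i \<i>"] by (simp add: b_def NE)
  have fE: "f (E i z) = Re (b i * z)" for i z
  proof -
    have "E i z = Re z *\<^sub>R E i 1 + Im z *\<^sub>R E i \<i>"
      by (rule bcontfun_eqI) (auto simp: E complex_eq_iff)
    then show ?thesis by (simp add: linear_add[OF f(1)] linear_scale[OF f(1)] b_def)
  qed
  have f_sum: "((\<lambda>i. Re (b i * g i)) has_sum f g) UNIV" for g :: "(int^'n) \<Rightarrow>\<^sub>C complex"
  proof -
    \<comment> \<open>The remainder is \<open>f\<close> applied to \<open>g\<close> outside
      \<open>F\<close>, and \<open>N\<close> of that part is the tail of a convergent sum.\<close>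
    have "norm (f g - (\<Sum>i\<in>F. Re (b i * g i))) \<le> N g - (\<Sum>i\<in>F. w i * cmod (g i))" if F: "finite F" for F
    proof -
      define h where "h = (\<Sum>i\<in>F. E i (g i))"
      have h: "h j = (if j \<in> F then g j else 0)" for j
      proof -
        have "apply_bcontfun (\<Sum>i\<in>F. E i (g i)) j = (\<Sum>i\<in>F. E i (g i) j)"
          using F by (induction F) auto
        then show ?thesis using F by (simp add: h_def E)
      qed
      have "f g - (\<Sum>i\<in>F. Re (b i * g i)) = f (g - h)"
        by (simp add: h_def linear_diff[OF f(1)] linear_sum[OF f(1)] fE)
      also have "\<bar>\<dots>\<bar> \<le> N (g - h)" by (rule f_abs)
      also have "N (g - h) = (\<Sum>\<^sub>\<infinity>i. w i * cmod (g i) - (if i \<in> F then w i * cmod (g i) else 0))"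
        unfolding N_def by (rule infsum_cong) (simp add: h)
      also have "\<dots> = N g - (\<Sum>i\<in>F. w i * cmod (g i))"
      proof (rule infsumI)
        have "((\<lambda>i. if i \<in> F then w i * cmod (g i) else 0) has_sum (\<Sum>i\<in>F. w i * cmod (g i))) UNIV"
          using has_sum_finite[OF F] by (subst has_sum_cong_neutral[where T = F]) auto
        then show "((\<lambda>i. w i * cmod (g i) - (if i \<in> F then w i * cmod (g i) else 0)) has_sum
            N g - (\<Sum>i\<in>F. w i * cmod (g i))) UNIV"
          unfolding N_def diff_conv_add_uminus by (intro has_sum_add has_sum_uminusI has_sum_infsum sumN)
      qed
      finally show ?thesis by simp
    qed
    then have ev: "\<forall>\<^sub>F F in finite_subsets_at_top UNIV.
        norm (f g - (\<Sum>i\<in>F. Re (b i * g i))) \<le> N g - (\<Sum>i\<in>F. w i * cmod (g i))"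
      by (intro eventually_finite_subsets_at_top_weakI) auto
    have t0: "((\<lambda>F. N g - (\<Sum>i\<in>F. w i * cmod (g i))) \<longlongrightarrow> N g - N g) (finite_subsets_at_top UNIV)"
      using has_sum_infsum[OF sumN[of g]] unfolding has_sum_def N_def
      by (intro tendsto_diff tendsto_const)
    have "((\<lambda>F. f g - (\<Sum>i\<in>F. Re (b i * g i))) \<longlongrightarrow> 0) (finite_subsets_at_top UNIV)"
      using t0 unfolding diff_self by (rule Lim_null_comparison[OF ev])
    then have "((\<lambda>F. f g - (f g - (\<Sum>i\<in>F. Re (b i * g i)))) \<longlongrightarrow> f g - 0) (finite_subsets_at_top UNIV)"
      by (intro tendsto_diff tendsto_const)
    then show ?thesis by (simp add: has_sum_def)
  qed
  have "((\<lambda>i. b i * a i l) has_sum (if l = l0 then 1 else 0)) UNIV" if l: "l \<in> \<Lambda>" for l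
  proof -
    have key: "((\<lambda>i. Re (b i * (z * a i l))) has_sum (if l = l0 then Re z else 0)) UNIV" for z
    proof -
      define g where "g z = Bcontfun (\<lambda>i. z * a i l)" for z
      have g: "apply_bcontfun (g z) = (\<lambda>i. z * a i l)" for z
      proof -
        obtain B where "\<And>i. cmod (a i l) \<le> B" using bdd[OF l] by (auto simp: bounded_iff)
        then have "bounded (range (\<lambda>i. z * a i l))"
          by (auto simp: bounded_iff norm_mult intro!: exI[of _ "cmod z * B"] mult_left_mono)
        then show ?thesis unfolding g_def by (rule apply_Bcontfun_int_vec)
      qed
      have S: "(g z, if l = l0 then Re z else 0) \<in> S" for z
      proof -
        define c where "c = (\<lambda>k. if k = l then z else 0)"
        have "c \<in> C" using l by (auto simp: C_def c_def)
        moreover have "A c i = z * a i l" for i by (subst A_eq[of "{l}"]) (auto simp: c_def)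
        ultimately show ?thesis unfolding S_def
          by (auto simp: g fun_eq_iff c_def intro!: exI[of _ c])
      qed
      \<comment> \<open>The cone inequality for \<open>z\<close> and for \<open>- z\<close> together
        gives an equality.\<close>
      have "g (- z) = - g z" by (rule bcontfun_eqI) (simp add: g)
      then have "f (g z) = (if l = l0 then Re z else 0)"
        using fS[OF S[of z]] fS[OF S[of "- z"]] linear_neg[OF f(1), of "g z"] by (auto split: if_splits)
      then show ?thesis using f_sum[of "g z"] by (simp add: g)
    qed
    have "((\<lambda>i. Re (b i * a i l)) has_sum (if l = l0 then 1 else 0)) UNIV"
      using key[of 1] by (cases "l = l0") simp_all
    \<comment> \<open>Multiplication by \<open>- \<i>\<close> turns the imaginary part into a real
      part.\<close>
    moreover have "((\<lambda>i. Im (b i * a i l)) has_sum 0) UNIV"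
      using key[of "- \<i>"] by (cases "l = l0") (simp_all add: algebra_simps)
    ultimately have "((\<lambda>i. b i * a i l) has_sum Complex (if l = l0 then 1 else 0) 0) UNIV"
      by (rule has_sum_complex_parts)
    then show ?thesis by (cases "l = l0") (simp_all add: Complex_eq)
  qed
  with b show ?thesis by (rule that)
qed

section \<open>Sequence norms and function norms\<close>

lemma ennreal_infsum_eq_nsum:
  fixes f :: "int^'n \<Rightarrow> real"
  assumes "\<And>i. 0 \<le> f i" "f summable_on UNIV"
  shows "ennreal (infsum f UNIV) = nsum (\<lambda>i. ennreal (f i))"
proof -
  have "ennreal (infsum f UNIV) = (SUP F\<in>{F. finite F \<and> F \<subseteq> UNIV}. ennreal (sum f F))"
    using assms by (intro infsum_nonneg_is_SUPREMUM_ennreal) auto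
  also have "\<dots> = (SUP F\<in>{F. finite F \<and> F \<subseteq> UNIV}. (\<Sum>i\<in>F. ennreal (f i)))"
    by (simp add: assms(1))
  also have "\<dots> = infsum (\<lambda>i. ennreal (f i)) UNIV"
    by (rule nonneg_infsum_complete[symmetric]) simp
  also have "\<dots> = nsum (\<lambda>i. ennreal (f i))"
    by (rule infsum_ennreal_countable) (rule countable_int_vec)
  finally show ?thesis .
qed

lemma summable_on_of_nsum:
  fixes f :: "int^'n \<Rightarrow> real"
  assumes "\<And>i. 0 \<le> f i" "nsum (\<lambda>i. ennreal (f i)) < top"
  shows "f summable_on UNIV"
proof (rule nonneg_bdd_above_summable_on)
  show "bdd_above (sum f ` {F. F \<subseteq> UNIV \<and> finite F})"
  proof (rule bdd_aboveI2)
    fix F :: "(int^'n) set" assume "F \<in> {F. F \<subseteq> UNIV \<and> finite F}"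
    then have F: "finite F" by simp
    have "ennreal (sum f F) = (\<Sum>i\<in>F. ennreal (f i))" by (simp add: assms(1))
    also have "\<dots> \<le> infsum (\<lambda>i. ennreal (f i)) UNIV" by (rule sum_le_infsum_ennreal[OF F]) simp
    also have "\<dots> = nsum (\<lambda>i. ennreal (f i))"
      by (rule infsum_ennreal_countable) (rule countable_int_vec)
    also have "\<dots> = ennreal (enn2real (nsum (\<lambda>i. ennreal (f i))))"
      using assms(2) by simp
    finally show "sum f F \<le> enn2real (nsum (\<lambda>i. ennreal (f i)))"
      by (simp add: ennreal_le_iff)
  qed
qed (rule assms(1))

text \<open>Young's convolution inequality, from Minkowski's inequality and translation
  invariance.\<close>

lemma seq_norm_convolution:
  fixes X Y :: "int^'n \<Rightarrow> ennreal"
  assumes "1 \<le> p"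
  shows "seq_norm p (\<lambda>k. nsum (\<lambda>j. X (k - j) * Y j)) \<le> nsum X * seq_norm p Y"
proof -
  have eq: "(\<lambda>k. nsum (\<lambda>j. X (k - j) * Y j)) = (\<lambda>k. nsum (\<lambda>i. X i * Y (k - i)))"
  proof
    fix k show "nsum (\<lambda>j. X (k - j) * Y j) = nsum (\<lambda>i. X i * Y (k - i))"
      using nsum_shift(4)[of "\<lambda>j. X (k - j) * Y j" k] by simp
  qed
  have "seq_norm p (\<lambda>k. nsum (\<lambda>i. X i * Y (k - i))) \<le> nsum (\<lambda>i. seq_norm p (\<lambda>k. X i * Y (k - i)))"
    by (rule seq_norm_nsum[OF assms])
  also have "\<dots> = nsum X * seq_norm p Y"
    by (simp add: seq_norm_cmult[OF assms] seq_norm_shift nsum_cmult)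
  finally show ?thesis unfolding eq .
qed

lemma floor_vec_fibre:
  fixes k :: "int^'n"
  shows "{x. floor_vec x = k} \<in> sets lborel" "emeasure lborel {x. floor_vec x = k} \<le> 1"
proof -
  define a b :: "real^'n" where "a = (\<chi> i. of_int (k $ i))" and "b = (\<chi> i. of_int (k $ i) + 1)"
  have eq: "{x. floor_vec x = k} = (\<Inter>i. {x. a $ i \<le> x $ i}) \<inter> (\<Inter>i. {x. x $ i < b $ i})"
    by (auto simp: vec_eq_iff floor_eq_iff a_def b_def)
  have "closed (\<Inter>i. {x. a $ i \<le> x $ i})" "open (\<Inter>i. {x. x $ i < b $ i})"
    by (auto intro!: closed_INT open_INT closed_halfspace_component_ge_cart open_halfspace_component_lt_cart)
  then show "{x. floor_vec x = k} \<in> sets lborel" unfolding eq by (intro sets.Int) auto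
  have "emeasure lborel {x. floor_vec x = k} \<le> emeasure lborel (cbox a b)"
    unfolding eq by (intro emeasure_mono) (auto simp: mem_box_cart less_imp_le)
  also have "\<dots> = ennreal (measure lborel (cbox a b))"
    using emeasure_lborel_cbox_finite[of a b] by (intro emeasure_eq_ennreal_measure) auto
  also have "measure lborel (cbox a b) = 1"
    by (subst content_cbox_cart) (auto simp: interval_ne_empty_cart a_def b_def)
  finally show "emeasure lborel {x. floor_vec x = k} \<le> 1" by simp
qed

lemma nn_integral_floor_vec_le:
  fixes X :: "int^'n \<Rightarrow> ennreal"
  shows "(\<integral>\<^sup>+x. X (floor_vec x) \<partial>lborel) \<le> nsum X"
proof -
  have "(\<integral>\<^sup>+x. X (floor_vec x) \<partial>lborel)
      = (\<integral>\<^sup>+x. nsum (\<lambda>k. X k * indicator {x. floor_vec x = k} x) \<partial>lborel)"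
  proof (rule nn_integral_cong)
    fix x :: "real^'n"
    have "(\<lambda>k. X k * indicator {x. floor_vec x = k} x) = (\<lambda>k. if k = floor_vec x then X k else 0)"
      by (auto simp: indicator_def)
    then show "X (floor_vec x) = nsum (\<lambda>k. X k * indicator {x. floor_vec x = k} x)"
      by (simp add: nsum_single)
  qed
  also have "\<dots> = nsum (\<lambda>k. \<integral>\<^sup>+x. X k * indicator {x. floor_vec x = k} x \<partial>lborel)"
    using floor_vec_fibre(1)
    by (intro nn_integral_count_space_nn_integral countable_int_vec borel_measurable_times_ennreal
        borel_measurable_indicator) auto
  also have "\<dots> = nsum (\<lambda>k. X k * emeasure lborel {x. floor_vec x = k})"
    by (simp only: nn_integral_cmult_indicator[OF floor_vec_fibre(1)])
  also have "\<dots> \<le> nsum (\<lambda>k. X k * 1)"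
    by (intro nsum_mono mult_left_mono floor_vec_fibre(2)) auto
  finally show ?thesis by simp
qed

lemma Lp_norm_eq_npow:
  "p \<noteq> \<infinity> \<Longrightarrow> Lp_norm M p f =
    npow (1 / enn2real p) (\<integral>\<^sup>+x. npow (enn2real p) (ennreal (cmod (f x))) \<partial>M)"
  by (simp add: Lp_norm_def npow_def Let_def npow_ennreal[unfolded npow_def, simplified])

text \<open>Unit cells have measure at most 1, so passing to a cellwise majorant costs no
  constant.\<close>

lemma Lp_norm_le_seq_norm:
  fixes f :: "real^'n \<Rightarrow> complex"
  assumes p: "1 \<le> p" and f [measurable]: "f \<in> borel_measurable lborel"
    and le: "\<And>x. ennreal (cmod (f x)) \<le> X (floor_vec x)"
  shows "Lp_norm lborel p f \<le> seq_norm p X"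
proof (cases "p = \<infinity>")
  case True
  have "esssup lborel (\<lambda>x. ennreal (cmod (f x))) \<le> (SUP k. X k)"
    by (intro esssup_I AE_I2 order_trans[OF le] SUP_upper) auto
  then show ?thesis using True by (simp add: Lp_norm_def seq_norm_def)
next
  case False
  define r where "r = enn2real p"
  have r: "1 \<le> r" using enn2real_ge_1[OF p False] by (simp add: r_def)
  have "(\<integral>\<^sup>+x. npow r (ennreal (cmod (f x))) \<partial>lborel) \<le> (\<integral>\<^sup>+x. npow r (X (floor_vec x)) \<partial>lborel)"
    using r by (intro nn_integral_mono npow_mono le) auto
  also have "\<dots> \<le> nsum (\<lambda>k. npow r (X k))" by (rule nn_integral_floor_vec_le)
  finally show ?thesis
    using False r by (simp add: Lp_norm_eq_npow seq_norm_def r_def[symmetric] npow_mono)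
qed

section \<open>Coefficient sequences grouped by unit cells\<close>

text \<open>\<open>\<Lambda>\<close> carries no translations, whereas windows and convolutions need
  them; so sequences on \<open>\<Lambda>\<close> are majorized by sequences on the integer lattice.
  A cell without points gets the value 0.\<close>

definition coef_sup :: "(real^'n) set \<Rightarrow> (real^'n \<Rightarrow> complex) \<Rightarrow> int^'n \<Rightarrow> ennreal" where
  "coef_sup \<Lambda> c j = (SUP l\<in>{l\<in>\<Lambda>. floor_vec l = j}. ennreal (cmod (c l)))"

lemma coef_sup_ge: "l \<in> \<Lambda> \<Longrightarrow> ennreal (cmod (c l)) \<le> coef_sup \<Lambda> c (floor_vec l)"
  unfolding coef_sup_def by (rule SUP_upper) simp

text \<open>The window factor is constant on each cell and leaves the supremum; this is why cut-offs
  are composed with \<open>floor_vec\<close>.\<close>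

lemma coef_sup_mult:
  assumes "\<And>k. 0 \<le> u k"
  shows "coef_sup \<Lambda> (\<lambda>l. of_real (u (floor_vec l)) * c l) j = ennreal (u j) * coef_sup \<Lambda> c j"
  unfolding coef_sup_def SUP_mult_left_ennreal
  by (rule SUP_cong) (auto simp: norm_mult ennreal_mult' assms)

lemma nsum_coef_sup_le: "nsum (coef_sup \<Lambda> c) \<le> (\<integral>\<^sup>+l. ennreal (cmod (c l)) \<partial>count_space \<Lambda>)"
proof -
  have "coef_sup \<Lambda> c j \<le> nsum (\<lambda>l. if l \<in> \<Lambda> \<and> floor_vec l = j then ennreal (cmod (c l)) else 0)" for j
    unfolding coef_sup_def
  proof (rule SUP_least)
    fix l assume "l \<in> {l \<in> \<Lambda>. floor_vec l = j}"
    then show "ennreal (cmod (c l)) \<le> nsum (\<lambda>l. if l \<in> \<Lambda> \<and> floor_vec l = j then ennreal (cmod (c l)) else 0)"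
      using nsum_ge[of "\<lambda>l. if l \<in> \<Lambda> \<and> floor_vec l = j then ennreal (cmod (c l)) else 0" l] by simp
  qed
  then have "nsum (coef_sup \<Lambda> c)
      \<le> nsum (\<lambda>j. nsum (\<lambda>l. if l \<in> \<Lambda> \<and> floor_vec l = j then ennreal (cmod (c l)) else 0))"
    by (rule nsum_mono)
  also have "\<dots> = nsum (\<lambda>l. nsum (\<lambda>j. if j = floor_vec l then ennreal (cmod (c l)) * indicator \<Lambda> l else 0))"
    by (subst nsum_swap) (intro nn_integral_cong; auto simp: indicator_def)
  also have "\<dots> = nsum (\<lambda>l. ennreal (cmod (c l)) * indicator \<Lambda> l)"
    by (simp add: nsum_single)
  also have "\<dots> = (\<integral>\<^sup>+l. ennreal (cmod (c l)) \<partial>count_space \<Lambda>)"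
    using nn_integral_restrict_space[of \<Lambda> "count_space UNIV" "\<lambda>l. ennreal (cmod (c l))"]
    by (simp add: restrict_count_space)
  finally show ?thesis .
qed

lemma npow_SUP_finite:
  fixes f :: "'a \<Rightarrow> ennreal"
  assumes "finite A" "0 \<le> r"
  shows "npow r (SUP a\<in>A. f a) = (SUP a\<in>A. npow r (f a))"
proof (cases "A = {}")
  case False
  have "(SUP a\<in>A. f a) = Max (f ` A)" using assms False by (simp add: Max_Sup)
  then have "(SUP a\<in>A. f a) \<in> f ` A" using assms False Max_in[of "f ` A"] by simp
  then obtain a where a: "a \<in> A" "(SUP a\<in>A. f a) = f a" by auto
  show ?thesis
  proof (rule antisym)
    show "npow r (SUP a\<in>A. f a) \<le> (SUP a\<in>A. npow r (f a))"
      unfolding a(2) using a(1) by (rule SUP_upper)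
    show "(SUP a\<in>A. npow r (f a)) \<le> npow r (SUP a\<in>A. f a)"
      by (intro SUP_least npow_mono assms(2) SUP_upper)
  qed
qed (simp add: bot_ennreal)

lemma seq_norm_coef_sup_le:
  assumes p: "1 \<le> p" and fin: "\<And>j. finite {l\<in>\<Lambda>. floor_vec l = j}"
  shows "seq_norm p (coef_sup \<Lambda> c) \<le> Lp_norm (count_space \<Lambda>) p c"
proof (cases "p = \<infinity>")
  case True
  have "ennreal (cmod (c l)) \<le> esssup (count_space \<Lambda>) (\<lambda>l. ennreal (cmod (c l)))" if "l \<in> \<Lambda>" for l
    using esssup_AE[where M = "count_space \<Lambda>" and f = "\<lambda>l. ennreal (cmod (c l))"] that by (simp add: AE_count_space)
  then show ?thesis using True
    by (auto simp: seq_norm_def Lp_norm_def coef_sup_def intro!: SUP_least)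
next
  case False
  define r where "r = enn2real p"
  have r: "1 \<le> r" using enn2real_ge_1[OF p False] by (simp add: r_def)
  have "npow r (coef_sup \<Lambda> c j) = coef_sup \<Lambda> (\<lambda>l. of_real (cmod (c l) powr r)) j" for j
    using r unfolding coef_sup_def by (subst npow_SUP_finite[OF fin]) (auto simp: npow_ennreal)
  then have "nsum (\<lambda>j. npow r (coef_sup \<Lambda> c j)) \<le> (\<integral>\<^sup>+l. npow r (ennreal (cmod (c l))) \<partial>count_space \<Lambda>)"
    using nsum_coef_sup_le[of \<Lambda> "\<lambda>l. of_real (cmod (c l) powr r)"] by (simp add: npow_ennreal)
  then show ?thesis
    using False r by (simp add: Lp_norm_eq_npow seq_norm_def r_def[symmetric] npow_mono)
qed

lemma finite_support_lp_space:
  assumes p: "1 \<le> p" and c: "finite {l. c l \<noteq> 0}" "{l. c l \<noteq> 0} \<subseteq> \<Lambda>"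
  shows "c \<in> lp_space p \<Lambda>"
proof -
  have "Lp_norm (count_space \<Lambda>) p c < \<infinity>"
  proof (cases "p = \<infinity>")
    case True
    have "esssup (count_space \<Lambda>) (\<lambda>l. ennreal (cmod (c l))) \<le> ennreal (\<Sum>l | c l \<noteq> 0. cmod (c l))"
    proof (intro esssup_I AE_I2 ennreal_leI)
      fix l show "cmod (c l) \<le> (\<Sum>l | c l \<noteq> 0. cmod (c l))"
        using c(1) by (cases "c l = 0") (auto intro!: member_le_sum sum_nonneg)
    qed simp
    then show ?thesis using True by (simp add: Lp_norm_def le_less_trans)
  next
    case False
    have "(\<integral>\<^sup>+l. npow r (ennreal (cmod (c l))) \<partial>count_space \<Lambda>) = (\<Sum>l | c l \<noteq> 0. npow r (ennreal (cmod (c l))))" for r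
      using c by (intro nn_integral_count_space') auto
    also have "\<dots> r < top" for r by (simp add: npow_ennreal)
    finally have "(\<integral>\<^sup>+l. npow r (ennreal (cmod (c l))) \<partial>count_space \<Lambda>) < top" for r .
    then show ?thesis unfolding Lp_norm_eq_npow[OF False] by (simp add: less_top[symmetric])
  qed
  then show ?thesis using c(2) by (auto simp: lp_space_def)
qed

section \<open>Localized families\<close>

lemma grid_cell_diameter:
  fixes x y :: "real^'n"
  assumes q: "0 < q" and eq: "floor_vec (real q *\<^sub>R x) = floor_vec (real q *\<^sub>R y)"
  shows "norm (x - y) \<le> real CARD('n) / real q"
proof -
  have "\<bar>(x - y) $ i\<bar> \<le> 1 / real q" for i
  proof -
    have "\<lfloor>real q * x $ i\<rfloor> = \<lfloor>real q * y $ i\<rfloor>"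
      using arg_cong[OF eq, of "\<lambda>v. v $ i"] by simp
    then have "\<bar>real q * x $ i - real q * y $ i\<bar> \<le> 1" by linarith
    then have "real q * \<bar>x $ i - y $ i\<bar> \<le> 1" by (simp add: right_diff_distrib[symmetric] abs_mult)
    then show ?thesis using q by (simp add: pos_le_divide_eq mult.commute)
  qed
  then have "(\<Sum>i\<in>UNIV. \<bar>(x - y) $ i\<bar>) \<le> real CARD('n) * (1 / real q)"
    by (intro sum_bounded_above) auto
  then show ?thesis using norm_le_l1_cart[of "x - y"] by simp
qed

text \<open>Relative separation enters as a bound \<open>R\<close> for the number of points in a
  unit cell.\<close>

locale localized_family =
  fixes \<Lambda> :: "(real^'n) set" and \<phi> :: "real^'n \<Rightarrow> real^'n \<Rightarrow> complex" and R :: nat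
  assumes fibre_finite: "finite {l\<in>\<Lambda>. floor_vec l = j}"
    and fibre_card: "card {l\<in>\<Lambda>. floor_vec l = j} \<le> R"
    and envelope: "wiener_norm (\<lambda>x. SUP l\<in>\<Lambda>. ennreal (cmod (\<phi> l (x + l)))) < \<infinity>"
    and modulus: "((\<lambda>\<delta>. wiener_norm (\<lambda>x. SUP l\<in>\<Lambda>. modulus_of_continuity \<delta> (\<phi> l) (x + l)))
            \<longlongrightarrow> 0) (at_right 0)"
begin

text \<open>The enlargement allows \<open>\<phi> l x\<close> to be bounded through the cells of
  \<open>x\<close> and \<open>l\<close> separately, by the entry at their difference;
  \<open>osc\<close> does the same for increments of \<open>\<phi> l\<close>.\<close>

definition env :: "int^'n \<Rightarrow> ennreal" where
  "env = enlarge (cell_sup (\<lambda>x. SUP l\<in>\<Lambda>. ennreal (cmod (\<phi> l (x + l)))))"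

definition osc :: "real \<Rightarrow> int^'n \<Rightarrow> ennreal" where
  "osc \<delta> = enlarge (cell_sup (\<lambda>x. SUP l\<in>\<Lambda>. modulus_of_continuity \<delta> (\<phi> l) (x + l)))"

text \<open>The entry in row \<open>i\<close> and column \<open>l\<close> of the matrix
  \<open>A\<close>.\<close>

definition sample :: "(int^'n \<Rightarrow> real^'n \<Rightarrow> real) \<Rightarrow> int^'n \<Rightarrow> real^'n \<Rightarrow> complex" where
  "sample h i l = (\<integral>x. h i x *\<^sub>R \<phi> l x \<partial>lborel)"

text \<open>The entries of \<open>A c\<close> live on the fine grid. Adding their absolute values
  over the grid cells inside one unit cell gives a sequence on the same lattice as
  \<open>coef_sup\<close>, so that one window acts on both.\<close>

definition block_sample ::
    "nat \<Rightarrow> (int^'n \<Rightarrow> real^'n \<Rightarrow> real) \<Rightarrow> (real^'n \<Rightarrow> complex) \<Rightarrow> int^'n \<Rightarrow> ennreal" where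
  "block_sample q h c k = nsum (\<lambda>i. if block_index q i = k
     then ennreal (cmod (\<Sum>l | c l \<noteq> 0. c l * sample h i l)) else 0)"

lemma countable_index: "countable \<Lambda>"
  using fibre_finite by (rule countable_of_finite_fibres)

lemma nn_integral_index_le: "A \<subseteq> \<Lambda> \<Longrightarrow> (\<integral>\<^sup>+l. X (floor_vec l) \<partial>count_space A) \<le> of_nat R * nsum X"
proof (rule nn_integral_fibres_le)
  fix j assume A: "A \<subseteq> \<Lambda>"
  then have sub: "{a \<in> A. floor_vec a = j} \<subseteq> {l \<in> \<Lambda>. floor_vec l = j}" by auto
  then show "finite {a \<in> A. floor_vec a = j}" using fibre_finite by (rule finite_subset)
  show "card {a \<in> A. floor_vec a = j} \<le> R"
    using card_mono[OF fibre_finite sub] fibre_card by (rule order_trans)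
qed

lemma sum_index_le: "finite F \<Longrightarrow> F \<subseteq> \<Lambda> \<Longrightarrow> (\<Sum>l\<in>F. X (floor_vec l)) \<le> of_nat R * nsum X"
  using nn_integral_index_le[of F X] by (simp add: nn_integral_count_space_finite)

lemma nsum_env: "nsum env < top"
  using envelope unfolding env_def nsum_enlarge wiener_norm_eq_nsum
  by (simp add: ennreal_mult_less_top of_nat_less_top)

lemma env_ge:
  assumes "l \<in> \<Lambda>"
  shows "ennreal (cmod (\<phi> l x)) \<le> env (floor_vec x - floor_vec l)"
proof -
  let ?h = "\<lambda>x. SUP l\<in>\<Lambda>. ennreal (cmod (\<phi> l (x + l)))"
  have "ennreal (cmod (\<phi> l x)) \<le> ?h (x - l)"
    using SUP_upper[OF assms, of "\<lambda>l'. ennreal (cmod (\<phi> l' ((x - l) + l')))"] by simp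
  also have "\<dots> \<le> cell_sup ?h (floor_vec (x - l))" by (rule cell_sup_ge) simp
  also have "\<dots> \<le> env (floor_vec x - floor_vec l)"
    unfolding env_def by (rule le_enlarge) (rule floor_vec_diff)
  finally show ?thesis .
qed

lemma osc_ge:
  assumes "l \<in> \<Lambda>" "norm (y - x) \<le> \<delta>"
  shows "ennreal (cmod (\<phi> l y - \<phi> l x)) \<le> osc \<delta> (floor_vec x - floor_vec l)"
proof -
  let ?h = "\<lambda>x. SUP l\<in>\<Lambda>. modulus_of_continuity \<delta> (\<phi> l) (x + l)"
  have "ennreal (cmod (\<phi> l y - \<phi> l x)) \<le> modulus_of_continuity \<delta> (\<phi> l) x"
    unfolding modulus_of_continuity_def
    by (rule SUP_upper2[of "y - x"]) (use assms in auto)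
  also have "\<dots> \<le> ?h (x - l)"
    using SUP_upper[OF assms(1), of "\<lambda>l'. modulus_of_continuity \<delta> (\<phi> l') ((x - l) + l')"] by simp
  also have "\<dots> \<le> cell_sup ?h (floor_vec (x - l))" by (rule cell_sup_ge) simp
  also have "\<dots> \<le> osc \<delta> (floor_vec x - floor_vec l)"
    unfolding osc_def by (rule le_enlarge) (rule floor_vec_diff)
  finally show ?thesis .
qed

lemma ex_small_osc:
  assumes "0 < \<epsilon>"
  obtains \<delta> where "0 < \<delta>" "nsum (osc \<delta>) < \<epsilon>"
proof -
  have "((\<lambda>\<delta>. of_nat (card (lattice_box 2 :: (int^'n) set)) *
      wiener_norm (\<lambda>x. SUP l\<in>\<Lambda>. modulus_of_continuity \<delta> (\<phi> l) (x + l)))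
      \<longlongrightarrow> of_nat (card (lattice_box 2 :: (int^'n) set)) * 0) (at_right 0)"
    by (intro ennreal_tendsto_cmult modulus of_nat_less_top)
  then have "((\<lambda>\<delta>. nsum (osc \<delta>)) \<longlongrightarrow> 0) (at_right 0)"
    by (simp add: osc_def nsum_enlarge wiener_norm_eq_nsum)
  then have "eventually (\<lambda>\<delta>. nsum (osc \<delta>) < \<epsilon>) (at_right 0)"
    using assms by (rule order_tendstoD)
  then have "eventually (\<lambda>\<delta>. nsum (osc \<delta>) < \<epsilon> \<and> 0 < \<delta>) (at_right (0::real))"
    by (intro eventually_conj) (auto simp: eventually_at_right_less)
  then obtain \<delta> where "nsum (osc \<delta>) < \<epsilon>" "0 < \<delta>"
    using eventually_happens'[OF trivial_limit_at_right_real] by blast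
  then show ?thesis by (intro that)
qed

text \<open>Small \<open>osc\<close> means uniform continuity, which is also the source of the
  measurability of \<open>\<phi> l\<close>.\<close>

lemma family_continuous:
  assumes "l \<in> \<Lambda>"
  shows "continuous_on UNIV (\<phi> l)"
  unfolding continuous_on_iff
proof (intro ballI allI impI)
  fix x and e :: real assume e: "0 < e"
  then obtain \<delta> where \<delta>: "0 < \<delta>" "nsum (osc \<delta>) < ennreal e"
    using ex_small_osc[of "ennreal e"] by (auto simp: ennreal_less_zero_iff)
  have "dist (\<phi> l y) (\<phi> l x) < e" if "dist y x < \<delta>" for y
  proof -
    have "ennreal (cmod (\<phi> l y - \<phi> l x)) \<le> osc \<delta> (floor_vec x - floor_vec l)"
      using that by (intro osc_ge assms) (simp add: dist_norm)
    also have "\<dots> \<le> nsum (osc \<delta>)" by (rule nsum_ge)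
    also note \<delta>(2)
    finally show ?thesis using e by (simp add: dist_norm ennreal_less_iff)
  qed
  then show "\<exists>d>0. \<forall>x'\<in>UNIV. dist x' x < d \<longrightarrow> dist (\<phi> l x') (\<phi> l x) < e"
    using \<delta>(1) by blast
qed

lemma family_measurable [measurable]: "l \<in> \<Lambda> \<Longrightarrow> \<phi> l \<in> borel_measurable lborel"
  using borel_measurable_continuous_onI[OF family_continuous] by simp

lemma sample_osc:
  assumes g: "grid_kernels q h B" and q: "0 < q" "real CARD('n) / real q \<le> \<delta>" and l: "l \<in> \<Lambda>"
  shows "ennreal (cmod (\<phi> l x - sample h (floor_vec (real q *\<^sub>R x)) l)) \<le> osc \<delta> (floor_vec x - floor_vec l)"
  unfolding sample_def
proof (rule kernel_average_bound(1))
  fix y assume "h (floor_vec (real q *\<^sub>R x)) y \<noteq> 0"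
  then have "floor_vec (real q *\<^sub>R y) = floor_vec (real q *\<^sub>R x)" by (rule grid_kernelsD(3)[OF g])
  then have "norm (y - x) \<le> \<delta>" using grid_cell_diameter[OF q(1)] q(2) by (meson order_trans)
  then show "ennreal (cmod (\<phi> l x - \<phi> l y)) \<le> osc \<delta> (floor_vec x - floor_vec l)"
    using osc_ge[OF l, of y x] by (simp add: norm_minus_commute)
qed (use l grid_kernelsD[OF g] in auto)

lemma
  assumes g: "grid_kernels q h B" and q: "0 < q" and l: "l \<in> \<Lambda>"
  shows sample_env: "ennreal (cmod (sample h i l)) \<le> env (block_index q i - floor_vec l)"
    and integrable_sample: "integrable lborel (\<lambda>x. h i x *\<^sub>R \<phi> l x)"
proof -
  have b: "ennreal (cmod (0 - \<phi> l y)) \<le> env (block_index q i - floor_vec l)" if "h i y \<noteq> 0" for y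
    using env_ge[OF l, of y] block_index_floor_vec[OF q, of y] grid_kernelsD(3)[OF g that] by simp
  have "ennreal (cmod (0 - (\<integral>x. h i x *\<^sub>R \<phi> l x \<partial>lborel))) \<le> env (block_index q i - floor_vec l)"
    by (rule kernel_average_bound(1)) (use l grid_kernelsD[OF g] b in auto)
  then show "ennreal (cmod (sample h i l)) \<le> env (block_index q i - floor_vec l)"
    by (simp add: sample_def)
  have "env (block_index q i - floor_vec l) < top"
    using nsum_ge[of env] nsum_env by (rule le_less_trans)
  then show "integrable lborel (\<lambda>x. h i x *\<^sub>R \<phi> l x)"
    by (rule kernel_average_bound(2)[where v = 0, rotated 5]) (use l grid_kernelsD[OF g] b in auto)
qed

lemma synthesis_finite:
  assumes "finite {l. c l \<noteq> 0}" "{l. c l \<noteq> 0} \<subseteq> \<Lambda>"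
  shows "synthesis \<Lambda> \<phi> c x = (\<Sum>l | c l \<noteq> 0. c l * \<phi> l x)"
proof -
  have "synthesis \<Lambda> \<phi> c x = (\<Sum>\<^sub>\<infinity>l\<in>{l. c l \<noteq> 0}. c l * \<phi> l x)"
    unfolding synthesis_def using assms by (intro infsum_cong_neutral) auto
  then show ?thesis using assms by simp
qed

text \<open>At \<open>x\<close> each \<open>\<phi> l\<close> is replaced by its average over the
  grid cell of \<open>x\<close>. The averages combine to one entry of \<open>A c\<close>, and the
  errors are controlled by \<open>osc\<close>; \<open>R\<close> accounts for points of
  \<open>\<Lambda>\<close> sharing a unit cell.\<close>

lemma synthesis_pointwise_bound:
  assumes g: "grid_kernels q h B" and q: "0 < q" "real CARD('n) / real q \<le> \<delta>"
    and c: "finite {l. c l \<noteq> 0}" "{l. c l \<noteq> 0} \<subseteq> \<Lambda>"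
  shows "ennreal (cmod (synthesis \<Lambda> \<phi> c x)) \<le> block_sample q h c (floor_vec x)
    + of_nat R * nsum (\<lambda>j. osc \<delta> (floor_vec x - j) * coef_sup \<Lambda> c j)"
proof -
  define i where "i = floor_vec (real q *\<^sub>R x)"
  let ?F = "{l. c l \<noteq> 0}"
  have eq: "synthesis \<Lambda> \<phi> c x = (\<Sum>l\<in>?F. c l * sample h i l) + (\<Sum>l\<in>?F. c l * (\<phi> l x - sample h i l))"
    unfolding synthesis_finite[OF c] by (simp add: sum.distrib[symmetric] algebra_simps)
  have bi: "block_index q i = floor_vec x" by (simp add: i_def block_index_floor_vec q)
  have 1: "ennreal (cmod (\<Sum>l\<in>?F. c l * sample h i l)) \<le> block_sample q h c (floor_vec x)"
    unfolding block_sample_def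
    using nsum_ge[of "\<lambda>i. if block_index q i = floor_vec x
      then ennreal (cmod (\<Sum>l\<in>?F. c l * sample h i l)) else 0" i] bi by simp
  have "ennreal (cmod (\<Sum>l\<in>?F. c l * (\<phi> l x - sample h i l)))
      \<le> ennreal (\<Sum>l\<in>?F. cmod (c l) * cmod (\<phi> l x - sample h i l))"
    by (intro ennreal_leI order_trans[OF norm_sum]) (simp add: norm_mult)
  also have "\<dots> = (\<Sum>l\<in>?F. ennreal (cmod (c l)) * ennreal (cmod (\<phi> l x - sample h i l)))"
    by (simp add: sum_ennreal[symmetric] ennreal_mult')
  also have "\<dots> \<le> (\<Sum>l\<in>?F. coef_sup \<Lambda> c (floor_vec l) * osc \<delta> (floor_vec x - floor_vec l))"
    unfolding i_def using c(2) by (intro sum_mono mult_mono coef_sup_ge sample_osc[OF g q]) auto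
  also have "\<dots> \<le> of_nat R * nsum (\<lambda>j. coef_sup \<Lambda> c j * osc \<delta> (floor_vec x - j))"
    by (rule sum_index_le[OF c])
  finally have 2: "ennreal (cmod (\<Sum>l\<in>?F. c l * (\<phi> l x - sample h i l)))
      \<le> of_nat R * nsum (\<lambda>j. osc \<delta> (floor_vec x - j) * coef_sup \<Lambda> c j)" by (simp add: mult.commute)
  have "ennreal (cmod (synthesis \<Lambda> \<phi> c x)) \<le> ennreal (cmod (\<Sum>l\<in>?F. c l * sample h i l))
      + ennreal (cmod (\<Sum>l\<in>?F. c l * (\<phi> l x - sample h i l)))"
    unfolding eq by (simp add: ennreal_plus[symmetric] ennreal_leI norm_triangle_ineq del: ennreal_plus)
  also have "\<dots> \<le> block_sample q h c (floor_vec x)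
    + of_nat R * nsum (\<lambda>j. osc \<delta> (floor_vec x - j) * coef_sup \<Lambda> c j)" by (rule add_mono[OF 1 2])
  finally show ?thesis .
qed

lemma synthesis_finite_measurable:
  assumes "finite {l. c l \<noteq> 0}" "{l. c l \<noteq> 0} \<subseteq> \<Lambda>"
  shows "synthesis \<Lambda> \<phi> c \<in> borel_measurable lborel"
proof -
  have "(\<lambda>x. \<Sum>l | c l \<noteq> 0. c l * \<phi> l x) \<in> borel_measurable lborel"
    using assms family_measurable by (intro borel_measurable_sum borel_measurable_times) auto
  then show ?thesis using synthesis_finite[OF assms] by (simp cong: measurable_cong)
qed

lemma discrete_stability:
  assumes p: "1 \<le> p" and st: "lp_stable p \<Lambda> \<phi>"
  shows "\<exists>q h B K. 0 < q \<and> grid_kernels q h B \<and>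
    (\<forall>c. finite {l. c l \<noteq> 0} \<longrightarrow> {l. c l \<noteq> 0} \<subseteq> \<Lambda> \<longrightarrow>
      seq_norm p (coef_sup \<Lambda> c) \<le> ennreal K * seq_norm p (block_sample q h c))"
proof -
  obtain C :: real where C: "C > 0" and low: "\<And>c. c \<in> lp_space p \<Lambda> \<Longrightarrow>
      ennreal (inverse C) * Lp_norm (count_space \<Lambda>) p c \<le> Lp_norm lborel p (synthesis \<Lambda> \<phi> c)"
    using st unfolding lp_stable_def by blast
  \<comment> \<open>Chosen to make \<open>C * real R * \<epsilon>\<close> at most 1/2, so that the
    sampling error is absorbed by half of \<open>X\<close>. The summand 1 keeps
    \<open>\<epsilon>\<close> positive when \<open>R = 0\<close>.\<close>
  define \<epsilon> where "\<epsilon> = inverse C * (1 / 2 / (real R + 1))"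
  have "C * real R * \<epsilon> = (C * inverse C) * (real R * (1 / 2 / (real R + 1)))"
    unfolding \<epsilon>_def by (simp only: mult_ac)
  also have "C * inverse C = 1" using C by simp
  also have "1 * (real R * (1 / 2 / (real R + 1))) \<le> 1 / 2" by (simp add: field_simps)
  finally have \<epsilon>2: "C * real R * \<epsilon> \<le> 1 / 2" .
  have "0 < \<epsilon>" using C by (simp add: \<epsilon>_def)
  note \<epsilon> = this \<epsilon>2
  obtain \<delta> where \<delta>: "0 < \<delta>" "nsum (osc \<delta>) < ennreal \<epsilon>"
    using ex_small_osc[of "ennreal \<epsilon>"] \<epsilon>(1) by (auto simp: ennreal_less_zero_iff)
  \<comment> \<open>Grid cells of side \<open>1 / q\<close> have diameter at most
    \<open>CARD('n) / q\<close>, so points sharing one are within \<open>\<delta>\<close>.\<close>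
  obtain q :: nat where q': "real CARD('n) / \<delta> < real q" using reals_Archimedean2 by blast
  have "0 < real CARD('n) / \<delta>" using \<delta>(1) by simp
  then have "0 < q" using q' by linarith
  moreover have "real CARD('n) < real q * \<delta>" using q' \<delta>(1) by (simp add: pos_divide_less_eq)
  ultimately have "0 < q" "real CARD('n) / real q < \<delta>"
    by (simp_all add: pos_divide_less_eq mult.commute)
  then have q: "0 < q" "real CARD('n) / real q \<le> \<delta>" by simp_all
  obtain h :: "int^'n \<Rightarrow> real^'n \<Rightarrow> real" and B where g: "grid_kernels q h B"
    using ex_grid_kernels[OF q(1)] by blast
  have "seq_norm p (coef_sup \<Lambda> c) \<le> ennreal (2 * C) * seq_norm p (block_sample q h c)"
    if c: "finite {l. c l \<noteq> 0}" "{l. c l \<noteq> 0} \<subseteq> \<Lambda>" for c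
  proof -
    define X where "X = seq_norm p (coef_sup \<Lambda> c)"
    define Y where "Y = seq_norm p (block_sample q h c)"
    have "X \<le> Lp_norm (count_space \<Lambda>) p c"
      unfolding X_def by (rule seq_norm_coef_sup_le[OF p fibre_finite])
    then have "ennreal (inverse C) * X \<le> ennreal (inverse C) * Lp_norm (count_space \<Lambda>) p c"
      by (rule mult_left_mono) simp
    also have "\<dots> \<le> Lp_norm lborel p (synthesis \<Lambda> \<phi> c)"
      by (rule low[OF finite_support_lp_space[OF p c]])
    also have "\<dots> \<le> seq_norm p (\<lambda>k. block_sample q h c k + of_nat R * nsum (\<lambda>j. osc \<delta> (k - j) * coef_sup \<Lambda> c j))"
      by (intro Lp_norm_le_seq_norm p synthesis_finite_measurable c synthesis_pointwise_bound[OF g q])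
    also have "\<dots> \<le> Y + of_nat R * (nsum (osc \<delta>) * X)"
      unfolding X_def Y_def
      by (intro order_trans[OF seq_norm_add[OF p]] add_left_mono)
        (auto simp: seq_norm_cmult[OF p] intro!: mult_left_mono seq_norm_convolution p)
    also have "\<dots> \<le> Y + of_nat R * (ennreal \<epsilon> * X)"
      using \<delta>(2) by (intro add_left_mono mult_left_mono mult_right_mono) auto
    finally have XY: "ennreal (inverse C) * X \<le> Y + of_nat R * (ennreal \<epsilon> * X)" .
    \<comment> \<open>Finite support makes \<open>X\<close> finite, without which the error term
      could not be moved to the left side.\<close>
    have "X \<le> nsum (coef_sup \<Lambda> c)" unfolding X_def by (rule seq_norm_le_nsum[OF p])
    also have "\<dots> \<le> (\<integral>\<^sup>+l. ennreal (cmod (c l)) \<partial>count_space \<Lambda>)" by (rule nsum_coef_sup_le)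
    also have "\<dots> = (\<Sum>l | c l \<noteq> 0. ennreal (cmod (c l)))"
      using c by (intro nn_integral_count_space') auto
    also have "\<dots> < top" by simp
    finally obtain x where x: "X = ennreal x" "0 \<le> x" by (cases X) auto
    show ?thesis unfolding X_def[symmetric] Y_def[symmetric]
    proof (cases Y)
      case (real y)
      have nn: "0 \<le> y + real R * (\<epsilon> * x)" using real x \<epsilon>(1) by simp
      have "ennreal (inverse C * x) \<le> ennreal (y + real R * (\<epsilon> * x))"
        using XY x real \<epsilon>(1) C
        by (simp add: ennreal_mult' ennreal_of_nat_eq_real_of_nat)
      then have "inverse C * x \<le> y + real R * (\<epsilon> * x)"
        by (simp only: ennreal_le_iff[OF nn])
      then have "C * (inverse C * x) \<le> C * (y + real R * (\<epsilon> * x))"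
        using C by (intro mult_left_mono) auto
      also have "C * (y + real R * (\<epsilon> * x)) = C * y + (C * real R * \<epsilon>) * x"
        by (simp only: distrib_left mult.assoc)
      also have "\<dots> \<le> C * y + 1 / 2 * x"
        using \<epsilon>(2) x(2) by (intro add_left_mono mult_right_mono)
      finally have *: "C * (inverse C * x) \<le> C * y + 1 / 2 * x" .
      have "C * (inverse C * x) = x" using C by simp
      then have "x \<le> 2 * (C * y)" using * by linarith
      then have "x \<le> 2 * C * y" by (simp only: mult.assoc)
      then show "X \<le> ennreal (2 * C) * Y"
        using x real C by (simp add: ennreal_mult[symmetric] ennreal_leI)
    qed (use C in \<open>simp add: ennreal_mult_top\<close>)
  qed
  with q(1) g show ?thesis by blast
qed

text \<open>In row \<open>i\<close> of block \<open>k\<close> the factor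
  \<open>u (floor_vec l)\<close> is replaced by \<open>u k\<close>, which can be pulled out; the
  differences make up the commutator. \<open>R\<close> accounts for points of
  \<open>\<Lambda>\<close> in one cell and \<open>Q\<close> for the grid cells in one block.\<close>

lemma block_sample_modulated:
  assumes g: "grid_kernels q h B" and q: "0 < q"
    and c: "finite {l. c l \<noteq> 0}" "{l. c l \<noteq> 0} \<subseteq> \<Lambda>"
    and u: "\<And>k. 0 \<le> u k \<and> u k \<le> 1"
  defines "Q \<equiv> card (lattice_box (int q) :: (int^'n) set)"
  shows "block_sample q h (\<lambda>l. of_real (u (floor_vec l)) * c l) k
    \<le> ennreal (u k) * block_sample q h c k
      + commutator_bound (\<lambda>k. of_nat Q * of_nat R * env k) u (coef_sup \<Lambda> c) k"
proof -
  let ?F = "{l. c l \<noteq> 0}" and ?v = "\<lambda>l. of_real (u (floor_vec l)) * c l"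
  define T where "T = of_nat R * nsum (\<lambda>j. ennreal \<bar>u j - u k\<bar> * coef_sup \<Lambda> c j * env (k - j))"
  have pw: "ennreal (cmod (\<Sum>l | ?v l \<noteq> 0. ?v l * sample h i l))
      \<le> ennreal (u k) * ennreal (cmod (\<Sum>l\<in>?F. c l * sample h i l)) + T"
    if i: "block_index q i = k" for i
  proof -
    have "(\<Sum>l | ?v l \<noteq> 0. ?v l * sample h i l) = (\<Sum>l\<in>?F. ?v l * sample h i l)"
      using c by (intro sum.mono_neutral_left) auto
    also have "\<dots> = of_real (u k) * (\<Sum>l\<in>?F. c l * sample h i l)
        + (\<Sum>l\<in>?F. of_real (u (floor_vec l) - u k) * c l * sample h i l)"
      by (simp add: sum_distrib_left sum.distrib[symmetric] algebra_simps)
    finally have eq: "(\<Sum>l | ?v l \<noteq> 0. ?v l * sample h i l) = of_real (u k) * (\<Sum>l\<in>?F. c l * sample h i l)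
        + (\<Sum>l\<in>?F. of_real (u (floor_vec l) - u k) * c l * sample h i l)" .
    have "ennreal (cmod (\<Sum>l\<in>?F. of_real (u (floor_vec l) - u k) * c l * sample h i l))
        \<le> ennreal (\<Sum>l\<in>?F. \<bar>u (floor_vec l) - u k\<bar> * cmod (c l) * cmod (sample h i l))"
      by (intro ennreal_leI order_trans[OF norm_sum] sum_mono)
        (simp only: norm_mult norm_of_real)
    also have "\<dots> = (\<Sum>l\<in>?F. ennreal \<bar>u (floor_vec l) - u k\<bar> * ennreal (cmod (c l)) * ennreal (cmod (sample h i l)))"
      by (simp add: sum_ennreal[symmetric] ennreal_mult)
    also have "\<dots> \<le> (\<Sum>l\<in>?F. ennreal \<bar>u (floor_vec l) - u k\<bar> * coef_sup \<Lambda> c (floor_vec l) * env (k - floor_vec l))"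
      using c(2) sample_env[OF g q, of _ i]
      by (intro sum_mono mult_mono coef_sup_ge) (auto simp: i)
    also have "\<dots> \<le> T" unfolding T_def by (rule sum_index_le[OF c])
    finally have 2: "ennreal (cmod (\<Sum>l\<in>?F. of_real (u (floor_vec l) - u k) * c l * sample h i l)) \<le> T" .
    have "ennreal (cmod (\<Sum>l | ?v l \<noteq> 0. ?v l * sample h i l))
        \<le> ennreal (u k * cmod (\<Sum>l\<in>?F. c l * sample h i l))
          + ennreal (cmod (\<Sum>l\<in>?F. of_real (u (floor_vec l) - u k) * c l * sample h i l))"
    proof -
      have "cmod (of_real (u k) * (\<Sum>l\<in>?F. c l * sample h i l)) = u k * cmod (\<Sum>l\<in>?F. c l * sample h i l)"
        using u[of k] by (simp add: norm_mult)
      then have "cmod (\<Sum>l | ?v l \<noteq> 0. ?v l * sample h i l) \<le> u k * cmod (\<Sum>l\<in>?F. c l * sample h i l)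
          + cmod (\<Sum>l\<in>?F. of_real (u (floor_vec l) - u k) * c l * sample h i l)"
        unfolding eq by (intro order_trans[OF norm_triangle_ineq]) simp
      then show ?thesis using u[of k]
        by (subst ennreal_plus[symmetric, of "u k * cmod (\<Sum>l\<in>?F. c l * sample h i l)"])
          (auto simp del: ennreal_plus intro: ennreal_leI)
    qed
    also have "\<dots> \<le> ennreal (u k) * ennreal (cmod (\<Sum>l\<in>?F. c l * sample h i l)) + T"
      using 2 u[of k] by (intro add_mono) (simp_all add: ennreal_mult)
    finally show ?thesis .
  qed
  have "block_sample q h ?v k \<le> nsum (\<lambda>i. ennreal (u k) * (if block_index q i = k
      then ennreal (cmod (\<Sum>l\<in>?F. c l * sample h i l)) else 0) + T * indicator {i. block_index q i = k} i)"
    unfolding block_sample_def using pw by (intro nsum_mono) auto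
  also have "\<dots> = ennreal (u k) * block_sample q h c k + T * of_nat (card {i. block_index q i = k})"
    using block_index_fibre(1)[OF q, of k]
    by (simp add: nsum_add nsum_cmult block_sample_def nsum_indicator)
  also have "\<dots> \<le> ennreal (u k) * block_sample q h c k + T * of_nat Q"
    unfolding Q_def by (intro add_left_mono mult_left_mono of_nat_mono block_index_fibre(2) q) auto
  also have "T * of_nat Q = (of_nat Q * of_nat R) * nsum (\<lambda>j. ennreal \<bar>u j - u k\<bar> * coef_sup \<Lambda> c j * env (k - j))"
    by (simp add: T_def mult_ac)
  also have "\<dots> = nsum (\<lambda>j. (of_nat Q * of_nat R) * (ennreal \<bar>u j - u k\<bar> * coef_sup \<Lambda> c j * env (k - j)))"
    by (rule nsum_cmult[symmetric])
  also have "\<dots> = commutator_bound (\<lambda>k. of_nat Q * of_nat R * env k) u (coef_sup \<Lambda> c) k"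
    unfolding commutator_bound_def by (intro nn_integral_cong) (simp only: mult_ac)
  finally show ?thesis .
qed

end

section \<open>Dual coefficients\<close>

text \<open>Fubini's theorem for a counting measure, with absolute summability identifying
  \<open>infsum\<close> with the integral over \<open>count_space\<close>.\<close>

lemma integral_infsum_interchange:
  fixes f :: "'i \<Rightarrow> 'a \<Rightarrow> complex"
  assumes I: "countable I" and M: "sigma_finite_measure M"
    and meas: "\<And>i. i \<in> I \<Longrightarrow> f i \<in> borel_measurable M"
    and fin: "(\<integral>\<^sup>+i. \<integral>\<^sup>+x. ennreal (cmod (f i x)) \<partial>M \<partial>count_space I) < \<infinity>"
    and pw: "\<And>x. x \<in> space M \<Longrightarrow> (\<integral>\<^sup>+i. ennreal (cmod (f i x)) \<partial>count_space I) < \<infinity>"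
  shows "integrable M (\<lambda>x. infsum (\<lambda>i. f i x) I)"
    and "(\<integral>x. infsum (\<lambda>i. f i x) I \<partial>M) = infsum (\<lambda>i. \<integral>x. f i x \<partial>M) I"
proof -
  interpret C: sigma_finite_measure "count_space I" by (rule sigma_finite_measure_count_space_countable[OF I])
  interpret M: sigma_finite_measure M by (rule M)
  interpret P: pair_sigma_finite "count_space I" M ..
  have m: "case_prod f \<in> borel_measurable (count_space I \<Otimes>\<^sub>M M)"
    using meas by (intro measurable_pair_measure_countable1 I) auto
  have int: "integrable (count_space I \<Otimes>\<^sub>M M) (case_prod f)"
  proof (rule integrableI_bounded[OF m])
    have "(\<integral>\<^sup>+z. ennreal (norm (case_prod f z)) \<partial>(count_space I \<Otimes>\<^sub>M M))
        = (\<integral>\<^sup>+i. \<integral>\<^sup>+x. ennreal (cmod (f i x)) \<partial>M \<partial>count_space I)"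
      using m by (subst M.nn_integral_fst[symmetric]) auto
    then show "(\<integral>\<^sup>+z. ennreal (norm (case_prod f z)) \<partial>(count_space I \<Otimes>\<^sub>M M)) < \<infinity>"
      using fin by simp
  qed
  have eq: "(\<integral>i. g i \<partial>count_space I) = infsum g I" if "integrable (count_space I) g" for g :: "'i \<Rightarrow> complex"
    using infsetsum_infsum[of g I] that by (simp add: abs_summable_on_def infsetsum_def)
  have pweq: "(\<integral>i. f i x \<partial>count_space I) = infsum (\<lambda>i. f i x) I" if "x \<in> space M" for x
    using pw[OF that] by (intro eq integrableI_bounded) auto
  have "integrable M (\<lambda>x. \<integral>i. f i x \<partial>count_space I)"
    by (rule P.integrable_snd[OF int])
  then show "integrable M (\<lambda>x. infsum (\<lambda>i. f i x) I)"
    by (subst (asm) Bochner_Integration.integrable_cong[OF refl pweq]) auto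
  have "(\<integral>x. infsum (\<lambda>i. f i x) I \<partial>M) = (\<integral>x. \<integral>i. f i x \<partial>count_space I \<partial>M)"
    by (rule Bochner_Integration.integral_cong) (auto simp: pweq)
  also have "\<dots> = (\<integral>i. \<integral>x. f i x \<partial>M \<partial>count_space I)"
    by (rule P.Fubini_integral[OF int])
  also have "\<dots> = infsum (\<lambda>i. \<integral>x. f i x \<partial>M) I"
    by (rule eq) (rule P.integrable_fst[OF int])
  finally show "(\<integral>x. infsum (\<lambda>i. f i x) I \<partial>M) = infsum (\<lambda>i. \<integral>x. f i x \<partial>M) I" .
qed

section \<open>Superpositions of grid bumps\<close>

text \<open>The sum of all \<open>h i x *\<^sub>R b i\<close> in closed form: only the bump of the
  grid cell of \<open>x\<close> can be nonzero at \<open>x\<close>.\<close>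

definition grid_synthesis ::
    "nat \<Rightarrow> (int^'n \<Rightarrow> real^'n \<Rightarrow> real) \<Rightarrow> (int^'n \<Rightarrow> complex) \<Rightarrow> real^'n \<Rightarrow> complex" where
  "grid_synthesis q h b x = h (floor_vec (real q *\<^sub>R x)) x *\<^sub>R b (floor_vec (real q *\<^sub>R x))"

lemma grid_synthesis_bound:
  assumes g: "grid_kernels q h B" and q: "0 < q"
    and b: "\<And>i. cmod (b i) \<le> w (block_index q i)"
  shows "cmod (grid_synthesis q h b x) \<le> B * w (floor_vec x)"
proof -
  let ?i = "floor_vec (real q *\<^sub>R x)"
  have "cmod (grid_synthesis q h b x) = h ?i x * cmod (b ?i)"
    using grid_kernelsD(1)[OF g, of ?i x] by (simp add: grid_synthesis_def)
  also have "\<dots> \<le> B * w (floor_vec x)"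
    using b[of ?i] grid_kernelsD(1,2)[OF g, of ?i x]
    by (intro mult_mono) (auto simp: block_index_floor_vec[OF q])
  finally show ?thesis .
qed

lemma grid_synthesis_oscillation:
  assumes g: "grid_kernels q h B" and q: "0 < q"
    and b: "\<And>i. cmod (b i) \<le> w (block_index q i)"
  shows "cmod (grid_synthesis q h b x - grid_synthesis q h b y)
    \<le> B * norm (x - y) * (w (floor_vec x) + w (floor_vec y))"
proof -
  let ?i = "floor_vec (real q *\<^sub>R x)" and ?j = "floor_vec (real q *\<^sub>R y)"
  have B: "0 \<le> B * norm (x - y)" using grid_kernelsD(4)[OF g, of ?i x y] by linarith
  have wi: "cmod (b ?i) \<le> w (floor_vec x)" "cmod (b ?j) \<le> w (floor_vec y)"
    using b[of ?i] b[of ?j] by (simp_all add: block_index_floor_vec[OF q])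
  then have w0: "0 \<le> w (floor_vec x)" "0 \<le> w (floor_vec y)"
    by (meson norm_ge_zero order_trans)+
  have term_le: "cmod ((h i x - h i y) *\<^sub>R b i) \<le> B * norm (x - y) * cmod (b i)" for i
    using grid_kernelsD(4)[OF g, of i x y] by (auto intro: mult_right_mono)
  show ?thesis
  proof (cases "?i = ?j")
    case True
    then have "grid_synthesis q h b x - grid_synthesis q h b y = (h ?i x - h ?i y) *\<^sub>R b ?i"
      by (simp add: grid_synthesis_def scaleR_diff_left)
    then have "cmod (grid_synthesis q h b x - grid_synthesis q h b y) \<le> B * norm (x - y) * w (floor_vec x)"
      using order_trans[OF term_le[of ?i] mult_left_mono[OF wi(1) B]] by simp
    also have "\<dots> \<le> B * norm (x - y) * (w (floor_vec x) + w (floor_vec y))"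
      using B w0 by (intro mult_left_mono) auto
    finally show ?thesis .
  next
    case False
    \<comment> \<open>Each bump vanishes at the other point, so its value is itself an increment and
      the Lipschitz bound applies, however close the two cells are.\<close>
    then have "h ?i y = 0" "h ?j x = 0"
      using grid_kernelsD(3)[OF g, of ?i y] grid_kernelsD(3)[OF g, of ?j x] by auto
    then have "grid_synthesis q h b x - grid_synthesis q h b y
        = (h ?i x - h ?i y) *\<^sub>R b ?i + (h ?j x - h ?j y) *\<^sub>R b ?j"
      by (simp add: grid_synthesis_def)
    also have "cmod \<dots> \<le> B * norm (x - y) * cmod (b ?i) + B * norm (x - y) * cmod (b ?j)"
      by (intro norm_triangle_le add_mono term_le)
    also have "\<dots> \<le> B * norm (x - y) * w (floor_vec x) + B * norm (x - y) * w (floor_vec y)"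
      by (intro add_mono mult_left_mono wi B)
    finally show ?thesis by (simp add: distrib_left)
  qed
qed

context localized_family
begin

text \<open>The abstract localization with \<open>X = coef_sup \<Lambda> c\<close> and
  \<open>Y = block_sample q h c\<close>. Windowing \<open>X\<close> amounts to windowing
  \<open>c\<close>, so discrete stability can be applied to the windowed sequence, and its blocks
  are windowed blocks of \<open>c\<close> up to a commutator.\<close>

lemma localized_lower_bound:
  assumes p: "1 \<le> p" and g: "grid_kernels q h B" and q: "0 < q"
    and st: "\<forall>c. finite {l. c l \<noteq> 0} \<longrightarrow> {l. c l \<noteq> 0} \<subseteq> \<Lambda> \<longrightarrow>
      seq_norm p (coef_sup \<Lambda> c) \<le> ennreal K * seq_norm p (block_sample q h c)"
  shows "\<exists>W. nsum W < top \<and>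
    (\<forall>c l. finite {l. c l \<noteq> 0} \<longrightarrow> {l. c l \<noteq> 0} \<subseteq> \<Lambda> \<longrightarrow> l \<in> \<Lambda> \<longrightarrow>
      ennreal (cmod (c l)) \<le> nsum (\<lambda>i. W (block_index q i - floor_vec l) *
        ennreal (cmod (\<Sum>l | c l \<noteq> 0. c l * sample h i l))))"
proof -
  define H where "H k = of_nat (card (lattice_box (int q) :: (int^'n) set)) * of_nat R * env k" for k
  have H: "nsum H < top"
    unfolding H_def nsum_cmult using nsum_env by (simp add: ennreal_mult_less_top of_nat_less_top)
  obtain W where W: "nsum W < top" and loc: "\<forall>X Y j. nsum X < top \<longrightarrow>
      (\<forall>u. (\<forall>k. 0 \<le> u k \<and> u k \<le> 1) \<longrightarrow>
        seq_norm p (\<lambda>k. ennreal (u k) * X k) \<le> ennreal K *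
          (seq_norm p (\<lambda>k. ennreal (u k) * Y k) + seq_norm p (commutator_bound H u X))) \<longrightarrow>
      X j \<le> kernel_conv W Y j"
    using localized_stability[OF p H, of K] by blast
  have "ennreal (cmod (c l)) \<le> nsum (\<lambda>i. W (block_index q i - floor_vec l) *
        ennreal (cmod (\<Sum>l | c l \<noteq> 0. c l * sample h i l)))"
    if c: "finite {l. c l \<noteq> 0}" "{l. c l \<noteq> 0} \<subseteq> \<Lambda>" and l: "l \<in> \<Lambda>" for c l
  proof -
    have "nsum (coef_sup \<Lambda> c) \<le> (\<integral>\<^sup>+l. ennreal (cmod (c l)) \<partial>count_space \<Lambda>)" by (rule nsum_coef_sup_le)
    also have "\<dots> = (\<Sum>l | c l \<noteq> 0. ennreal (cmod (c l)))"
      using c by (intro nn_integral_count_space') auto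
    also have "\<dots> < top" by simp
    finally have fin: "nsum (coef_sup \<Lambda> c) < top" .
    have "coef_sup \<Lambda> c (floor_vec l) \<le> kernel_conv W (block_sample q h c) (floor_vec l)"
    proof (rule loc[rule_format, OF fin])
      fix u :: "int^'n \<Rightarrow> real" assume u: "\<And>k. 0 \<le> u k \<and> u k \<le> 1"
      let ?v = "\<lambda>l. of_real (u (floor_vec l)) * c l"
      have v: "finite {l. ?v l \<noteq> 0}" "{l. ?v l \<noteq> 0} \<subseteq> \<Lambda>"
        using c by (auto intro: finite_subset[OF _ c(1)])
      have u0: "0 \<le> u k" for k using u by blast
      have "coef_sup \<Lambda> ?v = (\<lambda>k. ennreal (u k) * coef_sup \<Lambda> c k)"
        by (rule ext) (rule coef_sup_mult[OF u0])
      then have "seq_norm p (\<lambda>k. ennreal (u k) * coef_sup \<Lambda> c k) = seq_norm p (coef_sup \<Lambda> ?v)"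
        by (simp only:)
      also have "\<dots> \<le> ennreal K * seq_norm p (block_sample q h ?v)" by (rule st[rule_format, OF v])
      also have "\<dots> \<le> ennreal K * seq_norm p (\<lambda>k. ennreal (u k) * block_sample q h c k
          + commutator_bound H u (coef_sup \<Lambda> c) k)"
        unfolding H_def using u
        by (intro mult_left_mono seq_norm_mono block_sample_modulated[OF g q c]) auto
      also have "\<dots> \<le> ennreal K * (seq_norm p (\<lambda>k. ennreal (u k) * block_sample q h c k)
          + seq_norm p (commutator_bound H u (coef_sup \<Lambda> c)))"
        by (intro mult_left_mono seq_norm_add p) simp
      finally show "seq_norm p (\<lambda>k. ennreal (u k) * coef_sup \<Lambda> c k) \<le> ennreal K *
          (seq_norm p (\<lambda>k. ennreal (u k) * block_sample q h c k)
          + seq_norm p (commutator_bound H u (coef_sup \<Lambda> c)))" .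
    qed
    also have "\<dots> = nsum (\<lambda>m. nsum (\<lambda>i. W (m - floor_vec l) * (if block_index q i = m
        then ennreal (cmod (\<Sum>l | c l \<noteq> 0. c l * sample h i l)) else 0)))"
      by (simp only: kernel_conv_def block_sample_def nsum_cmult)
    also have "\<dots> = nsum (\<lambda>i. nsum (\<lambda>m. if m = block_index q i
        then W (m - floor_vec l) * ennreal (cmod (\<Sum>l | c l \<noteq> 0. c l * sample h i l)) else 0))"
      by (subst nsum_swap) (intro nn_integral_cong; simp)
    also have "\<dots> = nsum (\<lambda>i. W (block_index q i - floor_vec l) *
        ennreal (cmod (\<Sum>l | c l \<noteq> 0. c l * sample h i l)))"
      by (simp only: nsum_single)
    finally show ?thesis by (rule order_trans[OF coef_sup_ge[OF l]])
  qed
  with W show ?thesis by blast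
qed

text \<open>A unit cell contains boundedly many grid cells, so summability of \<open>W\<close>
  passes to the weights on the grid; the columns of \<open>A\<close> are bounded by the total mass
  of \<open>env\<close>. Duality then applies to each \<open>l0\<close> separately.\<close>

lemma ex_dual_coefficients:
  assumes g: "grid_kernels q h B" and q: "0 < q" and W: "nsum W < top"
    and low: "\<forall>c l. finite {l. c l \<noteq> 0} \<longrightarrow> {l. c l \<noteq> 0} \<subseteq> \<Lambda> \<longrightarrow> l \<in> \<Lambda> \<longrightarrow>
      ennreal (cmod (c l)) \<le> nsum (\<lambda>i. W (block_index q i - floor_vec l) *
        ennreal (cmod (\<Sum>l | c l \<noteq> 0. c l * sample h i l)))"
    and l0: "l0 \<in> \<Lambda>"
  shows "\<exists>b. (\<forall>i. cmod (b i) \<le> 2 * enn2real (W (block_index q i - floor_vec l0))) \<and>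
    (\<forall>l\<in>\<Lambda>. ((\<lambda>i. b i * sample h i l) has_sum (if l = l0 then 1 else 0)) UNIV)"
proof -
  define w where "w i = enn2real (W (block_index q i - floor_vec l0))" for i
  have Wfin: "W k < top" for k using nsum_ge[of W k] W by (rule le_less_trans)
  then have wW: "ennreal (w i) = W (block_index q i - floor_vec l0)" for i by (simp add: w_def)
  have "nsum (\<lambda>i. ennreal (w i)) = nsum (\<lambda>i. W (block_index q i - floor_vec l0))" by (simp add: wW)
  also have "\<dots> \<le> of_nat (card (lattice_box (int q) :: (int^'n) set)) * nsum (\<lambda>k. W (k - floor_vec l0))"
    by (rule nn_integral_fibres_le) (simp_all add: block_index_fibre[OF q])
  also have "\<dots> < top" using W by (simp add: nsum_shift(3) ennreal_mult_less_top of_nat_less_top)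
  finally have wfin: "nsum (\<lambda>i. ennreal (w i)) < top" .
  have w0: "0 \<le> w i" for i by (simp add: w_def)
  have wsum: "w summable_on UNIV" by (rule summable_on_of_nsum[OF w0 wfin])
  have bdd: "bounded (range (\<lambda>i. sample h i l))" if l: "l \<in> \<Lambda>" for l
  proof -
    have "cmod (sample h i l) \<le> enn2real (nsum env)" for i
    proof -
      have "ennreal (cmod (sample h i l)) \<le> nsum env"
        using sample_env[OF g q l, of i] nsum_ge by (rule order_trans)
      then show ?thesis using nsum_env by (cases "nsum env") auto
    qed
    then show ?thesis by (auto simp: bounded_iff)
  qed
  show ?thesis
  proof (rule weighted_l1_duality[of w \<Lambda> "sample h" l0, OF w0 wsum bdd l0])
    fix c :: "real^'n \<Rightarrow> complex"
    assume c: "finite {l. c l \<noteq> 0}" "{l. c l \<noteq> 0} \<subseteq> \<Lambda>"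
    define G where "G i = cmod (\<Sum>l | c l \<noteq> 0. c l * sample h i l)" for i
    have "G i \<le> (\<Sum>l | c l \<noteq> 0. cmod (c l) * enn2real (nsum env))" for i
      unfolding G_def
    proof (intro order_trans[OF norm_sum] sum_mono)
      fix l assume "l \<in> {l. c l \<noteq> 0}"
      then have "l \<in> \<Lambda>" using c by auto
      then have "ennreal (cmod (sample h i l)) \<le> nsum env"
        using sample_env[OF g q, of l i] nsum_ge by (meson order_trans)
      then have "cmod (sample h i l) \<le> enn2real (nsum env)" using nsum_env by (cases "nsum env") auto
      then show "cmod (c l * sample h i l) \<le> cmod (c l) * enn2real (nsum env)"
        by (simp add: norm_mult mult_left_mono)
    qed
    then have sum: "(\<lambda>i. w i * G i) summable_on UNIV"
      by (intro summable_on_comparison_test[OF summable_on_cmult_left[OF wsum]] mult_left_mono w0)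
        (auto simp: w0 G_def)
    have "ennreal (cmod (c l0)) \<le> nsum (\<lambda>i. W (block_index q i - floor_vec l0) * ennreal (G i))"
      unfolding G_def by (rule low[rule_format, OF c l0])
    also have "\<dots> = nsum (\<lambda>i. ennreal (w i * G i))" by (simp add: ennreal_mult w0 wW G_def)
    also have "\<dots> = ennreal (\<Sum>\<^sub>\<infinity>i. w i * G i)"
      by (intro ennreal_infsum_eq_nsum[symmetric] sum mult_nonneg_nonneg w0) (simp add: G_def)
    finally show "cmod (c l0) \<le> (\<Sum>\<^sub>\<infinity>i. w i * cmod (\<Sum>l | c l \<noteq> 0. c l * sample h i l))"
      unfolding G_def by (subst (asm) ennreal_le_iff) (auto intro!: infsum_nonneg simp: w0)
  next
    fix b assume b: "\<And>i. cmod (b i) \<le> 2 * w i"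
      "\<And>l. l \<in> \<Lambda> \<Longrightarrow> ((\<lambda>i. b i * sample h i l) has_sum (if l = l0 then 1 else 0)) UNIV"
    show ?thesis by (intro exI[of _ b] conjI allI ballI b(1)[unfolded w_def] b(2))
  qed
qed

end

section \<open>The dual family\<close>

lemma Lp_norm_finite_bounded:
  assumes p: "1 \<le> p" and c: "c \<in> lp_space p \<Lambda>" and fin: "\<And>j. finite {l\<in>\<Lambda>. floor_vec l = j}"
  obtains K where "0 \<le> K" "\<And>l. l \<in> \<Lambda> \<Longrightarrow> cmod (c l) \<le> K"
proof -
  have "Lp_norm (count_space \<Lambda>) p c < top" using c by (simp add: lp_space_def)
  then obtain K where K: "Lp_norm (count_space \<Lambda>) p c = ennreal K" "0 \<le> K"
    by (cases "Lp_norm (count_space \<Lambda>) p c") auto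
  have "cmod (c l) \<le> K" if "l \<in> \<Lambda>" for l
  proof -
    have "ennreal (cmod (c l)) \<le> coef_sup \<Lambda> c (floor_vec l)" by (rule coef_sup_ge[OF that])
    also have "\<dots> \<le> seq_norm p (coef_sup \<Lambda> c)" by (rule seq_norm_ge[OF p])
    also have "\<dots> \<le> ennreal K"
      unfolding K(1)[symmetric] by (rule seq_norm_coef_sup_le[OF p fin])
    finally show ?thesis using K(2) by simp
  qed
  with K(2) show ?thesis by (rule that)
qed

lemma continuous_grid_synthesis:
  assumes g: "grid_kernels q h B" and q: "0 < q" and b: "\<And>i. cmod (b i) \<le> D"
  shows "continuous_on UNIV (grid_synthesis q h b)"
proof (rule lipschitz_on_continuous_on)
  have D: "0 \<le> D" using b[of undefined] norm_ge_zero order_trans by blast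
  have B: "0 \<le> B" using grid_kernelsD(1,2)[OF g, of undefined undefined] by linarith
  show "(B * (D + D))-lipschitz_on UNIV (grid_synthesis q h b)"
  proof (rule lipschitz_onI)
    fix x y
    show "dist (grid_synthesis q h b x) (grid_synthesis q h b y) \<le> B * (D + D) * dist x y"
      using grid_synthesis_oscillation[OF g q, of b "\<lambda>_. D" x y] b by (simp add: dist_norm mult_ac)
  qed (use B D in simp)
qed

context localized_family
begin

text \<open>A sample is itself an integral against a bump, so exchanging sum and integral turns
  duality of coefficients into duality of functions.\<close>

lemma integral_times_grid_synthesis:
  assumes g: "grid_kernels q h B" and q: "0 < q" and l: "l \<in> \<Lambda>"
    and b: "nsum (\<lambda>i. ennreal (cmod (b i))) < top"
    and dual: "((\<lambda>i. b i * sample h i l) has_sum d) UNIV"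
  shows "(\<integral>x. \<phi> l x * grid_synthesis q h b x \<partial>lborel) = d"
proof -
  define f where "f i x = h i x *\<^sub>R \<phi> l x * b i" for i x
  have h: "0 \<le> h i x" for i x by (rule grid_kernelsD(1)[OF g])
  have zero: "f i x = 0" if "i \<noteq> floor_vec (real q *\<^sub>R x)" for i x
    using that grid_kernelsD(3)[OF g, of i x] by (auto simp: f_def)
  have sum: "infsum (\<lambda>i. f i x) UNIV = \<phi> l x * grid_synthesis q h b x" for x
  proof -
    have "infsum (\<lambda>i. f i x) UNIV = infsum (\<lambda>i. f i x) {floor_vec (real q *\<^sub>R x)}"
      by (rule infsum_cong_neutral) (auto simp: zero)
    then show ?thesis by (simp add: f_def grid_synthesis_def)
  qed
  have meas [measurable]: "f i \<in> borel_measurable lborel" for i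
    unfolding f_def using borel_measurable_integrable[OF integrable_sample[OF g q l, of i]]
    by (intro borel_measurable_times) auto
  have le: "(\<integral>\<^sup>+x. ennreal (cmod (f i x)) \<partial>lborel) \<le> nsum env * ennreal (cmod (b i))" for i
  proof -
    have "ennreal (cmod (f i x)) \<le> (nsum env * ennreal (cmod (b i))) * ennreal (h i x)" for x
    proof -
      have "ennreal (cmod (f i x)) = ennreal (cmod (\<phi> l x)) * ennreal (cmod (b i)) * ennreal (h i x)"
        using h[of i x] by (simp add: f_def norm_mult ennreal_mult mult_ac)
      also have "\<dots> \<le> (nsum env * ennreal (cmod (b i))) * ennreal (h i x)"
        by (intro mult_right_mono order_trans[OF env_ge[OF l, of x] nsum_ge[of env]]) auto
      finally show ?thesis .
    qed
    then have "(\<integral>\<^sup>+x. ennreal (cmod (f i x)) \<partial>lborel) \<le>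
        (\<integral>\<^sup>+x. (nsum env * ennreal (cmod (b i))) * ennreal (h i x) \<partial>lborel)"
      by (intro nn_integral_mono)
    also have "\<dots> = (nsum env * ennreal (cmod (b i))) * (\<integral>\<^sup>+x. ennreal (h i x) \<partial>lborel)"
      using borel_measurable_integrable[OF grid_kernelsD(5)[OF g, of i]] by (intro nn_integral_cmult) auto
    also have "(\<integral>\<^sup>+x. ennreal (h i x) \<partial>lborel) = 1"
      using nn_integral_eq_integral[OF grid_kernelsD(5)[OF g, of i]] h grid_kernelsD(6)[OF g, of i] by simp
    finally show ?thesis by simp
  qed
  have "nsum (\<lambda>i. \<integral>\<^sup>+x. ennreal (cmod (f i x)) \<partial>lborel) \<le> nsum (\<lambda>i. nsum env * ennreal (cmod (b i)))"
    by (intro nsum_mono le)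
  also have "\<dots> < top" using nsum_env b by (simp add: nsum_cmult ennreal_mult_less_top)
  finally have fin: "nsum (\<lambda>i. \<integral>\<^sup>+x. ennreal (cmod (f i x)) \<partial>lborel) < \<infinity>" by simp
  have pw: "nsum (\<lambda>i. ennreal (cmod (f i x))) < \<infinity>" for x
    by (subst nsum_finite_support[of "{floor_vec (real q *\<^sub>R x)}"]) (auto simp: zero)
  have "(\<integral>x. \<phi> l x * grid_synthesis q h b x \<partial>lborel) = infsum (\<lambda>i. \<integral>x. f i x \<partial>lborel) UNIV"
    using integral_infsum_interchange(2)[of UNIV lborel f, OF countable_int_vec sigma_finite_lborel meas fin pw]
    by (simp add: sum)
  also have "(\<lambda>i. \<integral>x. f i x \<partial>lborel) = (\<lambda>i. b i * sample h i l)"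
    by (rule ext) (simp only: f_def sample_def integral_mult_left_zero mult.commute[of "b _"])
  also have "infsum \<dots> UNIV = d" using dual by (rule infsumI)
  finally show ?thesis .
qed

text \<open>For bounded coefficients the synthesis series is absolutely bounded by one constant
  \<open>T\<close> at all points, so integrability of \<open>\<psi>\<close> justifies the exchange
  for every exponent.\<close>

lemma synthesis_times_integral:
  assumes p: "1 \<le> p" and c: "c \<in> lp_space p \<Lambda>"
    and \<psi>: "\<psi> \<in> borel_measurable lborel" "(\<integral>\<^sup>+x. ennreal (cmod (\<psi> x)) \<partial>lborel) < top"
  shows "integrable lborel (\<lambda>x. synthesis \<Lambda> \<phi> c x * \<psi> x)"
    and "(\<integral>x. synthesis \<Lambda> \<phi> c x * \<psi> x \<partial>lborel) = (\<Sum>\<^sub>\<infinity>l\<in>\<Lambda>. c l * (\<integral>x. \<phi> l x * \<psi> x \<partial>lborel))"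
proof -
  obtain K where K: "0 \<le> K" "\<And>l. l \<in> \<Lambda> \<Longrightarrow> cmod (c l) \<le> K"
    using p c fibre_finite by (rule Lp_norm_finite_bounded) blast
  define T where "T = ennreal K * (of_nat R * nsum env)"
  have T: "T < top" using nsum_env by (simp add: T_def ennreal_mult_less_top of_nat_less_top)
  define f where "f l x = c l * \<phi> l x * \<psi> x" for l x
  have meas: "f l \<in> borel_measurable lborel" if "l \<in> \<Lambda>" for l
    unfolding f_def using family_measurable[OF that] \<psi>(1) by (intro borel_measurable_times) auto
  have cphi: "(\<integral>\<^sup>+l. ennreal (cmod (c l * \<phi> l x)) \<partial>count_space \<Lambda>) \<le> T" for x
  proof -
    have "(\<integral>\<^sup>+l. ennreal (cmod (c l * \<phi> l x)) \<partial>count_space \<Lambda>)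
        \<le> (\<integral>\<^sup>+l. ennreal K * env (floor_vec x - floor_vec l) \<partial>count_space \<Lambda>)"
      using K env_ge
      by (intro nn_integral_mono) (auto simp: norm_mult ennreal_mult intro!: mult_mono ennreal_leI)
    also have "\<dots> = ennreal K * (\<integral>\<^sup>+l. env (floor_vec x - floor_vec l) \<partial>count_space \<Lambda>)"
      by (rule nn_integral_cmult) simp
    also have "\<dots> \<le> ennreal K * (of_nat R * nsum (\<lambda>j. env (floor_vec x - j)))"
      by (intro mult_left_mono nn_integral_index_le) auto
    finally show ?thesis by (simp add: T_def nsum_shift(4))
  qed
  have pw: "(\<integral>\<^sup>+l. ennreal (cmod (f l x)) \<partial>count_space \<Lambda>) \<le> T * ennreal (cmod (\<psi> x))" for x
  proof -
    have "(\<integral>\<^sup>+l. ennreal (cmod (f l x)) \<partial>count_space \<Lambda>)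
        = (\<integral>\<^sup>+l. ennreal (cmod (c l * \<phi> l x)) * ennreal (cmod (\<psi> x)) \<partial>count_space \<Lambda>)"
      by (simp add: f_def norm_mult ennreal_mult)
    also have "\<dots> = (\<integral>\<^sup>+l. ennreal (cmod (c l * \<phi> l x)) \<partial>count_space \<Lambda>) * ennreal (cmod (\<psi> x))"
      by (rule nn_integral_multc) simp
    also have "\<dots> \<le> T * ennreal (cmod (\<psi> x))" by (intro mult_right_mono cphi) simp
    finally show ?thesis .
  qed
  have "(\<integral>\<^sup>+l. \<integral>\<^sup>+x. ennreal (cmod (f l x)) \<partial>lborel \<partial>count_space \<Lambda>)
      = (\<integral>\<^sup>+x. \<integral>\<^sup>+l. ennreal (cmod (f l x)) \<partial>count_space \<Lambda> \<partial>lborel)"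
  proof (rule nn_integral_count_space_nn_integral[symmetric, OF countable_index])
    fix l assume "l \<in> \<Lambda>"
    note [measurable] = meas[OF this]
    show "(\<lambda>x. ennreal (cmod (f l x))) \<in> borel_measurable lborel" by measurable
  qed
  also have "\<dots> \<le> (\<integral>\<^sup>+x. T * ennreal (cmod (\<psi> x)) \<partial>lborel)" by (intro nn_integral_mono pw)
  also have "\<dots> = T * (\<integral>\<^sup>+x. ennreal (cmod (\<psi> x)) \<partial>lborel)"
    using \<psi>(1) by (intro nn_integral_cmult) auto
  also have "\<dots> < top" using T \<psi>(2) by (simp add: ennreal_mult_less_top)
  finally have fin: "(\<integral>\<^sup>+l. \<integral>\<^sup>+x. ennreal (cmod (f l x)) \<partial>lborel \<partial>count_space \<Lambda>) < \<infinity>" by simp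
  have pw': "(\<integral>\<^sup>+l. ennreal (cmod (f l x)) \<partial>count_space \<Lambda>) < \<infinity>" for x
    using le_less_trans[OF pw[of x]] T by (simp add: ennreal_mult_less_top)
  have eq: "infsum (\<lambda>l. f l x) \<Lambda> = synthesis \<Lambda> \<phi> c x * \<psi> x" for x
    unfolding f_def synthesis_def by (rule infsum_cmult_left')
  note I = integral_infsum_interchange[OF countable_index sigma_finite_lborel meas fin pw', unfolded eq]
  show "integrable lborel (\<lambda>x. synthesis \<Lambda> \<phi> c x * \<psi> x)" by (rule I(1))
  show "(\<integral>x. synthesis \<Lambda> \<phi> c x * \<psi> x \<partial>lborel) = (\<Sum>\<^sub>\<infinity>l\<in>\<Lambda>. c l * (\<integral>x. \<phi> l x * \<psi> x \<partial>lborel))"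
    using I(2) by (simp add: f_def mult.assoc)
qed

end

lemma wiener_norm_le:
  fixes h :: "real^'n \<Rightarrow> ennreal"
  assumes "\<And>x. h x \<le> C * enlarge W (floor_vec x)"
  shows "wiener_norm h \<le> C * (of_nat (card (lattice_box 2 :: (int^'n) set)) * nsum W)"
proof -
  have "wiener_norm h \<le> nsum (\<lambda>k. C * enlarge W k)"
    unfolding wiener_norm_eq_nsum cell_sup_def using assms by (intro nsum_mono SUP_least) auto
  then show ?thesis by (simp add: nsum_cmult nsum_enlarge)
qed

theorem corollary3p3:
  fixes p :: ennreal
    and \<Lambda> :: "(real^'n) set"
    and \<phi> :: "real^'n \<Rightarrow> real^'n \<Rightarrow> complex"
  assumes "1 \<le> p"
    and "relatively_separated \<Lambda>"
    and "wiener_norm (\<lambda>x. SUP l\<in>\<Lambda>. ennreal (cmod (\<phi> l (x + l)))) < \<infinity>"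
    and "((\<lambda>\<delta>. wiener_norm (\<lambda>x. SUP l\<in>\<Lambda>. modulus_of_continuity \<delta> (\<phi> l) (x + l)))
            \<longlongrightarrow> 0) (at_right 0)"
    and "lp_stable p \<Lambda> \<phi>"
  shows "\<exists>\<psi> :: real^'n \<Rightarrow> real^'n \<Rightarrow> complex.
    wiener_norm (\<lambda>x. SUP l\<in>\<Lambda>. ennreal (cmod (\<psi> l (x + l)))) < \<infinity> \<and>
    ((\<lambda>\<delta>. wiener_norm (\<lambda>x. SUP l\<in>\<Lambda>. modulus_of_continuity \<delta> (\<psi> l) (x + l)))
       \<longlongrightarrow> 0) (at_right 0) \<and>
    bij_betw (synthesis \<Lambda> \<phi>) (lp_space p \<Lambda>) (synthesis_space p \<Lambda> \<phi>) \<and>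
    (\<forall>f\<in>synthesis_space p \<Lambda> \<phi>.
       (\<forall>l\<in>\<Lambda>. integrable lborel (\<lambda>x. f x * \<psi> l x)) \<and>
       the_inv_into (lp_space p \<Lambda>) (synthesis \<Lambda> \<phi>) f =
         (\<lambda>l. if l \<in> \<Lambda> then (\<integral>x. f x * \<psi> l x \<partial>lborel) else 0))"
proof -
  note p = assms(1)
  obtain R where R: "\<And>j. finite {l\<in>\<Lambda>. floor_vec l = j}" "\<And>j. card {l\<in>\<Lambda>. floor_vec l = j} \<le> R"
    using relatively_separated_count[OF assms(2)] by blast
  interpret localized_family \<Lambda> \<phi> R
    by unfold_locales (rule R assms)+
  obtain q h B K where q: "0 < q" and g: "grid_kernels q h B" and st:
    "\<forall>c. finite {l. c l \<noteq> 0} \<longrightarrow> {l. c l \<noteq> 0} \<subseteq> \<Lambda> \<longrightarrow>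
      seq_norm p (coef_sup \<Lambda> c) \<le> ennreal K * seq_norm p (block_sample q h c)"
    using discrete_stability[OF p assms(5)] by blast
  obtain W where W: "nsum W < top" and low:
    "\<forall>c l. finite {l. c l \<noteq> 0} \<longrightarrow> {l. c l \<noteq> 0} \<subseteq> \<Lambda> \<longrightarrow> l \<in> \<Lambda> \<longrightarrow>
      ennreal (cmod (c l)) \<le> nsum (\<lambda>i. W (block_index q i - floor_vec l) *
        ennreal (cmod (\<Sum>l | c l \<noteq> 0. c l * sample h i l)))"
    using localized_lower_bound[OF p g q st] by blast
  have "\<forall>l\<in>\<Lambda>. \<exists>b. (\<forall>i. cmod (b i) \<le> 2 * enn2real (W (block_index q i - floor_vec l))) \<and>
      (\<forall>l'\<in>\<Lambda>. ((\<lambda>i. b i * sample h i l') has_sum (if l' = l then 1 else 0)) UNIV)"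
    using ex_dual_coefficients[OF g q W low] by blast
  from bchoice[OF this] obtain b where b: "\<And>l i. l \<in> \<Lambda> \<Longrightarrow> cmod (b l i) \<le> 2 * enn2real (W (block_index q i - floor_vec l))"
    and dual: "\<And>l l'. l \<in> \<Lambda> \<Longrightarrow> l' \<in> \<Lambda> \<Longrightarrow>
      ((\<lambda>i. b l i * sample h i l') has_sum (if l' = l then 1 else 0)) UNIV"
    by blast
  define \<psi> where "\<psi> l = grid_synthesis q h (b l)" for l
  define w where "w l k = 2 * enn2real (W (k - floor_vec l))" for l k
  have Wfin: "W k < top" for k using nsum_ge[of W k] W by (rule le_less_trans)
  have w: "ennreal (w l k) = 2 * W (k - floor_vec l)" for l k
    using Wfin by (simp add: w_def ennreal_mult)
  have bw: "cmod (b l i) \<le> w l (block_index q i)" if "l \<in> \<Lambda>" for l i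
    using b[OF that] by (simp add: w_def)
  have B: "0 \<le> B" using grid_kernelsD(1,2)[OF g, of undefined undefined] by linarith
  have \<psi>_le: "ennreal (cmod (\<psi> l x)) \<le> ennreal (2 * B) * W (floor_vec x - floor_vec l)" if "l \<in> \<Lambda>" for l x
  proof -
    have "ennreal (cmod (\<psi> l x)) \<le> ennreal (B * w l (floor_vec x))"
      unfolding \<psi>_def by (intro ennreal_leI grid_synthesis_bound[OF g q] bw that)
    also have "\<dots> = ennreal (2 * B) * W (floor_vec x - floor_vec l)"
      using B by (simp add: ennreal_mult' w mult_ac)
    finally show ?thesis .
  qed
  have Wenl: "W (floor_vec (x + l + y) - floor_vec l) \<le> enlarge W (floor_vec x)"
    if "norm y \<le> 1" for x l y :: "real^'n"
    by (rule le_enlarge) (rule floor_vec_add[OF that])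
  have Wenl0: "W (floor_vec (x + l) - floor_vec l) \<le> enlarge W (floor_vec x)" for x l :: "real^'n"
    using Wenl[of 0 x l] by simp
  have env\<psi>: "wiener_norm (\<lambda>x. SUP l\<in>\<Lambda>. ennreal (cmod (\<psi> l (x + l)))) < \<infinity>"
  proof -
    have "(SUP l\<in>\<Lambda>. ennreal (cmod (\<psi> l (x + l)))) \<le> ennreal (2 * B) * enlarge W (floor_vec x)" for x
    proof (rule SUP_least)
      fix l assume l: "l \<in> \<Lambda>"
      show "ennreal (cmod (\<psi> l (x + l))) \<le> ennreal (2 * B) * enlarge W (floor_vec x)"
        using order_trans[OF \<psi>_le[OF l, of "x + l"] mult_left_mono[OF Wenl0[of x l]]] by simp
    qed
    from wiener_norm_le[OF this] show ?thesis
      using W by (simp add: le_less_trans ennreal_mult_less_top of_nat_less_top)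
  qed
  have osc\<psi>: "((\<lambda>\<delta>. wiener_norm (\<lambda>x. SUP l\<in>\<Lambda>. modulus_of_continuity \<delta> (\<psi> l) (x + l))) \<longlongrightarrow> 0) (at_right 0)"
  proof -
    define D where "D = of_nat (card (lattice_box 2 :: (int^'n) set)) * nsum W"
    have D: "D < top" using W by (simp add: D_def ennreal_mult_less_top of_nat_less_top)
    \<comment> \<open>The 4 is the 2 contained in \<open>w\<close>, doubled for the cells of the two
      points compared. The restriction to \<open>\<delta> \<le> 1\<close> matches
      \<open>floor_vec_add\<close>.\<close>
    have le: "wiener_norm (\<lambda>x. SUP l\<in>\<Lambda>. modulus_of_continuity \<delta> (\<psi> l) (x + l)) \<le> D * ennreal (4 * B * \<delta>)"
      if \<delta>: "0 < \<delta>" "\<delta> \<le> 1" for \<delta>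
    proof -
      have "(SUP l\<in>\<Lambda>. modulus_of_continuity \<delta> (\<psi> l) (x + l)) \<le> ennreal (4 * B * \<delta>) * enlarge W (floor_vec x)" for x
        unfolding modulus_of_continuity_def
      proof (intro SUP_least)
        fix l y assume l: "l \<in> \<Lambda>" and y: "y \<in> {y :: real^'n. norm y \<le> \<delta>}"
        let ?x = "x + l"
        have "cmod (\<psi> l (?x + y) - \<psi> l ?x) \<le> B * norm ((?x + y) - ?x) * (w l (floor_vec (?x + y)) + w l (floor_vec ?x))"
          unfolding \<psi>_def by (intro grid_synthesis_oscillation[OF g q] bw l)
        also have "\<dots> \<le> B * \<delta> * (w l (floor_vec (?x + y)) + w l (floor_vec ?x))"
          using y B by (intro mult_right_mono mult_left_mono) (auto simp: w_def)
        finally have "ennreal (cmod (\<psi> l (?x + y) - \<psi> l ?x))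
            \<le> ennreal (B * \<delta> * (w l (floor_vec (?x + y)) + w l (floor_vec ?x)))"
          by (rule ennreal_leI)
        also have "\<dots> = ennreal (B * \<delta>) * (2 * W (floor_vec (?x + y) - floor_vec l) + 2 * W (floor_vec ?x - floor_vec l))"
          using B \<delta> by (simp add: ennreal_mult w[symmetric] w_def)
        also have "\<dots> \<le> ennreal (B * \<delta>) * (2 * enlarge W (floor_vec x) + 2 * enlarge W (floor_vec x))"
          using y \<delta> Wenl[of y x l] Wenl0[of x l]
          by (intro mult_left_mono add_mono) auto
        also have "\<dots> = ennreal (4 * B * \<delta>) * enlarge W (floor_vec x)"
        proof -
          have two: "2 * z + 2 * z = 4 * z" for z :: ennreal
            by (simp add: distrib_right[symmetric])
          have four: "ennreal (4 * B * \<delta>) = 4 * ennreal (B * \<delta>)"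
            using B \<delta> by (simp add: mult.assoc ennreal_mult')
          show ?thesis unfolding two four by (simp only: mult_ac)
        qed
        finally show "ennreal (cmod (\<psi> l (x + l + y) - \<psi> l (x + l))) \<le> ennreal (4 * B * \<delta>) * enlarge W (floor_vec x)" .
      qed
      from wiener_norm_le[OF this] show ?thesis by (simp add: D_def mult.commute)
    qed
    have "((\<lambda>\<delta>. 4 * B * \<delta>) \<longlongrightarrow> 4 * B * 0) (at_right 0)"
      by (intro tendsto_mult tendsto_const tendsto_ident_at)
    then have "((\<lambda>\<delta>. D * ennreal (4 * B * \<delta>)) \<longlongrightarrow> D * ennreal (4 * B * 0)) (at_right 0)"
      by (intro ennreal_tendsto_cmult D tendsto_ennrealI)
    then have lim: "((\<lambda>\<delta>. D * ennreal (4 * B * \<delta>)) \<longlongrightarrow> 0) (at_right 0)" by simp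
    have "eventually (\<lambda>\<delta>::real. 0 < \<delta> \<and> \<delta> \<le> 1) (at_right 0)"
      unfolding eventually_at_right_field by (intro exI[of _ 1]) auto
    then have "eventually (\<lambda>\<delta>. wiener_norm (\<lambda>x. SUP l\<in>\<Lambda>. modulus_of_continuity \<delta> (\<psi> l) (x + l))
        \<le> D * ennreal (4 * B * \<delta>)) (at_right 0)"
      by eventually_elim (rule le; simp)
    then show ?thesis
      by (intro tendsto_sandwich[OF _ _ tendsto_const lim]) auto
  qed
  have sumb: "nsum (\<lambda>i. ennreal (cmod (b l i))) < top" if l: "l \<in> \<Lambda>" for l
  proof -
    have "nsum (\<lambda>i. ennreal (cmod (b l i))) \<le> nsum (\<lambda>i. 2 * W (block_index q i - floor_vec l))"
      unfolding w[symmetric] by (intro nsum_mono ennreal_leI bw l)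
    also have "\<dots> \<le> of_nat (card (lattice_box (int q) :: (int^'n) set)) * nsum (\<lambda>k. 2 * W (k - floor_vec l))"
      by (rule nn_integral_fibres_le) (simp_all add: block_index_fibre[OF q])
    also have "\<dots> < top"
      using W by (simp add: nsum_cmult nsum_shift(3) ennreal_mult_less_top of_nat_less_top)
    finally show ?thesis .
  qed
  have \<psi>_meas: "\<psi> l \<in> borel_measurable lborel" if l: "l \<in> \<Lambda>" for l
  proof -
    have "cmod (b l i) \<le> 2 * enn2real (nsum W)" for i
      using b[OF l, of i] enn2real_mono[OF nsum_ge W, of "block_index q i - floor_vec l"] by linarith
    then have "continuous_on UNIV (\<psi> l)"
      unfolding \<psi>_def by (rule continuous_grid_synthesis[OF g q])
    then show ?thesis by (simp add: borel_measurable_continuous_onI)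
  qed
  have \<psi>_int: "(\<integral>\<^sup>+x. ennreal (cmod (\<psi> l x)) \<partial>lborel) < top" if l: "l \<in> \<Lambda>" for l
  proof -
    have "(\<integral>\<^sup>+x. ennreal (cmod (\<psi> l x)) \<partial>lborel) \<le> (\<integral>\<^sup>+x. ennreal (2 * B) * W (floor_vec x - floor_vec l) \<partial>lborel)"
      by (intro nn_integral_mono \<psi>_le l)
    also have "\<dots> \<le> nsum (\<lambda>k. ennreal (2 * B) * W (k - floor_vec l))"
      by (rule nn_integral_floor_vec_le)
    also have "\<dots> < top" using W by (simp add: nsum_cmult nsum_shift(3) ennreal_mult_less_top)
    finally show ?thesis .
  qed
  have coef: "(\<integral>x. synthesis \<Lambda> \<phi> c x * \<psi> l x \<partial>lborel) = c l" if c: "c \<in> lp_space p \<Lambda>" and l: "l \<in> \<Lambda>" for c l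
  proof -
    have "(\<integral>x. synthesis \<Lambda> \<phi> c x * \<psi> l x \<partial>lborel) = (\<Sum>\<^sub>\<infinity>l'\<in>\<Lambda>. c l' * (\<integral>x. \<phi> l' x * \<psi> l x \<partial>lborel))"
      by (rule synthesis_times_integral(2)[OF p c \<psi>_meas[OF l] \<psi>_int[OF l]])
    also have "\<dots> = (\<Sum>\<^sub>\<infinity>l'\<in>\<Lambda>. c l' * (if l' = l then 1 else 0))"
      unfolding \<psi>_def
      by (intro infsum_cong arg_cong[where f = "\<lambda>z. _ * z"]
          integral_times_grid_synthesis[OF g q _ sumb[OF l] dual[OF l]])
    also have "\<dots> = (\<Sum>\<^sub>\<infinity>l'\<in>{l}. c l' * (if l' = l then 1 else 0))"
      using l by (intro infsum_cong_neutral) auto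
    finally show ?thesis by simp
  qed
  \<comment> \<open>The coefficient formula recovers \<open>c\<close> from its synthesis, which
    settles injectivity for all exponents at once.\<close>
  have inj: "inj_on (synthesis \<Lambda> \<phi>) (lp_space p \<Lambda>)"
  proof (rule inj_onI, rule ext)
    fix c d l
    assume c: "c \<in> lp_space p \<Lambda>" and d: "d \<in> lp_space p \<Lambda>" and eq: "synthesis \<Lambda> \<phi> c = synthesis \<Lambda> \<phi> d"
    show "c l = d l"
    proof (cases "l \<in> \<Lambda>")
      case True
      then show ?thesis using coef[OF c True] coef[OF d True] eq by simp
    qed (use c d in \<open>simp add: lp_space_def\<close>)
  qed
  have "bij_betw (synthesis \<Lambda> \<phi>) (lp_space p \<Lambda>) (synthesis_space p \<Lambda> \<phi>)"
    using inj by (simp add: bij_betw_def synthesis_space_def)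
  moreover have "(\<forall>l\<in>\<Lambda>. integrable lborel (\<lambda>x. f x * \<psi> l x)) \<and>
       the_inv_into (lp_space p \<Lambda>) (synthesis \<Lambda> \<phi>) f =
         (\<lambda>l. if l \<in> \<Lambda> then (\<integral>x. f x * \<psi> l x \<partial>lborel) else 0)"
    if f: "f \<in> synthesis_space p \<Lambda> \<phi>" for f
  proof -
    obtain c where c: "c \<in> lp_space p \<Lambda>" and fc: "f = synthesis \<Lambda> \<phi> c"
      using f by (auto simp: synthesis_space_def)
    have "integrable lborel (\<lambda>x. f x * \<psi> l x)" if l: "l \<in> \<Lambda>" for l
      unfolding fc by (rule synthesis_times_integral(1)[OF p c \<psi>_meas[OF l] \<psi>_int[OF l]])
    moreover have "the_inv_into (lp_space p \<Lambda>) (synthesis \<Lambda> \<phi>) f = c"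
      unfolding fc by (rule the_inv_into_f_f[OF inj c])
    moreover have "c = (\<lambda>l. if l \<in> \<Lambda> then (\<integral>x. f x * \<psi> l x \<partial>lborel) else 0)"
      unfolding fc using coef[OF c] c by (auto simp: lp_space_def)
    ultimately show ?thesis by simp
  qed
  ultimately show ?thesis using env\<psi> osc\<psi> by (intro exI[of _ \<psi>]) blast
qed

end
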